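(* Let $X, Y$ be positive operators and let $\nu \in (0,1]$. Then $$D_{\nu}(X\vert Y) \leq \frac{\mathrm{Tr}[(X-Y)_+]}{\nu}.$$
   Context: Operators act on a Hilbert space, and the traces that appear are assumed to be finite (in particular this covers matrices). For positive operators $X, Y$ (with $\mathrm{Tr}[X], \mathrm{Tr}[Y]$ not required to equal $1$) and $\nu\in(0,1]$, the Tsallis relative entropy is $$D_{\nu}(X\vert Y) = \frac{\mathrm{Tr}[X - X^{1-\nu}Y^{\nu}]}{\nu}.$$ For an operator $A$, $\vert A\vert = (A^*A)^{1/2}$ and $A_+ = \frac{1}{2}(A + \vert A\vert)$. *)

theory Defs
  imports "HOL-Analysis.Analysis" "HOL-Library.Complex_Order"
    "HOL-Computational_Algebra.Polynomial"
begin

text \<open>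
  Complex Hilbert spaces of arbitrary dimension. Completeness comes from \<^class>\<open>banach\<close>; the inner
  product is linear in its second argument and induces the given norm. Operators are plain functions
  subject to \<open>bounded_op\<close>. The order on complex numbers is that of \<^theory>\<open>HOL-Library.Complex_Order\<close>:
  \<open>z \<le> w\<close> says that \<open>w - z\<close> is a nonnegative real.
\<close>

class chilbert_space = banach +
  fixes scaleC :: "complex \<Rightarrow> 'a \<Rightarrow> 'a" (infixr "*\<^sub>C" 75)
    and cinner :: "'a \<Rightarrow> 'a \<Rightarrow> complex"
  assumes scaleC_add_right: "c *\<^sub>C (x + y) = c *\<^sub>C x + c *\<^sub>C y"
    and scaleC_add_left: "(c + d) *\<^sub>C x = c *\<^sub>C x + d *\<^sub>C x"
    and scaleC_scaleC: "c *\<^sub>C d *\<^sub>C x = (c * d) *\<^sub>C x"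
    and scaleC_of_real: "complex_of_real r *\<^sub>C x = r *\<^sub>R x"
    and cinner_commute: "cinner x y = cnj (cinner y x)"
    and cinner_add_right: "cinner x (y + z) = cinner x y + cinner x z"
    and cinner_scaleC_right: "cinner x (c *\<^sub>C y) = c * cinner x y"
    and cinner_self: "cinner x x = complex_of_real ((norm x)\<^sup>2)"

instantiation complex :: chilbert_space
begin

definition scaleC_complex :: "complex \<Rightarrow> complex \<Rightarrow> complex"
  where "scaleC_complex c x = c * x"

definition cinner_complex :: "complex \<Rightarrow> complex \<Rightarrow> complex"
  where "cinner_complex x y = cnj x * y"

instance
proof
  fix x :: complex
  show "cinner x x = complex_of_real ((norm x)\<^sup>2)"
    unfolding cinner_complex_def by (metis complex_norm_square mult.commute)
qed (auto simp: scaleC_complex_def cinner_complex_def algebra_simps scaleR_conv_of_real)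

end

instantiation vec :: (chilbert_space, finite) chilbert_space
begin

definition scaleC_vec :: "complex \<Rightarrow> ('a, 'b) vec \<Rightarrow> ('a, 'b) vec"
  where "scaleC_vec c x = (\<chi> i. c *\<^sub>C (x $ i))"

definition cinner_vec :: "('a, 'b) vec \<Rightarrow> ('a, 'b) vec \<Rightarrow> complex"
  where "cinner_vec x y = (\<Sum>i\<in>UNIV. cinner (x $ i) (y $ i))"

instance
proof
  fix x y z :: "('a, 'b) vec" and c d :: complex and r :: real
  show "c *\<^sub>C (x + y) = c *\<^sub>C x + c *\<^sub>C y" "(c + d) *\<^sub>C x = c *\<^sub>C x + d *\<^sub>C x"
    "c *\<^sub>C d *\<^sub>C x = (c * d) *\<^sub>C x" "complex_of_real r *\<^sub>C x = r *\<^sub>R x"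
    by (simp_all add: scaleC_vec_def vec_eq_iff scaleC_add_right scaleC_add_left
        scaleC_scaleC scaleC_of_real)
  show "cinner x y = cnj (cinner y x)"
    unfolding cinner_vec_def cnj_sum by (intro sum.cong refl cinner_commute)
  show "cinner x (y + z) = cinner x y + cinner x z"
    by (simp add: cinner_vec_def cinner_add_right sum.distrib)
  show "cinner x (c *\<^sub>C y) = c * cinner x y"
    by (simp add: cinner_vec_def scaleC_vec_def cinner_scaleC_right sum_distrib_left)
  show "cinner x x = complex_of_real ((norm x)\<^sup>2)"
    by (simp add: cinner_vec_def cinner_self norm_vec_def L2_set_def sum_nonneg)
qed

end

definition bounded_op :: "('a::chilbert_space \<Rightarrow> 'a) \<Rightarrow> bool"
  where "bounded_op A \<longleftrightarrow> bounded_linear A \<and> (\<forall>c x. A (c *\<^sub>C x) = c *\<^sub>C A x)"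

definition positive_op :: "('a::chilbert_space \<Rightarrow> 'a) \<Rightarrow> bool"
  where "positive_op A \<longleftrightarrow> bounded_op A \<and> (\<forall>x. 0 \<le> cinner x (A x))"

definition adjoint_op :: "('a::chilbert_space \<Rightarrow> 'a) \<Rightarrow> ('a \<Rightarrow> 'a)"
  where "adjoint_op A = (THE B. \<forall>x y. cinner (A x) y = cinner x (B y))"

definition op_spectrum :: "('a::chilbert_space \<Rightarrow> 'a) \<Rightarrow> complex set"
  where "op_spectrum A =
    {c. \<not> (\<exists>B. bounded_op B \<and> (\<forall>x. B (A x - c *\<^sub>C x) = x) \<and> (\<forall>x. A (B x) - c *\<^sub>C B x = x))}"

definition poly_op :: "real poly \<Rightarrow> ('a::chilbert_space \<Rightarrow> 'a) \<Rightarrow> ('a \<Rightarrow> 'a)"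
  where "poly_op p A = (\<lambda>x. \<Sum>i\<le>degree p. coeff p i *\<^sub>R (A ^^ i) x)"

text \<open>
  Continuous functional calculus: \<open>f(A)\<close>, for self-adjoint \<open>A\<close> and real \<open>f\<close> continuous on the
  spectrum of \<open>A\<close> (a compact set of reals), is the operator-norm limit of \<open>p\<^sub>n(A)\<close> whenever the
  polynomials \<open>p\<^sub>n\<close> converge to \<open>f\<close> uniformly on the spectrum.
\<close>

definition fun_op :: "(real \<Rightarrow> real) \<Rightarrow> ('a::chilbert_space \<Rightarrow> 'a) \<Rightarrow> ('a \<Rightarrow> 'a)"
  where "fun_op f A = (THE T. bounded_op T \<and>
    (\<forall>P. uniform_limit {t. complex_of_real t \<in> op_spectrum A} (\<lambda>n. poly (P n)) f sequentially
      \<longrightarrow> (\<lambda>n. onorm (poly_op (P n) A - T)) \<longlonglongrightarrow> 0))"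

text \<open>
  Only used for positive \<open>A\<close> and \<open>s \<ge> 0\<close>. The case distinction gives \<open>A\<^sup>0 = I\<close>, also when \<open>A\<close> is
  not injective, because \<open>0 powr 0 = 0\<close>.
\<close>

definition powr_op :: "('a::chilbert_space \<Rightarrow> 'a) \<Rightarrow> real \<Rightarrow> ('a \<Rightarrow> 'a)"
  where "powr_op A s = fun_op (\<lambda>t. if s = 0 then 1 else t powr s) A"

definition abs_op :: "('a::chilbert_space \<Rightarrow> 'a) \<Rightarrow> ('a \<Rightarrow> 'a)"
  where "abs_op A = powr_op (adjoint_op A \<circ> A) (1/2)"

definition pos_part_op :: "('a::chilbert_space \<Rightarrow> 'a) \<Rightarrow> ('a \<Rightarrow> 'a)"
  where "pos_part_op A = (\<lambda>x. (1/2) *\<^sub>R (A x + abs_op A x))"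

text \<open>Orthonormal bases as maximal orthonormal sets.\<close>

definition is_onb :: "'a::chilbert_space set \<Rightarrow> bool"
  where "is_onb B \<longleftrightarrow> (\<forall>e\<in>B. norm e = 1) \<and> (\<forall>e\<in>B. \<forall>f\<in>B. e \<noteq> f \<longrightarrow> cinner e f = 0) \<and>
    (\<forall>x. (\<forall>e\<in>B. cinner e x = 0) \<longrightarrow> x = 0)"

text \<open>
  \<open>A\<close> has trace \<open>t\<close> if the diagonal of \<open>A\<close> sums (unconditionally, hence absolutely) to the same \<open>t\<close>
  in every orthonormal basis. \<open>trace_op A\<close> is meaningful only if such a \<open>t\<close> exists.
\<close>

definition has_trace :: "('a::chilbert_space \<Rightarrow> 'a) \<Rightarrow> complex \<Rightarrow> bool"
  where "has_trace A t \<longleftrightarrow> (\<forall>B. is_onb B \<longrightarrow> ((\<lambda>e. cinner e (A e)) has_sum t) B)"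

definition finite_trace :: "('a::chilbert_space \<Rightarrow> 'a) \<Rightarrow> bool"
  where "finite_trace A \<longleftrightarrow> (\<exists>t. has_trace A t)"

definition trace_op :: "('a::chilbert_space \<Rightarrow> 'a) \<Rightarrow> complex"
  where "trace_op A = (THE t. has_trace A t)"

definition tsallis_rel_entropy ::
    "real \<Rightarrow> ('a::chilbert_space \<Rightarrow> 'a) \<Rightarrow> ('a \<Rightarrow> 'a) \<Rightarrow> complex"
  where "tsallis_rel_entropy \<nu> X Y =
    trace_op (X - (powr_op X (1 - \<nu>) \<circ> powr_op Y \<nu>)) / complex_of_real \<nu>"

end

theory Submission
  imports Defs "HOL-Computational_Algebra.Fundamental_Theorem_Algebra"
begin

text \<open>
  Put \<open>P = (X - Y)\<^sub>+\<close> and \<open>Z = Y + P\<close>, so that \<open>X \<le> Z\<close> and \<open>Y \<le> Z\<close>. By operator monotonicity of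
  \<open>t\<^bsup>\<nu>\<^esup>\<close> and \<open>t\<^bsup>1-\<nu>\<^esup>\<close>,
  \<open>Tr X\<^bsup>1-\<nu>\<^esup>(X\<^bsup>\<nu>\<^esup> - Y\<^bsup>\<nu>\<^esup>) \<le> Tr X\<^bsup>1-\<nu>\<^esup>(Z\<^bsup>\<nu>\<^esup> - Y\<^bsup>\<nu>\<^esup>) \<le> Tr Z\<^bsup>1-\<nu>\<^esup>(Z\<^bsup>\<nu>\<^esup> - Y\<^bsup>\<nu>\<^esup>)
  = Tr Z - Tr Z\<^bsup>1-\<nu>\<^esup>Y\<^bsup>\<nu>\<^esup> \<le> Tr Z - Tr Y = Tr P\<close>.
  In infinite dimension the traces are handled as squared Hilbert--Schmidt norms, which are invariant
  under taking adjoints; this replaces cyclicity of the trace, and the bounds by powers of \<open>Z\<close> replace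
  Hoelder's inequality.
\<close>

section \<open>Hilbert spaces and Hilbert--Schmidt operators\<close>

text \<open>\<open>trace_op\<close> is a definite description, so each trace must first be shown to
  exist with one value in all orthonormal bases. Two cases are hard: Tr |X - Y|, and the trace of
  X^(1-\<nu>) Y^\<nu>, which is not a positive operator. The latter has to be identified with the
  squared Hilbert-Schmidt norm of X^a Y^b, where a = (1-\<nu>)/2 and b = \<nu>/2, because it is this
  norm that can be estimated. The halved exponents explain the form in which monotonicity is used:
  ||A^s x|| <= ||Z^s x|| for s <= 1/2 is A^(2s) <= Z^(2s) as a norm inequality. It replaces the
  leftmost factor of a Hilbert-Schmidt product, and the rightmost one after passing to adjoints. Z
  enters because X and Y need not be comparable. One interpolation argument serves twice: it gives
  monotonicity of powers, and between the exponents 0 and 1 it gives |<x, D x>| <= <x, |D| x>,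
  whence X <= Z. The functional calculus rests on one estimate, ||p(A)|| <= sup |p| over the real
  spectrum, obtained by factoring p^2 - ||p(A)||^2 over the reals.\<close>

lemma scaleC_zero_right [simp]: "c *\<^sub>C (0::'a::chilbert_space) = 0"
  using scaleC_add_right[of c "0::'a" 0] by simp

lemma cinner_add_left: "cinner (x + y) z = cinner x z + cinner y (z::'a::chilbert_space)"
  by (metis cinner_add_right cinner_commute complex_cnj_add)

lemma cinner_scaleC_left: "cinner (c *\<^sub>C x) y = cnj c * cinner x (y::'a::chilbert_space)"
  by (metis cinner_scaleC_right cinner_commute complex_cnj_mult)

lemma cinner_scaleR_right: "cinner x (r *\<^sub>R y) = r *\<^sub>R cinner x (y::'a::chilbert_space)"
  by (metis cinner_scaleC_right scaleC_of_real scaleR_conv_of_real)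

lemma cinner_scaleR_left: "cinner (r *\<^sub>R x) y = r *\<^sub>R cinner x (y::'a::chilbert_space)"
  by (metis cinner_scaleC_left scaleC_of_real scaleR_conv_of_real complex_cnj_complex_of_real)

lemma Re_cinner_self: "Re (cinner x x) = (norm (x::'a::chilbert_space))\<^sup>2"
  by (simp add: cinner_self)

lemma Re_cinner_commute: "Re (cinner x y) = Re (cinner y (x::'a::chilbert_space))"
  by (subst cinner_commute) simp

lemma norm_cinner_commute: "norm (cinner x y) = norm (cinner y (x::'a::chilbert_space))"
  by (subst cinner_commute) simp

lemma norm_add_sq:
  "(norm (x + y))\<^sup>2 = (norm x)\<^sup>2 + (norm y)\<^sup>2 + 2 * Re (cinner x (y::'a::chilbert_space))"
proof -
  have "(norm (x + y))\<^sup>2 = Re (cinner (x + y) (x + y))"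
    by (simp add: Re_cinner_self)
  also have "\<dots> = (norm x)\<^sup>2 + (norm y)\<^sup>2 + Re (cinner x y) + Re (cinner y x)"
    by (simp add: cinner_add_left cinner_add_right Re_cinner_self)
  finally show ?thesis
    using Re_cinner_commute[of x y] by simp
qed

lemma norm_scaleC: "norm (c *\<^sub>C x) = norm c * norm (x::'a::chilbert_space)"
proof -
  have "complex_of_real ((norm (c *\<^sub>C x))\<^sup>2) = (cnj c * c) * cinner x x"
    unfolding cinner_self[symmetric] cinner_scaleC_left cinner_scaleC_right by (simp only: mult.assoc mult.left_commute)
  also have "\<dots> = complex_of_real ((norm c * norm x)\<^sup>2)"
    by (simp add: cinner_self power_mult_distrib complex_norm_square mult.commute del: of_real_power)
  finally have "(norm (c *\<^sub>C x))\<^sup>2 = (norm c * norm x)\<^sup>2"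
    using of_real_eq_iff by blast
  then show ?thesis
    by (simp add: power2_eq_iff_nonneg)
qed

lemma Cauchy_Schwarz: "norm (cinner x y) \<le> norm x * norm (y::'a::chilbert_space)"
proof (cases "x = 0 \<or> y = 0")
  case True
  then show ?thesis
    using cinner_scaleR_right[of x 0 0] cinner_scaleR_left[of 0 0 y] by auto
next
  case False
  \<comment> \<open>\<open>u\<close> is the phase that turns \<open>cinner x y\<close> into its
    modulus. The value 1 for a vanishing product keeps \<open>norm u = 1\<close>, since
    \<open>sgn 0 = 0\<close>.\<close>
  define u where "u = (if cinner x y = 0 then 1 else cnj (sgn (cinner x y)))"
  have nu: "norm u = 1"
    by (simp add: u_def norm_sgn)
  have "cnj (sgn z) * z = norm z" for z :: complex
    using complex_norm_square[of z]
    by (cases "z = 0") (simp_all add: sgn_eq power2_eq_square mult.commute nonzero_divide_eq_eq)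
  then have "u * cinner x y = norm (cinner x y)"
    by (simp add: u_def)
  then have e: "Re (cinner x (u *\<^sub>C y)) = norm (cinner x y)"
    by (simp add: cinner_scaleC_right)
  have "0 \<le> (norm (norm y *\<^sub>R x + (- norm x) *\<^sub>R (u *\<^sub>C y)))\<^sup>2"
    by simp
  also have "\<dots> = 2 * (norm x)\<^sup>2 * (norm y)\<^sup>2 - 2 * (norm x * norm y) * norm (cinner x y)"
    unfolding norm_add_sq cinner_scaleR_left cinner_scaleR_right
    using e nu by (simp add: norm_scaleC power_mult_distrib)
  finally have "(norm x * norm y) * norm (cinner x y) \<le> (norm x * norm y) * (norm x * norm y)"
    by (simp add: power2_eq_square algebra_simps)
  then show ?thesis
    using False by simp
qed

lemma bounded_bilinear_cinner:
  "bounded_bilinear (cinner :: 'a::chilbert_space \<Rightarrow> 'a \<Rightarrow> complex)"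
  by unfold_locales
    (auto simp: cinner_add_left cinner_add_right cinner_scaleR_left cinner_scaleR_right
      intro!: exI[of _ 1] Cauchy_Schwarz)

interpretation cinner: bounded_bilinear "cinner :: 'a::chilbert_space \<Rightarrow> 'a \<Rightarrow> complex"
  by (rule bounded_bilinear_cinner)

lemma norm_diff_sq:
  "(norm (x - y))\<^sup>2 = (norm x)\<^sup>2 + (norm y)\<^sup>2 - 2 * Re (cinner x (y::'a::chilbert_space))"
  using norm_add_sq[of x "- y"] by (simp add: cinner.minus_right)

lemma cinner_eqI:
  assumes "\<And>y. cinner y x = cinner y (x'::'a::chilbert_space)"
  shows "x = x'"
proof -
  have "cinner (x - x') (x - x') = 0"
    by (simp add: cinner.diff_right assms)
  then show ?thesis
    by (simp add: cinner_self)
qed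

text \<open>Adjointness as a relation: the adjoints below are built explicitly from self-adjoint
  operators, so no existence question arises.\<close>

definition adjoint_pair :: "('a::chilbert_space \<Rightarrow> 'a) \<Rightarrow> ('a \<Rightarrow> 'a) \<Rightarrow> bool"
  where "adjoint_pair S T \<longleftrightarrow> (\<forall>x y. cinner (S x) y = cinner x (T y))"

lemma adjoint_pairD: "adjoint_pair S T \<Longrightarrow> cinner (S x) y = cinner x (T y)"
  by (simp add: adjoint_pair_def)

lemma adjoint_pair_sym: "adjoint_pair S T \<Longrightarrow> adjoint_pair T S"
  unfolding adjoint_pair_def by (subst (1 2) cinner_commute) simp

lemma adjoint_pair_comp:
  "adjoint_pair S S' \<Longrightarrow> adjoint_pair R R' \<Longrightarrow> adjoint_pair (\<lambda>x. S (R x)) (\<lambda>x. R' (S' x))"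
  by (simp add: adjoint_pair_def)

lemma adjoint_pair_add:
  "adjoint_pair S S' \<Longrightarrow> adjoint_pair R R' \<Longrightarrow> adjoint_pair (\<lambda>x. S x + R x) (\<lambda>x. S' x + R' x)"
  by (simp add: adjoint_pair_def cinner_add_left cinner_add_right)

lemma adjoint_pair_diff:
  "adjoint_pair S S' \<Longrightarrow> adjoint_pair R R' \<Longrightarrow> adjoint_pair (\<lambda>x. S x - R x) (\<lambda>x. S' x - R' x)"
  by (simp add: adjoint_pair_def cinner.diff_left cinner.diff_right)

lemma adjoint_pair_scaleC:
  "adjoint_pair S S' \<Longrightarrow> adjoint_pair (\<lambda>x. c *\<^sub>C S x) (\<lambda>x. cnj c *\<^sub>C S' x)"
  by (simp add: adjoint_pair_def cinner_scaleC_left cinner_scaleC_right)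

section \<open>Orthonormal bases and Parseval's identity\<close>

text \<open>\<open>has_trace\<close> and \<open>hs\<close> quantify over all orthonormal bases, so
  their values are unique only because a basis exists. A nonzero vector orthogonal to a maximal
  orthonormal set could be normalised and adjoined.\<close>

lemma is_onb_ex: "\<exists>B::'a::chilbert_space set. is_onb B"
proof -
  define \<O> where "\<O> = {B::'a set. (\<forall>e\<in>B. norm e = 1) \<and> (\<forall>e\<in>B. \<forall>f\<in>B. e \<noteq> f \<longrightarrow> cinner e f = 0)}"
  have "\<exists>M\<in>\<O>. \<forall>B\<in>\<O>. M \<subseteq> B \<longrightarrow> B = M"
  proof (rule subset_Zorn)
    fix C assume C: "subset.chain \<O> C"
    have sub: "C \<subseteq> \<O>" and lin: "\<And>A B. A \<in> C \<Longrightarrow> B \<in> C \<Longrightarrow> A \<subseteq> B \<or> B \<subseteq> A"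
      using C by (auto simp: subset_chain_def)
    have "cinner e f = 0" if ef: "e \<in> \<Union>C" "f \<in> \<Union>C" "e \<noteq> f" for e f
    proof -
      obtain A B where AB: "A \<in> C" "B \<in> C" "e \<in> A" "f \<in> B"
        using ef by blast
      then have "(e \<in> A \<and> f \<in> A) \<or> (e \<in> B \<and> f \<in> B)"
        using lin by blast
      then show ?thesis
        using AB sub ef(3) unfolding \<O>_def by blast
    qed
    then have "\<Union>C \<in> \<O>"
      using sub by (auto simp: \<O>_def)
    then show "\<exists>U\<in>\<O>. \<forall>X\<in>C. X \<subseteq> U"
      by blast
  qed
  then obtain M where M: "M \<in> \<O>" "\<And>B. B \<in> \<O> \<Longrightarrow> M \<subseteq> B \<Longrightarrow> B = M"
    by blast
  have "x = 0" if x: "\<forall>e\<in>M. cinner e x = 0" for x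
  proof (rule ccontr)
    assume x0: "x \<noteq> 0"
    define u where "u = (1 / norm x) *\<^sub>R x"
    have u: "norm u = 1" "\<And>e. e \<in> M \<Longrightarrow> cinner e u = 0"
      using x x0 by (auto simp: u_def cinner_scaleR_right)
    then have "\<And>e. e \<in> M \<Longrightarrow> cinner u e = 0"
      by (metis cinner_commute complex_cnj_zero)
    then have "insert u M \<in> \<O>"
      using M(1) u by (auto simp: \<O>_def)
    then have "u \<in> M"
      using M(2) by blast
    then show False
      using u by (metis cinner_self norm_zero of_real_1 one_power2 zero_neq_one)
  qed
  then show ?thesis
    using M(1) by (auto simp: is_onb_def \<O>_def)
qed

lemma cinner_sum_onb:
  assumes B: "is_onb B" and F: "finite F" "F \<subseteq> B" and e: "e \<in> B"
  shows "cinner e (\<Sum>f\<in>F. cinner f x *\<^sub>C f) = (if e \<in> F then cinner e x else 0)"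
proof -
  have "cinner e (\<Sum>f\<in>F. cinner f x *\<^sub>C f) = (\<Sum>f\<in>F. if f = e then cinner e x else 0)"
    unfolding cinner.sum_right
  proof (rule sum.cong)
    fix f assume f: "f \<in> F"
    show "cinner e (cinner f x *\<^sub>C f) = (if f = e then cinner e x else 0)"
      using B F f e by (auto simp: is_onb_def cinner_scaleC_right cinner_self subset_iff)
  qed simp
  also have "\<dots> = (if e \<in> F then cinner e x else 0)"
    using F by simp
  finally show ?thesis .
qed

lemma norm_sum_onb:
  assumes B: "is_onb B" and F: "finite F" "F \<subseteq> B"
  shows "(norm (\<Sum>e\<in>F. cinner e x *\<^sub>C e))\<^sup>2 = (\<Sum>e\<in>F. (norm (cinner e x))\<^sup>2)" (is "(norm ?p)\<^sup>2 = _")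
    and "cinner (\<Sum>e\<in>F. cinner e x *\<^sub>C e) x = (\<Sum>e\<in>F. (norm (cinner e x))\<^sup>2)"
proof -
  have "cinner ?p y = (\<Sum>e\<in>F. cnj (cinner e x) * cinner e y)" for y
    by (simp add: cinner.sum_left cinner_scaleC_left)
  moreover have "cnj z * z = of_real ((norm z)\<^sup>2)" for z
    using complex_norm_square[of z] by (simp add: mult.commute)
  ultimately have *: "cinner ?p x = complex_of_real (\<Sum>e\<in>F. (norm (cinner e x))\<^sup>2)"
    "cinner ?p ?p = cinner ?p x"
    using F cinner_sum_onb[OF assms] by (auto intro!: sum.cong simp: subset_iff)
  show "cinner ?p x = (\<Sum>e\<in>F. (norm (cinner e x))\<^sup>2)"
    using * by simp
  show "(norm ?p)\<^sup>2 = (\<Sum>e\<in>F. (norm (cinner e x))\<^sup>2)"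
    using * unfolding cinner_self using of_real_eq_iff by metis
qed

text \<open>Bases are defined by maximality, so the expansion must come from completeness. Finite
  sets whose coefficient sums approach the total s give a Cauchy sequence of projections of x. Its
  limit has the same coefficients as x, hence equals x, which forces s = ||x||^2.\<close>

lemma Parseval:
  assumes B: "is_onb B"
  shows "((\<lambda>e. (norm (cinner e x))\<^sup>2) has_sum (norm x)\<^sup>2) B"
proof -
  define c where "c e = (norm (cinner e x))\<^sup>2" for e
  define p where "p F = (\<Sum>e\<in>F. cinner e x *\<^sub>C e)" for F
  have np: "(norm (p F))\<^sup>2 = sum c F" and px: "cinner (p F) x = sum c F" if "finite F" "F \<subseteq> B" for F
    using norm_sum_onb[OF B that] by (simp_all add: p_def c_def)
  have Bessel: "sum c F \<le> (norm x)\<^sup>2" if "finite F" "F \<subseteq> B" for F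
  proof -
    have "0 \<le> (norm (x - p F))\<^sup>2"
      by simp
    also have "\<dots> = (norm x)\<^sup>2 - sum c F"
      unfolding norm_diff_sq Re_cinner_commute[of x] using px[OF that] np[OF that] by simp
    finally show ?thesis by simp
  qed
  have summ: "c summable_on B"
    by (rule nonneg_bdd_above_summable_on)
      (auto simp: c_def intro!: bdd_aboveI2[of _ _ "(norm x)\<^sup>2"] Bessel[unfolded c_def])
  define s where "s = infsum c B"
  have hs: "(c has_sum s) B"
    using summ by (simp add: s_def)
  have le_s: "sum c F \<le> s" if "finite F" "F \<subseteq> B" for F
    by (rule finite_sum_le_has_sum[OF hs]) (use that in \<open>auto simp: c_def\<close>)
  have "\<exists>F. finite F \<and> F \<subseteq> B \<and> s - 1 / real (Suc n) < sum c F" for n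
  proof -
    have "eventually (\<lambda>F. s - 1 / real (Suc n) < sum c F) (finite_subsets_at_top B)"
      using hs unfolding has_sum_def by (rule order_tendstoD) simp
    then show ?thesis
      unfolding eventually_finite_subsets_at_top by blast
  qed
  then obtain G where G: "\<And>n. finite (G n)" "\<And>n. G n \<subseteq> B" "\<And>n. s - 1 / real (Suc n) < sum c (G n)"
    by metis
  \<comment> \<open>The unions make the chosen sets increasing, so the difference of two projections
    is the projection for the set difference.\<close>
  define F where "F n = (\<Union>i\<le>n. G i)" for n
  have F: "finite (F n)" "F n \<subseteq> B" "G n \<subseteq> F n" for n
    using G by (auto simp: F_def)
  have Fmono: "F m \<subseteq> F n" if "m \<le> n" for m n
    using that by (force simp: F_def)
  have Fs: "s - 1 / real (Suc n) < sum c (F n)" for n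
    by (rule less_le_trans[OF G(3)] sum_mono2)+ (use F in \<open>auto simp: c_def\<close>)
  have dist_p: "(norm (p (F n) - p (F m)))\<^sup>2 \<le> 1 / real (Suc m)" if "m \<le> n" for m n
  proof -
    have "p (F n) - p (F m) = p (F n - F m)"
      unfolding p_def by (rule sum_diff[OF F(1) Fmono[OF that], symmetric])
    then have "(norm (p (F n) - p (F m)))\<^sup>2 = sum c (F n - F m)"
      using np[of "F n - F m"] F by auto
    also have "\<dots> = sum c (F n) - sum c (F m)"
      using sum_diff[OF F(1) Fmono[OF that]] by simp
    finally show ?thesis
      using Fs[of m] le_s[OF F(1,2), of n] by simp
  qed
  have "Cauchy (\<lambda>n. p (F n))"
  proof (rule metric_CauchyI)
    fix \<epsilon> :: real assume \<epsilon>: "0 < \<epsilon>"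
    obtain N where N: "1 / real (Suc N) < (\<epsilon>/2)\<^sup>2"
      using \<epsilon> nat_approx_posE[of "(\<epsilon>/2)\<^sup>2"] by auto
    have "norm (p (F n) - p (F N)) < \<epsilon>/2" if "N \<le> n" for n
      using dist_p[OF that] N \<epsilon> by (intro power2_less_imp_less[of _ "\<epsilon>/2"]) auto
    then have "dist (p (F m)) (p (F n)) < \<epsilon>" if "N \<le> m" "N \<le> n" for m n
      using dist_triangle_half_l[of "p (F m)" "p (F N)" \<epsilon> "p (F n)"] that by (simp only: dist_norm)
    then show "\<exists>M. \<forall>m\<ge>M. \<forall>n\<ge>M. dist (p (F m)) (p (F n)) < \<epsilon>"
      by blast
  qed
  then obtain l where l: "(\<lambda>n. p (F n)) \<longlonglongrightarrow> l"
    using Cauchy_convergent convergent_def by blast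
  have inl: "cinner e l = cinner e x" if e: "e \<in> B" for e
  proof -
    have lim: "(\<lambda>n. cinner e (p (F n))) \<longlonglongrightarrow> cinner e l"
      by (intro cinner.tendsto tendsto_const l)
    have "eventually (\<lambda>n. cinner e (p (F n)) = cinner e x) sequentially"
    proof (cases "\<exists>n. e \<in> F n")
      case True
      then obtain n where "e \<in> F n" by blast
      then have "e \<in> F m" if "m \<ge> n" for m
        using Fmono[OF that] by blast
      then show ?thesis
        using cinner_sum_onb[OF B F(1,2) e] unfolding p_def eventually_sequentially by auto
    next
      \<comment> \<open>A basis vector outside every \<open>F n\<close> can be added without
        exceeding s, while \<open>F n\<close> misses s by less than 1/(n+1); so its coefficient
        vanishes.\<close>
      case False
      have "sum c (F n) + c e \<le> s" for n
        using le_s[of "insert e (F n)"] F[of n] False e by (simp add: add.commute)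
      then have "c e \<le> 1 / real (Suc n)" for n
        using Fs[of n] add_mono[OF less_imp_le[OF Fs[of n]] order_refl[of "c e"]] \<open>\<And>n. sum c (F n) + c e \<le> s\<close>[of n] by linarith
      then have "c e \<le> 0"
        using nat_approx_posE[of "c e"] by (meson linorder_not_le)
      then have "cinner e x = 0"
        by (simp add: c_def)
      then show ?thesis
        using cinner_sum_onb[OF B F(1,2) e] False unfolding p_def by auto
    qed
    then show ?thesis
      by (rule LIMSEQ_unique[OF lim tendsto_eventually])
  qed
  then have "\<forall>e\<in>B. cinner e (l - x) = 0"
    by (simp add: cinner.diff_right)
  then have "l - x = 0"
    using B unfolding is_onb_def by blast
  then have "(\<lambda>n. (norm (p (F n)))\<^sup>2) \<longlonglongrightarrow> (norm x)\<^sup>2"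
    using l by (auto intro!: tendsto_intros)
  then have lim: "(\<lambda>n. sum c (F n)) \<longlonglongrightarrow> (norm x)\<^sup>2"
    using np F by simp
  have "(norm x)\<^sup>2 \<le> s"
    by (rule LIMSEQ_le_const2[OF lim]) (use le_s F in blast)
  moreover have "s \<le> (norm x)\<^sup>2"
    by (rule has_sum_le_finite_sums[OF hs]) (use Bessel in auto)
  ultimately show ?thesis
    using hs by (simp add: c_def[abs_def])
qed

section \<open>Hilbert-Schmidt norms and cyclicity of the trace\<close>

text \<open>\<open>h\<close> is the squared Hilbert--Schmidt norm of \<open>S\<close>.\<close>

definition hs :: "('a::chilbert_space \<Rightarrow> 'a) \<Rightarrow> real \<Rightarrow> bool"
  where "hs S h \<longleftrightarrow> (\<forall>B. is_onb B \<longrightarrow> ((\<lambda>e. (norm (S e))\<^sup>2) has_sum h) B)"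

lemma hsD: "hs S h \<Longrightarrow> is_onb B \<Longrightarrow> ((\<lambda>e. (norm (S e))\<^sup>2) has_sum h) B"
  by (simp add: hs_def)

lemma hs_unique: "hs S h \<Longrightarrow> hs S h' \<Longrightarrow> h = h'"
  unfolding hs_def using is_onb_ex has_sum_unique by blast

text \<open>Both sums are the double sum of |<f, S e>|^2, evaluated in either order by Parseval.
  This gives invariance under adjoints and, used twice, independence of the basis.\<close>

lemma has_sum_adjoint:
  assumes B: "is_onb B" and B': "is_onb B'" and ST: "adjoint_pair S T"
    and h: "((\<lambda>e. (norm (S e))\<^sup>2) has_sum h) B"
  shows "((\<lambda>f. (norm (T f))\<^sup>2) has_sum h) B'"
proof -
  define g where "g = (\<lambda>(e,f). (norm (cinner f (S e)))\<^sup>2)"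
  have 1: "((\<lambda>f. g (e, f)) has_sum (norm (S e))\<^sup>2) B'" for e
    using Parseval[OF B', of "S e"] by (simp add: g_def)
  have "g summable_on (B \<times> B')"
    by (rule summable_on_SigmaI[OF 1]) (use h in \<open>auto simp: g_def summable_on_def\<close>)
  then have "(g has_sum h) (B \<times> B')"
    by (rule has_sum_SigmaI[OF 1 h])
  then have 2: "((\<lambda>(f,e). g (e,f)) has_sum h) (B' \<times> B)"
    by (subst (asm) has_sum_swap)
  have 3: "((\<lambda>e. (case (f,e) of (f,e) \<Rightarrow> g (e,f))) has_sum (norm (T f))\<^sup>2) B" for f
  proof -
    have "norm (cinner f (S e)) = norm (cinner e (T f))" for e
      using adjoint_pairD[OF ST, of e f] norm_cinner_commute[of f "S e"] by simp
    then show ?thesis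
      using Parseval[OF B, of "T f"] by (simp add: g_def)
  qed
  show ?thesis
    by (rule has_sum_SigmaD[OF 2 3])
qed

text \<open>Passing to the adjoint and back carries the sum from \<open>B\<close> to an arbitrary
  basis, so a single basis decides.\<close>

lemma hsI:
  assumes "is_onb B" "adjoint_pair S T" "((\<lambda>e. (norm (S e))\<^sup>2) has_sum h) B"
  shows "hs S h"
  unfolding hs_def using has_sum_adjoint assms adjoint_pair_sym by metis

lemma hs_adjoint: "hs S h \<Longrightarrow> adjoint_pair S T \<Longrightarrow> hs T h"
  by (meson has_sum_adjoint hs_def is_onb_ex)

lemma hs_mono:
  assumes R: "hs R h" and S: "adjoint_pair S S'" and le: "\<And>x. norm (S x) \<le> norm (R x)"
  obtains h' where "hs S h'" "h' \<le> h"
proof -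
  obtain B :: "'a set" where B: "is_onb B"
    using is_onb_ex by blast
  have le2: "(norm (S x))\<^sup>2 \<le> (norm (R x))\<^sup>2" for x
    using le by (simp add: power_mono)
  have "(\<lambda>e. (norm (S e))\<^sup>2) summable_on B"
    by (rule summable_on_comparison_test[of "\<lambda>e. (norm (R e))\<^sup>2"])
      (use hsD[OF R B] le2 in \<open>auto simp: summable_on_def\<close>)
  then obtain h' where h': "((\<lambda>e. (norm (S e))\<^sup>2) has_sum h') B"
    by (auto simp: summable_on_def)
  have "h' \<le> h"
    by (rule has_sum_mono[OF h' hsD[OF R B]]) (rule le2)
  with hsI[OF B S h'] that show thesis by blast
qed

lemma hs_le:
  assumes "hs R h" "hs S h'" and le: "\<And>x. norm (S x) \<le> norm (R x)"
  shows "h' \<le> h"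
proof -
  obtain B :: "'a set" where B: "is_onb B"
    using is_onb_ex by blast
  show ?thesis
    by (rule has_sum_mono[OF hsD[OF assms(2) B] hsD[OF assms(1) B]]) (use le in \<open>simp add: power_mono\<close>)
qed

lemma hs_cmult:
  assumes "hs S h" shows "hs (\<lambda>x. c *\<^sub>C S x) ((norm c)\<^sup>2 * h)"
  using assms by (auto simp: hs_def norm_scaleC power_mult_distrib intro!: has_sum_cmult_right)

lemma hs_sum:
  assumes "hs S h" "hs R k" and "\<And>x. (norm (T x))\<^sup>2 = (norm (S x))\<^sup>2 + (norm (R x))\<^sup>2"
  shows "hs T (h + k)"
  unfolding hs_def assms(3) using assms(1,2) by (auto simp: hs_def intro!: has_sum_add)

lemma hs_mono_const:
  assumes R: "hs R h" and S: "adjoint_pair S S'" and le: "\<And>x. norm (S x) \<le> C * norm (R x)"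
  obtains h' where "hs S h'"
proof (rule hs_mono[OF hs_cmult[OF R, of "of_real C"] S])
  fix x show "norm (S x) \<le> norm (complex_of_real C *\<^sub>C R x)"
    using le[of x] by (simp add: norm_scaleC) (smt (verit) mult_right_mono norm_ge_zero)
qed (rule that)

lemma hs_add:
  assumes "hs S h" "hs R k" "adjoint_pair S S'" "adjoint_pair R R'"
  obtains j where "hs (\<lambda>x. S x + R x) j"
proof -
  obtain B :: "'a set" where B: "is_onb B"
    using is_onb_ex by blast
  have le: "(norm (S x + R x))\<^sup>2 \<le> 2 * (norm (S x))\<^sup>2 + 2 * (norm (R x))\<^sup>2" for x
    using norm_add_sq[of "S x" "R x"] norm_diff_sq[of "S x" "R x"] zero_le_power2[of "norm (S x - R x)"]
    by linarith
  have "(\<lambda>e. 2 * (norm (S e))\<^sup>2 + 2 * (norm (R e))\<^sup>2) summable_on B"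
    using assms(1,2) B by (intro summable_on_add summable_on_cmult_right) (auto simp: hs_def summable_on_def)
  then have "(\<lambda>e. (norm (S e + R e))\<^sup>2) summable_on B"
    by (rule summable_on_comparison_test) (use le in auto)
  then obtain j where "((\<lambda>e. (norm (S e + R e))\<^sup>2) has_sum j) B"
    by (auto simp: summable_on_def)
  then have "hs (\<lambda>x. S x + R x) j"
    by (rule hsI[OF B adjoint_pair_add[OF assms(3,4)]])
  then show thesis by (rule that)
qed

text \<open>By polarization Re <x, y> is a combination of ||x + y||^2, ||x||^2 and ||y||^2, so the
  real part of Tr S'R is a combination of the Hilbert-Schmidt norms of S + R, S and R. Adjoints have
  the same norms, and for them the same combination is the real part of Tr RS'.\<close>

lemma Re_trace_cyclic:
  assumes S: "hs S h" "adjoint_pair S S'" and R: "hs R k" "adjoint_pair R R'"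
  shows "\<exists>\<tau>. \<forall>B. is_onb B \<longrightarrow> ((\<lambda>e. Re (cinner (S e) (R e))) has_sum \<tau>) B \<and>
    ((\<lambda>e. Re (cinner (R' e) (S' e))) has_sum \<tau>) B"
proof -
  have pol: "Re (cinner x y) = 1/2 * (norm (x + y))\<^sup>2 + -1/2 * ((norm x)\<^sup>2 + (norm y)\<^sup>2)" for x y :: 'a
    unfolding norm_add_sq by argo
  obtain j where j: "hs (\<lambda>x. S x + R x) j"
    using hs_add[OF S(1) R(1) S(2) R(2)] .
  have j': "hs (\<lambda>x. R' x + S' x) j"
    using hs_adjoint[OF j adjoint_pair_add[OF S(2) R(2)]] by (simp add: add.commute)
  note S' = hs_adjoint[OF S] and R' = hs_adjoint[OF R]
  have "((\<lambda>e. Re (cinner (S e) (R e))) has_sum (1/2 * j + -1/2 * (h + k))) B" if "is_onb B" for B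
    unfolding pol by (intro has_sum_add has_sum_cmult_right hsD[OF _ that] j S R)
  moreover have "((\<lambda>e. Re (cinner (R' e) (S' e))) has_sum (1/2 * j + -1/2 * (k + h))) B" if "is_onb B" for B
    unfolding pol by (intro has_sum_add has_sum_cmult_right hsD[OF _ that] j' S' R')
  ultimately show ?thesis
    by (metis add.commute)
qed

lemma trace_cyclic:
  assumes S: "hs S h" "adjoint_pair S S'" and R: "hs R k" "adjoint_pair R R'"
  obtains \<tau> where "\<And>B. is_onb B \<Longrightarrow> ((\<lambda>e. cinner (S e) (R e)) has_sum \<tau>) B"
    "\<And>B. is_onb B \<Longrightarrow> ((\<lambda>e. cinner (R' e) (S' e)) has_sum \<tau>) B"
proof -
  obtain u where u: "\<forall>B. is_onb B \<longrightarrow> ((\<lambda>e. Re (cinner (S e) (R e))) has_sum u) B \<and>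
      ((\<lambda>e. Re (cinner (R' e) (S' e))) has_sum u) B"
    using Re_trace_cyclic[OF assms] by blast
  \<comment> \<open>Multiplying \<open>R\<close> by -i turns the imaginary part of
    \<open>cinner (S e) (R e)\<close> into a real part, so the real case applies again.\<close>
  obtain v where "\<forall>B. is_onb B \<longrightarrow> ((\<lambda>e. Re (cinner (S e) ((-\<i>) *\<^sub>C R e))) has_sum v) B \<and>
      ((\<lambda>e. Re (cinner (cnj (-\<i>) *\<^sub>C R' e) (S' e))) has_sum v) B"
    using Re_trace_cyclic[OF S hs_cmult[OF R(1)] adjoint_pair_scaleC[OF R(2)], of "-\<i>"] by blast
  then have v: "\<forall>B. is_onb B \<longrightarrow> ((\<lambda>e. Im (cinner (S e) (R e))) has_sum v) B \<and>
      ((\<lambda>e. Im (cinner (R' e) (S' e))) has_sum v) B"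
    by (simp add: cinner_scaleC_left cinner_scaleC_right)
  have "((\<lambda>e. of_real (Re (f e)) + \<i> * of_real (Im (f e))) has_sum (of_real u + \<i> * of_real v)) B"
    if "((\<lambda>e. Re (f e)) has_sum u) B" "((\<lambda>e. Im (f e)) has_sum v) B" for f :: "'a \<Rightarrow> complex" and B
    using that by (intro has_sum_add has_sum_cmult_right has_sum_of_real)
  then show thesis
    using that[of "of_real u + \<i> * of_real v"] u v by (simp add: complex_eq[symmetric])
qed

section \<open>Bounded operators and their real spectrum\<close>

lemma bounded_op_linear: "bounded_op A \<Longrightarrow> bounded_linear A"
  by (simp add: bounded_op_def)

lemma bounded_op_at_0: "bounded_op A \<Longrightarrow> A 0 = 0"
  by (simp add: bounded_op_linear linear_simps)

lemma bounded_op_scaleC: "bounded_op A \<Longrightarrow> A (c *\<^sub>C x) = c *\<^sub>C A x"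
  by (simp add: bounded_op_def)

lemma bounded_op_zero: "bounded_op (\<lambda>x. 0::'a::chilbert_space)"
  by (simp add: bounded_op_def)

lemma bounded_op_ident: "bounded_op (\<lambda>x. x::'a::chilbert_space)"
  by (simp add: bounded_op_def bounded_linear_ident)

lemma bounded_op_comp: "bounded_op A \<Longrightarrow> bounded_op B \<Longrightarrow> bounded_op (\<lambda>x. A (B x))"
  by (simp add: bounded_op_def bounded_linear_compose)

lemma bounded_op_add: "bounded_op A \<Longrightarrow> bounded_op B \<Longrightarrow> bounded_op (\<lambda>x. A x + B x)"
  by (simp add: bounded_op_def bounded_linear_add scaleC_add_right)

lemma scaleC_scaleR: "c *\<^sub>C r *\<^sub>R x = r *\<^sub>R c *\<^sub>C (x::'a::chilbert_space)"
  unfolding scaleC_of_real[symmetric] scaleC_scaleC by (simp add: mult.commute)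

lemma scaleC_diff_right: "c *\<^sub>C (x - y) = c *\<^sub>C x - c *\<^sub>C (y::'a::chilbert_space)"
  using scaleC_add_right[of c "x - y" y] by (simp add: algebra_simps)

lemma bounded_op_scaleR: "bounded_op A \<Longrightarrow> bounded_op (\<lambda>x. r *\<^sub>R A x)"
  by (simp add: bounded_op_def bounded_linear_const_scaleR scaleC_scaleR)

lemma bounded_op_diff: "bounded_op A \<Longrightarrow> bounded_op B \<Longrightarrow> bounded_op (\<lambda>x. A x - B x)"
  by (simp add: bounded_op_def bounded_linear_sub scaleC_diff_right)

lemma positive_op_bounded: "positive_op A \<Longrightarrow> bounded_op A"
  by (simp add: positive_op_def)

lemma positive_op_Re_nonneg: "positive_op A \<Longrightarrow> 0 \<le> Re (cinner x (A x))"
  by (simp add: positive_op_def less_eq_complex_def)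

text \<open>The form \<open>q\<close> vanishes on the diagonal because <x, A x> is real. Testing x +
  y makes it antisymmetric, replacing y by \<open>\<i> *\<^sub>C y\<close> then makes it symmetric;
  so it is zero.\<close>

lemma positive_op_adjoint_pair:
  assumes "positive_op A"
  shows "adjoint_pair A A"
proof -
  have A: "bounded_op A"
    using assms by (rule positive_op_bounded)
  interpret A: bounded_linear A
    using A by (rule bounded_op_linear)
  define q where "q x y = cinner x (A y) - cinner (A x) y" for x y
  have q0: "q x x = 0" for x
  proof -
    have "Im (cinner x (A x)) = 0"
      using assms by (simp add: positive_op_def less_eq_complex_def)
    then show ?thesis
      unfolding q_def by (subst (2) cinner_commute) (simp add: complex_eq_iff)
  qed
  have q_add: "q x y + q y x = 0" for x y
    using q0[of "x + y"] q0[of x] q0[of y]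
    by (simp add: q_def A.add cinner_add_left cinner_add_right algebra_simps)
  have "\<i> * q x y - \<i> * q y x = 0" for x y
    using q_add[of x "\<i> *\<^sub>C y"]
    by (simp add: q_def bounded_op_scaleC[OF A] cinner_scaleC_left cinner_scaleC_right algebra_simps)
  then have "q x y = q y x" for x y
    by (metis eq_iff_diff_eq_0 mult_cancel_left complex_i_not_zero)
  then have "q x y = 0" for x y
    using q_add[of x y] by simp
  then show ?thesis
    by (simp add: q_def adjoint_pair_def)
qed

lemma positive_opI:
  assumes "bounded_op A" "adjoint_pair A A" "\<And>x. 0 \<le> Re (cinner x (A x))"
  shows "positive_op A"
proof -
  have "cinner x (A x) = cnj (cinner x (A x))" for x
    using adjoint_pairD[OF assms(2), of x x] cinner_commute[of "A x" x] by simp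
  then have "Im (cinner x (A x)) = 0" for x
    by (metis Im_complex_of_real Reals_cnj_iff complex_is_Real_iff)
  then show ?thesis
    using assms by (simp add: positive_op_def less_eq_complex_def)
qed

lemma poly_op_conv_sum:
  assumes "degree p \<le> n"
  shows "poly_op p A x = (\<Sum>i\<le>n. coeff p i *\<^sub>R (A ^^ i) x)"
  unfolding poly_op_def
  by (rule sum.mono_neutral_left) (use assms in \<open>auto simp: coeff_eq_0\<close>)

lemma poly_op_0 [simp]: "poly_op 0 A x = 0"
  by (simp add: poly_op_def)

lemma poly_op_pCons:
  assumes "bounded_op A"
  shows "poly_op (pCons a p) A x = a *\<^sub>R x + A (poly_op p A x)"
proof -
  interpret A: bounded_linear A
    using assms by (rule bounded_op_linear)
  have "poly_op (pCons a p) A x = (\<Sum>i\<le>Suc (degree p). coeff (pCons a p) i *\<^sub>R (A ^^ i) x)"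
    by (rule poly_op_conv_sum) (simp add: degree_pCons_le)
  also have "\<dots> = a *\<^sub>R x + A (poly_op p A x)"
    unfolding sum.atMost_Suc_shift by (simp add: poly_op_def A.sum A.scaleR)
  finally show ?thesis .
qed

lemma poly_op_const: "bounded_op A \<Longrightarrow> poly_op [:c:] A x = c *\<^sub>R x"
  by (simp add: poly_op_pCons bounded_op_at_0)

lemma bounded_op_poly_op: "bounded_op A \<Longrightarrow> bounded_op (poly_op p A)"
proof (induction p)
  case 0
  have "poly_op 0 A = (\<lambda>x. 0)"
    by (simp add: fun_eq_iff)
  then show ?case by (simp add: bounded_op_zero)
next
  case (pCons a p)
  have "poly_op (pCons a p) A = (\<lambda>x. a *\<^sub>R x + A (poly_op p A x))"
    by (simp add: poly_op_pCons pCons.prems fun_eq_iff)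
  then show ?case
    using pCons by (simp add: bounded_op_add bounded_op_scaleR bounded_op_ident bounded_op_comp)
qed

lemma adjoint_pair_poly_op:
  assumes A: "bounded_op A" "adjoint_pair A A"
  shows "adjoint_pair (poly_op p A) (poly_op p A)"
proof (induction p)
  case 0
  then show ?case by (simp add: adjoint_pair_def cinner.zero_left cinner.zero_right)
next
  case (pCons a p)
  have comm: "poly_op p A (A x) = A (poly_op p A x)" for x
    using bounded_op_linear[OF A(1)]
    by (induction p) (simp_all add: poly_op_pCons A(1) linear_simps)
  show ?case
    using pCons A(2) comm
    by (simp add: adjoint_pair_def poly_op_pCons A(1) cinner_add_left cinner_add_right
        cinner_scaleR_left cinner_scaleR_right)
qed

lemma poly_op_commute:
  assumes A: "bounded_op A" and L: "linear L" and "\<And>x. L (A x) = A (L x)"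
  shows "L (poly_op p A x) = poly_op p A (L x)"
  by (induction p) (simp_all add: poly_op_pCons A linear_0[OF L] linear_add[OF L] linear_scale[OF L] assms(3))

lemma poly_op_add: "bounded_op A \<Longrightarrow> poly_op (p + q) A x = poly_op p A x + poly_op q A x"
  by (induction p q rule: poly_induct2)
    (simp_all add: poly_op_pCons bounded_op_linear linear_simps scaleR_add_left)

lemma poly_op_smult: "bounded_op A \<Longrightarrow> poly_op (smult c p) A x = c *\<^sub>R poly_op p A x"
  by (induction p)
    (simp_all add: poly_op_pCons bounded_op_linear linear_simps scaleR_add_right)

lemma poly_op_diff: "bounded_op A \<Longrightarrow> poly_op (p - q) A x = poly_op p A x - poly_op q A x"
  using poly_op_add[of A "p - q" q x] by simp

lemma poly_op_mult: "bounded_op A \<Longrightarrow> poly_op (p * q) A x = poly_op p A (poly_op q A x)"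
  by (induction p) (simp_all add: poly_op_pCons poly_op_add poly_op_smult bounded_op_linear linear_simps)

section \<open>Approximate eigenvalues and location of the real spectrum\<close>

lemma op_spectrumI:
  assumes "\<And>k. k > 0 \<Longrightarrow> \<exists>x. norm (A x - r *\<^sub>R x) < k * norm x"
  shows "complex_of_real r \<in> op_spectrum A"
proof (rule ccontr)
  assume "complex_of_real r \<notin> op_spectrum A"
  then obtain B where B: "bounded_op B" "\<And>x. B (A x - r *\<^sub>R x) = x"
    by (auto simp: op_spectrum_def scaleC_of_real)
  obtain K where K: "K > 0" "\<And>x. norm (B x) \<le> norm x * K"
    using bounded_linear.pos_bounded[OF bounded_op_linear[OF B(1)]] by blast
  obtain x where "norm (A x - r *\<^sub>R x) < 1/K * norm x"
    using assms[of "1/K"] K by auto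
  then show False
    using K(2)[of "A x - r *\<^sub>R x"] B(2)[of x] K(1) by (simp add: field_simps)
qed

text \<open>\<open>x - K x = y\<close> is solved as the fixed point of x |-> y + K x. The lower
  bound (1 - c) ||x|| <= ||x - K x|| makes solutions unique, hence linear in y, and bounds
  them.\<close>

lemma Neumann:
  fixes K :: "'a::chilbert_space \<Rightarrow> 'a"
  assumes K: "bounded_op K" and q: "q < 1" "\<And>x. norm (K x) \<le> q * norm x"
  obtains B where "bounded_op B" "\<And>x. B (x - K x) = x" "\<And>x. B x - K (B x) = x"
proof -
  interpret K: bounded_linear K
    using K by (rule bounded_op_linear)
  \<comment> \<open>\<open>q\<close> may be negative on the zero space, whereas a contraction
    constant must be nonnegative.\<close>
  define c where "c = max q 0"
  have c: "0 \<le> c" "c < 1" "norm (K x) \<le> c * norm x" for x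
    using q(1) by (auto simp: c_def intro!: order_trans[OF q(2)] mult_right_mono)
  have "\<exists>x. x - K x = y" for y
  proof -
    have "\<exists>!x. y + K x = x"
      by (rule banach_fix_type[OF c(1,2)]) (use c(3) in \<open>auto simp: dist_norm K.diff[symmetric]\<close>)
    then obtain x where "y + K x = x" by blast
    then show ?thesis
      by (metis add_diff_cancel_right')
  qed
  then obtain B where B: "\<And>y. B y - K (B y) = y"
    by metis
  have below: "(1 - c) * norm x \<le> norm (x - K x)" for x
    using norm_triangle_ineq2[of x "K x"] c(3)[of x] by (simp add: algebra_simps)
  have inj: "x = x'" if "x - K x = x' - K x'" for x x'
  proof -
    have "(1 - c) * norm (x - x') \<le> 0"
      using below[of "x - x'"] that by (simp add: K.diff algebra_simps)
    then show ?thesis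
      using c(2) by (simp add: mult_le_0_iff)
  qed
  have "bounded_linear B"
  proof (rule bounded_linear_intro)
    show "B (x + y) = B x + B y" for x y
      by (rule inj) (simp only: K.add add_diff_add B)
    show "B (r *\<^sub>R x) = r *\<^sub>R B x" for r x
      by (rule inj) (metis B K.scaleR scaleR_diff_right)
    show "norm (B x) \<le> norm x * (1 / (1 - c))" for x
      using below[of "B x"] B[of x] c(2) by (simp add: field_simps)
  qed
  moreover have "B (z *\<^sub>C x) = z *\<^sub>C B x" for z x
    by (rule inj) (metis B bounded_op_scaleC[OF K] scaleC_diff_right)
  ultimately have "bounded_op B"
    by (simp add: bounded_op_def)
  moreover have "B (x - K x) = x" for x
    by (rule inj) (rule B)
  ultimately show thesis
    using B that by blast
qed

text \<open>A - r is (\<kappa> - r)(1 - K) with K = (\<kappa> - A)/(\<kappa> - r) of norm below 1.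
  The free shift \<kappa> lets one estimate exclude points on either side of the spectrum.\<close>

lemma not_op_spectrumI:
  assumes A: "bounded_op A" and q: "q < \<bar>\<kappa> - r\<bar>" "\<And>x. norm (\<kappa> *\<^sub>R x - A x) \<le> q * norm x"
  shows "complex_of_real r \<notin> op_spectrum A"
proof (cases "\<forall>x::'a. x = 0")
  case True
  then have eq: "x = y" for x y :: 'a by metis
  show ?thesis
    unfolding op_spectrum_def using bounded_op_ident eq by blast
next
  case False
  then obtain y :: 'a where "y \<noteq> 0" by blast
  then have "0 \<le> q"
    using order_trans[OF norm_ge_zero q(2), of y] by (simp add: zero_le_mult_iff)
  then have r: "\<kappa> - r \<noteq> 0" using q(1) by auto
  define s where "s = 1 / (\<kappa> - r)"
  define K where "K x = s *\<^sub>R (\<kappa> *\<^sub>R x - A x)" for x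
  have K: "bounded_op K"
    unfolding K_def by (intro bounded_op_scaleR bounded_op_diff bounded_op_ident A)
  have "norm (K x) \<le> q / \<bar>\<kappa> - r\<bar> * norm x" for x
    using mult_left_mono[OF q(2)[of x], of "\<bar>s\<bar>"] r by (simp only: K_def norm_scaleR) (simp add: s_def)
  moreover have "q / \<bar>\<kappa> - r\<bar> < 1"
    using q(1) r by simp
  ultimately obtain B where B: "bounded_op B" "\<And>x. B (x - K x) = x" "\<And>x. B x - K (B x) = x"
    using Neumann[OF K] by metis
  interpret B: bounded_linear B
    using B(1) by (rule bounded_op_linear)
  have "s *\<^sub>R \<kappa> *\<^sub>R x - s *\<^sub>R r *\<^sub>R x = x" for x :: 'a
  proof -
    have "s * \<kappa> - s * r = 1"
      unfolding right_diff_distrib[symmetric] using r by (simp add: s_def)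
    then show ?thesis
      by (metis scaleR_diff_left scaleR_one scaleR_scaleR)
  qed
  then have AK: "s *\<^sub>R (A x - r *\<^sub>R x) = x - K x" for x
    by (simp add: K_def scaleR_diff_right algebra_simps)
  have "s *\<^sub>R B (A x - r *\<^sub>R x) = x" for x
    using B(2)[of x] by (simp add: AK[symmetric] B.scaleR)
  moreover have "A (s *\<^sub>R B x) - r *\<^sub>R (s *\<^sub>R B x) = x" for x
    using B(3)[of x] bounded_op_linear[OF A] unfolding AK[symmetric]
    by (simp add: linear_simps scaleR_diff_right mult.commute)
  ultimately show ?thesis
    using bounded_op_scaleR[OF B(1), of s] unfolding op_spectrum_def scaleC_of_real mem_Collect_eq
    by (auto simp: scaleC_of_real)
qed

definition real_spectrum :: "('a::chilbert_space \<Rightarrow> 'a) \<Rightarrow> real set"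
  where "real_spectrum A = {t. complex_of_real t \<in> op_spectrum A}"

lemma real_spectrum_positive:
  assumes A: "positive_op A" and M: "\<And>x. norm (A x) \<le> M * norm x"
  shows "real_spectrum A \<subseteq> {0..M}"
proof
  fix r assume r: "r \<in> real_spectrum A"
  note bA = positive_op_bounded[OF A]
  have "r \<le> M"
  proof (rule ccontr)
    assume "\<not> r \<le> M"
    moreover have "norm (0 *\<^sub>R x - A x) \<le> max M 0 * norm x" for x
      using order_trans[OF M, of x "max M 0 * norm x"] by (simp add: mult_right_mono)
    ultimately have "complex_of_real r \<notin> op_spectrum A" if "r > 0"
      using that by (intro not_op_spectrumI[OF bA, of "max M 0" 0]) auto
    \<comment> \<open>Here M < r <= 0, which is possible only in the zero space, where every number
      lies outside the spectrum.\<close>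
    moreover have False if "r \<le> 0"
    proof -
      have "M < 0" using that \<open>\<not> r \<le> M\<close> by simp
      then have "x = 0" for x :: 'a
        using order_trans[OF norm_ge_zero M, of x] by (simp add: zero_le_mult_iff)
      then have "complex_of_real r \<notin> op_spectrum A"
        by (intro not_op_spectrumI[OF bA, of 0 "r + 1"]) (auto simp: bounded_op_at_0[OF bA])
      then show False
        using r by (simp add: real_spectrum_def)
    qed
    ultimately show False
      using r by (force simp: real_spectrum_def)
  qed
  moreover have "0 \<le> r"
  proof (rule ccontr)
    assume r0: "\<not> 0 \<le> r"
    \<comment> \<open>Chosen so that (\<kappa> - r)^2 exceeds \<kappa>^2 + M^2; by positivity of A
      the latter, times ||x||^2, bounds ||\<kappa> x - A x||^2.\<close>
    define \<kappa> where "\<kappa> = (M\<^sup>2 + 1) / (2 * - r)"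
    have k0: "0 < \<kappa>"
      using r0 by (simp add: \<kappa>_def divide_pos_neg field_simps) (smt (verit) zero_le_power2 mult_neg_neg)
    have "- 2 * \<kappa> * r = M\<^sup>2 + 1"
      using r0 by (simp add: \<kappa>_def field_simps)
    then have sq: "(\<kappa> - r)\<^sup>2 = \<kappa>\<^sup>2 + M\<^sup>2 + 1 + r\<^sup>2"
      by (simp add: power2_eq_square algebra_simps)
    have "complex_of_real r \<notin> op_spectrum A"
    proof (rule not_op_spectrumI[OF bA])
      show "sqrt (\<kappa>\<^sup>2 + M\<^sup>2) < \<bar>\<kappa> - r\<bar>"
      proof -
        have "\<kappa>\<^sup>2 + M\<^sup>2 < (\<kappa> - r)\<^sup>2"
          using zero_le_power2[of r] unfolding sq by linarith
        then have "sqrt (\<kappa>\<^sup>2 + M\<^sup>2) < sqrt ((\<kappa> - r)\<^sup>2)"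
          by (rule real_sqrt_less_mono)
        then show ?thesis
          unfolding real_sqrt_abs .
      qed
      fix x
      have "(norm (\<kappa> *\<^sub>R x - A x))\<^sup>2 = \<kappa>\<^sup>2 * (norm x)\<^sup>2 + (norm (A x))\<^sup>2 - 2 * (\<kappa> * Re (cinner x (A x)))"
        unfolding norm_diff_sq by (simp add: power_mult_distrib cinner_scaleR_left)
      also have "\<dots> \<le> \<kappa>\<^sup>2 * (norm x)\<^sup>2 + (M * norm x)\<^sup>2"
        using power_mono[OF M[of x], of 2] mult_nonneg_nonneg[OF less_imp_le[OF k0] positive_op_Re_nonneg[OF A, of x]] by simp
      also have "\<dots> = (sqrt (\<kappa>\<^sup>2 + M\<^sup>2) * norm x)\<^sup>2"
        by (simp add: power_mult_distrib algebra_simps)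
      finally show "norm (\<kappa> *\<^sub>R x - A x) \<le> sqrt (\<kappa>\<^sup>2 + M\<^sup>2) * norm x"
        by (rule power2_le_imp_le) simp
    qed
    then show False
      using r by (simp add: real_spectrum_def)
  qed
  ultimately show "r \<in> {0..M}" by simp
qed

section \<open>Norm of a polynomial in a self-adjoint operator\<close>

text \<open>The divisor is the minimal real polynomial of z. The remainder has degree at most 1 and
  real coefficients and vanishes at the nonreal z, so it is zero.\<close>

lemma quadratic_dvd_of_complex_root:
  fixes q :: "real poly"
  assumes z: "poly (map_poly complex_of_real q) z = 0" and Im: "Im z \<noteq> 0"
  shows "[:(Re z)\<^sup>2 + (Im z)\<^sup>2, - 2 * Re z, 1:] dvd q"
proof -
  define d where "d = [:(Re z)\<^sup>2 + (Im z)\<^sup>2, - 2 * Re z, 1:]"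
  \<comment> \<open>Multiplication by z is an operator on the Hilbert space of complex numbers, so
    \<open>poly_op p Z 1\<close> is the value p(z), and the algebra of \<open>poly_op\<close>
    supplies the laws of evaluation.\<close>
  define Z where "Z w = z * w" for w :: complex
  have Z: "bounded_op Z"
    unfolding Z_def bounded_op_def scaleC_complex_def by (simp add: bounded_linear_mult_right)
  have Z_pCons: "poly_op (pCons a p) Z w = complex_of_real a * w + z * poly_op p Z w" for a p w
    unfolding poly_op_pCons[OF Z] by (simp add: Z_def scaleR_conv_of_real)
  have ev: "poly_op p Z 1 = poly (map_poly complex_of_real p) z" for p
    by (induction p) (simp_all add: Z_pCons map_poly_pCons)
  have "poly_op d Z 1 = 0"
    unfolding ev d_def by (simp add: map_poly_pCons complex_eq_iff power2_eq_square algebra_simps)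
  moreover have comm: "poly_op (p * d) Z x = poly_op d Z (poly_op p Z x)" for p x
    using poly_op_mult[OF Z, of d p x] by (simp only: mult.commute[of p d])
  have hom: "poly_op p Z w = w * poly_op p Z 1" for p w
  proof (induction p)
    case (pCons a p)
    show ?case
      unfolding Z_pCons pCons.IH by (simp add: algebra_simps)
  qed simp
  from hom[of d "poly_op (q div d) Z 1"] have "poly_op (q div d * d) Z 1 = poly_op (q div d) Z 1 * poly_op d Z 1"
    unfolding comm .
  ultimately have "poly_op (q mod d) Z 1 = 0"
    using z ev[of q] poly_op_add[OF Z, of "q div d * d" "q mod d" 1] by simp
  moreover obtain \<alpha> \<beta> where mod: "q mod d = [:\<alpha>, \<beta>:]"
  proof -
    have "degree (q mod d) < 2"
      using degree_mod_less'[of d q] by (cases "q mod d = 0") (auto simp: d_def)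
    then have "q mod d = [:coeff (q mod d) 0, coeff (q mod d) 1:]"
      by (intro poly_eqI) (auto simp: coeff_pCons coeff_eq_0 split: nat.splits)
    then show thesis by (rule that)
  qed
  ultimately have "complex_of_real \<alpha> + z * complex_of_real \<beta> = 0"
    by (simp add: Z_pCons)
  then have "\<beta> = 0 \<and> \<alpha> = 0"
    using Im by (auto simp: complex_eq_iff)
  then have "d dvd q"
    using mod by (simp add: mod_eq_0_iff_dvd)
  then show ?thesis by (simp add: d_def)
qed

text \<open>Induction over real factors, as lower bounds multiply. A real root r contributes A - r,
  bounded below by assumption. A nonreal root u + iv contributes (A - u)^2 + v^2, which for
  self-adjoint A is bounded below by v^2.\<close>

lemma poly_op_bounded_below:
  fixes A :: "'a::chilbert_space \<Rightarrow> 'a"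
  assumes A: "bounded_op A" "adjoint_pair A A" and "q \<noteq> 0"
    and "\<And>r. poly q r = 0 \<Longrightarrow> \<exists>k>0. \<forall>x. k * norm x \<le> norm (A x - r *\<^sub>R x)"
  shows "\<exists>k>0. \<forall>x. k * norm x \<le> norm (poly_op q A x)"
  using assms(3,4)
proof (induction "degree q" arbitrary: q rule: less_induct)
  case less
  have step: ?case if d: "d dvd q" "degree d > 0" and k: "k > 0" "\<And>x. k * norm x \<le> norm (poly_op d A x)" for d k
  proof -
    obtain p where p: "q = d * p"
      using d(1) by blast
    then have "p \<noteq> 0" "d \<noteq> 0"
      using less.prems by auto
    then have "degree p < degree q"
      using d(2) p by (simp add: degree_mult_eq)
    moreover have "\<exists>k>0. \<forall>x. k * norm x \<le> norm (A x - r *\<^sub>R x)" if "poly p r = 0" for r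
      by (rule less.prems(2)) (simp add: p that)
    ultimately obtain l where l: "l > 0" "\<And>x. l * norm x \<le> norm (poly_op p A x)"
      using less.hyps \<open>p \<noteq> 0\<close> by meson
    have "(k * l) * norm x \<le> norm (poly_op q A x)" for x
      using order_trans[OF mult_left_mono[OF l(2)[of x] less_imp_le[OF k(1)]] k(2)[of "poly_op p A x"]]
      by (simp add: p poly_op_mult[OF A(1)] mult.assoc)
    then show ?thesis
      using k(1) l(1) by (intro exI[of _ "k * l"]) simp
  qed
  show ?case
  proof (cases "degree q = 0")
    case True
    then obtain c where "q = [:c:]"
      by (rule degree_eq_zeroE)
    then show ?thesis
      using less.prems(1) by (intro exI[of _ "\<bar>c\<bar>"]) (simp add: poly_op_const[OF A(1)])
  next
    case False
    then obtain z where z: "poly (map_poly complex_of_real q) z = 0"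
      using alg_closed_imp_poly_has_root[of "map_poly complex_of_real q"] by (auto simp: degree_map_poly)
    show ?thesis
    proof (cases "Im z = 0")
      case True
      define r where "r = Re z"
      have "poly (map_poly complex_of_real p) (complex_of_real r) = complex_of_real (poly p r)" for p
        by (induction p) (simp_all add: map_poly_pCons)
      moreover have "z = complex_of_real r"
        using True by (simp add: r_def complex_eq_iff)
      ultimately have r: "poly q r = 0"
        using z by simp
      obtain k where k: "k > 0" "\<And>x. k * norm x \<le> norm (A x - r *\<^sub>R x)"
        using less.prems(2)[OF r] by blast
      show ?thesis
      proof (rule step)
        show "[:- r, 1:] dvd q"
          using r by (simp add: poly_eq_0_iff_dvd)
        show "k * norm x \<le> norm (poly_op [:- r, 1:] A x)" for x
          using k(2)[of x] by (simp add: poly_op_pCons[OF A(1)] bounded_op_at_0[OF A(1)])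
      qed (use k in auto)
    next
      case False
      define u v where "u = Re z" and "v = Im z"
      have dvd: "[:u\<^sup>2 + v\<^sup>2, - 2 * u, 1:] dvd q"
        using quadratic_dvd_of_complex_root[OF z False] by (simp add: u_def v_def)
      interpret A: bounded_linear A
        using A(1) by (rule bounded_op_linear)
      show ?thesis
      proof (rule step[OF dvd])
        show "0 < v\<^sup>2"
          using False by (simp add: v_def)
        fix x
        have "adjoint_pair (\<lambda>x. A x - u *\<^sub>R x) (\<lambda>x. A x - u *\<^sub>R x)"
          using A(2) by (simp add: adjoint_pair_def cinner.diff_left cinner.diff_right
              cinner_scaleR_left cinner_scaleR_right)
        then have sq: "Re (cinner x (A (A x - u *\<^sub>R x) - u *\<^sub>R (A x - u *\<^sub>R x))) = (norm (A x - u *\<^sub>R x))\<^sup>2"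
          by (simp add: adjoint_pair_def Re_cinner_self[symmetric])
        have "poly_op [:u\<^sup>2 + v\<^sup>2, - 2 * u, 1:] A x =
            A (A x - u *\<^sub>R x) - u *\<^sub>R (A x - u *\<^sub>R x) + v\<^sup>2 *\<^sub>R x"
          by (simp add: poly_op_pCons[OF A(1)] A.diff A.scaleR A.add A.zero power2_eq_square
              scaleR_add_left scaleR_diff_right scaleR_2[symmetric] flip: scaleR_scaleR)
            (simp add: scaleR_2[symmetric] algebra_simps)
        then have "v\<^sup>2 * (norm x)\<^sup>2 \<le> Re (cinner x (poly_op [:u\<^sup>2 + v\<^sup>2, - 2 * u, 1:] A x))"
          by (simp add: cinner_add_right sq cinner_scaleR_right Re_cinner_self)
        also have "\<dots> \<le> norm x * norm (poly_op [:u\<^sup>2 + v\<^sup>2, - 2 * u, 1:] A x)"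
          using complex_Re_le_cmod Cauchy_Schwarz by (rule order_trans)
        finally show "v\<^sup>2 * norm x \<le> norm (poly_op [:u\<^sup>2 + v\<^sup>2, - 2 * u, 1:] A x)"
          by (cases "x = 0") (simp_all add: power2_eq_square[of "norm x"])
      qed simp
    qed
  qed
qed

text \<open>||H||^2 is an approximate eigenvalue of H^2. A lower bound k for H^2 - L^2, squared and
  expanded with ||H (H x)|| <= L ||H x||, would give ||H x||^2 <= (L^2 - k^2/L^2) ||x||^2, against
  ||H|| = L.\<close>

lemma selfadjoint_sq_not_bounded_below:
  assumes H: "bounded_op H" "adjoint_pair H H" and L: "onorm H = L" "0 < L" and k: "0 < k"
  shows "\<exists>x. norm (H (H x) - L\<^sup>2 *\<^sub>R x) < k * norm x"
proof (rule ccontr)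
  assume "\<not> ?thesis"
  then have below: "k * norm x \<le> norm (H (H x) - L\<^sup>2 *\<^sub>R x)" for x
    by (simp add: not_less)
  note blH = bounded_op_linear[OF H(1)]
  have le: "norm (H x) \<le> L * norm x" for x
    using onorm[OF blH, of x] L by simp
  \<comment> \<open>\<open>max 0\<close> covers k > L^2, where the radicand would be
    negative.\<close>
  define s where "s = sqrt (max 0 (L\<^sup>2 - k\<^sup>2 / L\<^sup>2))"
  have "norm (H x) \<le> s * norm x" for x
  proof (rule power2_le_imp_le)
    have "(k * norm x)\<^sup>2 \<le> (norm (H (H x) - L\<^sup>2 *\<^sub>R x))\<^sup>2"
      using below[of x] k by (intro power_mono) auto
    also have "\<dots> = (norm (H (H x)))\<^sup>2 + L ^ 4 * (norm x)\<^sup>2 - 2 * L\<^sup>2 * (norm (H x))\<^sup>2"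
      unfolding norm_diff_sq
      using adjoint_pairD[OF H(2), of "H x" x]
      by (simp add: cinner_scaleR_right Re_cinner_self power_mult_distrib)
    also have "\<dots> \<le> L\<^sup>2 * (norm (H x))\<^sup>2 + L ^ 4 * (norm x)\<^sup>2 - 2 * L\<^sup>2 * (norm (H x))\<^sup>2"
      using power_mono[OF le[of "H x"], of 2] by (simp add: power_mult_distrib)
    finally have "L\<^sup>2 * (norm (H x))\<^sup>2 \<le> (L ^ 4 - k\<^sup>2) * (norm x)\<^sup>2"
      by (simp add: power_mult_distrib algebra_simps)
    then have "(norm (H x))\<^sup>2 \<le> (L ^ 4 - k\<^sup>2) * (norm x)\<^sup>2 / L\<^sup>2"
      using L(2) by (simp add: pos_le_divide_eq mult.commute)
    also have "\<dots> = (L\<^sup>2 - k\<^sup>2 / L\<^sup>2) * (norm x)\<^sup>2"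
      using L(2) by (simp add: field_simps power2_eq_square power4_eq_xxxx)
    also have "\<dots> \<le> (s * norm x)\<^sup>2"
      by (simp add: s_def power_mult_distrib mult_right_mono)
    finally show "(norm (H x))\<^sup>2 \<le> (s * norm x)\<^sup>2" .
  qed (simp add: s_def)
  then have "L \<le> s"
    unfolding L(1)[symmetric] by (rule onorm_bound[rotated]) (simp add: s_def)
  moreover have "s < sqrt (L\<^sup>2)"
    unfolding s_def using L(2) k by (intro real_sqrt_less_mono) simp
  ultimately show False
    using L(2) by simp
qed

text \<open>Otherwise A - r would be bounded below at each real root r of p^2 - L^2, hence so would
  p(A)^2 - L^2, which is impossible for L = ||p(A)||.\<close>

lemma poly_op_norm_attained:
  fixes A :: "'a::chilbert_space \<Rightarrow> 'a"
  assumes A: "bounded_op A" "adjoint_pair A A" and L: "onorm (poly_op p A) = L" "0 < L"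
    and ne: "p * p - [:L\<^sup>2:] \<noteq> 0"
  shows "\<exists>r\<in>real_spectrum A. \<bar>poly p r\<bar> = L"
proof (rule ccontr)
  assume none: "\<not> ?thesis"
  have "\<exists>k>0. \<forall>x. k * norm x \<le> norm (A x - r *\<^sub>R x)" if r: "poly (p * p - [:L\<^sup>2:]) r = 0" for r
  proof (rule ccontr)
    assume "\<not> ?thesis"
    then have "r \<in> real_spectrum A"
      unfolding real_spectrum_def by (auto intro!: op_spectrumI simp: not_le)
    moreover have "\<bar>poly p r\<bar> = L"
      using r L(2) by (simp add: power2_eq_square[symmetric]) (metis abs_of_pos power2_eq_iff abs_minus)
    ultimately show False
      using none by blast
  qed
  from poly_op_bounded_below[OF A ne this] obtain k where k: "k > 0"
    "\<And>x. k * norm x \<le> norm (poly_op (p * p - [:L\<^sup>2:]) A x)" by blast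
  obtain x where "norm (poly_op p A (poly_op p A x) - L\<^sup>2 *\<^sub>R x) < k * norm x"
    using selfadjoint_sq_not_bounded_below[OF bounded_op_poly_op[OF A(1)] adjoint_pair_poly_op[OF A] L k(1)]
    by blast
  then show False
    using k(2)[of x] by (simp add: poly_op_diff poly_op_mult poly_op_const A(1) not_le)
qed

lemma real_spectrum_nonempty:
  fixes A :: "'a::chilbert_space \<Rightarrow> 'a"
  assumes A: "bounded_op A" "adjoint_pair A A" and x: "(x::'a) \<noteq> 0"
  shows "real_spectrum A \<noteq> {}"
proof (cases "\<forall>y. A y = 0")
  case True
  have "0 \<in> real_spectrum A"
    unfolding real_spectrum_def mem_Collect_eq
    by (rule op_spectrumI) (use True x in \<open>auto intro!: exI[of _ x]\<close>)
  then show ?thesis by blast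
next
  case False
  have p: "poly_op [:0, 1:] A = A"
    by (simp add: fun_eq_iff poly_op_pCons A(1) bounded_op_at_0)
  have "0 < onorm A"
    using False by (simp add: onorm_pos_lt bounded_op_linear A(1))
  then show ?thesis
    using poly_op_norm_attained[OF A, of "[:0, 1:]" "onorm A"] p by auto
qed

text \<open>Applied to differences of polynomials, this makes the limit in \<open>fun_op\<close>
  exist and depend on the function alone. A positive norm is a value of |p| on the spectrum; when
  p^2 is constant any spectral point serves, so the spectrum must be nonempty.\<close>

theorem norm_poly_op_le:
  fixes A :: "'a::chilbert_space \<Rightarrow> 'a"
  assumes A: "bounded_op A" "adjoint_pair A A" and c: "\<And>t. t \<in> real_spectrum A \<Longrightarrow> \<bar>poly p t\<bar> \<le> c"
  shows "norm (poly_op p A x) \<le> c * norm x"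
proof (cases "x = 0")
  case True
  then show ?thesis
    by (simp add: bounded_op_at_0 bounded_op_poly_op A(1))
next
  case False
  note ne = real_spectrum_nonempty[OF A False]
  define L where "L = onorm (poly_op p A)"
  note bl = bounded_op_linear[OF bounded_op_poly_op[OF A(1), of p]]
  have "L \<le> c"
  proof (cases "0 < L")
    case False
    then show ?thesis
      using ne c by fastforce
  next
    case L: True
    have "\<exists>r\<in>real_spectrum A. \<bar>poly p r\<bar> = L"
    proof (cases "p * p - [:L\<^sup>2:] = 0")
      case True
      obtain r where r: "r \<in> real_spectrum A"
        using ne by blast
      have "(poly p r)\<^sup>2 = L\<^sup>2"
        using arg_cong[OF True, of "\<lambda>q. poly q r"] by (simp add: power2_eq_square)
      then show ?thesis
        using r L by (metis abs_of_pos power2_eq_iff abs_minus)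
    qed (rule poly_op_norm_attained[OF A L_def[symmetric] L])
    then show ?thesis
      using c by auto
  qed
  then show ?thesis
    using onorm[OF bl, of x] mult_right_mono[OF _ norm_ge_zero[of x]] unfolding L_def[symmetric]
    by (meson order_trans)
qed

section \<open>Continuous functional calculus\<close>

lemma Weierstrass_poly:
  assumes "continuous_on {a..b} (f :: real \<Rightarrow> real)"
  obtains P :: "nat \<Rightarrow> real poly" where "uniform_limit {a..b} (\<lambda>n. poly (P n)) f sequentially"
proof -
  have "\<exists>p. \<forall>x\<in>{a..b}. \<bar>f x - poly p x\<bar> < 1 / real (Suc n)" for n
  proof -
    obtain g where g: "real_polynomial_function g" "\<And>x. x \<in> {a..b} \<Longrightarrow> \<bar>f x - g x\<bar> < 1 / real (Suc n)"
      using Stone_Weierstrass_real_polynomial_function[OF compact_Icc assms, of "1 / real (Suc n)"] by auto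
    then obtain c m where "g = (\<lambda>x. \<Sum>i\<le>m. c i * x ^ i)"
      unfolding real_polynomial_function_iff_sum by blast
    then have "g = poly (\<Sum>i\<le>m. monom (c i) i)"
      by (simp add: fun_eq_iff poly_sum poly_monom)
    with g(2) show ?thesis by metis
  qed
  then obtain P where P: "\<And>n x. x \<in> {a..b} \<Longrightarrow> \<bar>f x - poly (P n) x\<bar> < 1 / real (Suc n)"
    by metis
  have "uniform_limit {a..b} (\<lambda>n. poly (P n)) f sequentially"
  proof (rule uniform_limitI)
    fix e :: real assume "0 < e"
    then obtain N where N: "1 / real (Suc N) < e"
      by (rule nat_approx_posE)
    have "dist (poly (P n) x) (f x) < e" if "n \<ge> N" "x \<in> {a..b}" for n x
    proof -
      have "1 / real (Suc n) \<le> 1 / real (Suc N)"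
        using that by (simp add: frac_le)
      then show ?thesis
        using P[OF that(2), of n] N by (simp add: dist_real_def abs_minus_commute)
    qed
    then show "\<forall>\<^sub>F n in sequentially. \<forall>x\<in>{a..b}. dist (poly (P n) x) (f x) < e"
      unfolding eventually_sequentially by blast
  qed
  then show thesis by (rule that)
qed

lemma bounded_op_limit:
  assumes P: "\<And>n. bounded_op (P n)" and T: "\<And>x. (\<lambda>n. P n x) \<longlonglongrightarrow> T x"
    and M: "\<And>x. norm (T x) \<le> M * norm x"
  shows "bounded_op T"
proof -
  note lin = P[THEN bounded_op_linear]
  have "bounded_linear T"
  proof (rule bounded_linear_intro)
    show "T (x + y) = T x + T y" for x y
      by (rule LIMSEQ_unique[OF T]) (simp add: linear_simps(1)[OF lin] tendsto_add T)
    show "T (r *\<^sub>R x) = r *\<^sub>R T x" for r x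
      by (rule LIMSEQ_unique[OF T]) (simp add: linear_simps[OF lin] tendsto_scaleR T)
    show "norm (T x) \<le> norm x * M" for x
      using M[of x] by (simp add: mult.commute)
  qed
  moreover have "T (c *\<^sub>C x) = c *\<^sub>C T x" for c x
  proof (rule cinner_eqI, rule LIMSEQ_unique)
    fix y
    show "(\<lambda>n. cinner y (P n (c *\<^sub>C x))) \<longlonglongrightarrow> cinner y (T (c *\<^sub>C x))"
      by (intro cinner.tendsto tendsto_const T)
    show "(\<lambda>n. cinner y (P n (c *\<^sub>C x))) \<longlonglongrightarrow> cinner y (c *\<^sub>C T x)"
      unfolding bounded_op_scaleC[OF P] cinner_scaleC_right
      by (intro tendsto_mult cinner.tendsto tendsto_const T)
  qed
  ultimately show ?thesis
    by (simp add: bounded_op_def)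
qed

text \<open>Shows that the definite description in \<open>fun_op\<close> denotes. Any two
  approximating sequences of polynomials become close in norm at A (\<open>close\<close>), so the
  limit T of one Weierstrass sequence is the norm limit of all of them (\<open>closeT\<close>), and
  that one sequence already determines T.\<close>

lemma fun_op_characterization:
  fixes A :: "'a::chilbert_space \<Rightarrow> 'a"
  assumes A: "bounded_op A" "adjoint_pair A A" and sp: "real_spectrum A \<subseteq> {a..b}"
    and f: "continuous_on {a..b} f"
  shows "bounded_op (fun_op f A) \<and>
    (\<forall>P. uniform_limit (real_spectrum A) (\<lambda>n. poly (P n)) f sequentially
      \<longrightarrow> (\<lambda>n. onorm (poly_op (P n) A - fun_op f A)) \<longlonglongrightarrow> 0)"
proof -
  obtain P where "uniform_limit {a..b} (\<lambda>n. poly (P n)) f sequentially"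
    using Weierstrass_poly[OF f] .
  then have P: "uniform_limit (real_spectrum A) (\<lambda>n. poly (P n)) f sequentially"
    using sp by (rule uniform_limit_on_subset)
  have close: "\<exists>N. \<forall>m\<ge>N. \<forall>n\<ge>N. \<forall>x. norm (poly_op (Q m) A x - poly_op (P n) A x) \<le> \<epsilon> * norm x"
    if Q: "uniform_limit (real_spectrum A) (\<lambda>n. poly (Q n)) f sequentially" and "\<epsilon> > 0" for Q \<epsilon>
  proof -
    obtain N1 where N1: "\<And>n t. n \<ge> N1 \<Longrightarrow> t \<in> real_spectrum A \<Longrightarrow> dist (poly (P n) t) (f t) < \<epsilon>/2"
      using uniform_limitD[OF P, of "\<epsilon>/2"] \<open>\<epsilon> > 0\<close> unfolding eventually_sequentially by auto
    obtain N2 where N2: "\<And>n t. n \<ge> N2 \<Longrightarrow> t \<in> real_spectrum A \<Longrightarrow> dist (poly (Q n) t) (f t) < \<epsilon>/2"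
      using uniform_limitD[OF Q, of "\<epsilon>/2"] \<open>\<epsilon> > 0\<close> unfolding eventually_sequentially by auto
    have "norm (poly_op (Q m) A x - poly_op (P n) A x) \<le> \<epsilon> * norm x" if "m \<ge> max N1 N2" "n \<ge> max N1 N2" for m n x
    proof -
      have "norm (poly_op (Q m - P n) A x) \<le> \<epsilon> * norm x"
      proof (rule norm_poly_op_le[OF A])
        fix t assume t: "t \<in> real_spectrum A"
        show "\<bar>poly (Q m - P n) t\<bar> \<le> \<epsilon>"
          using abs_triangle_ineq4[of "poly (Q m) t - f t" "poly (P n) t - f t"] N1[of n t] N2[of m t] t that
          by (simp add: dist_real_def)
      qed
      then show ?thesis
        by (simp add: poly_op_diff A(1))
    qed
    then show ?thesis by blast
  qed
  have "Cauchy (\<lambda>n. poly_op (P n) A x)" for x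
  proof (cases "x = 0")
    case True
    then show ?thesis
      by (simp add: bounded_op_at_0 bounded_op_poly_op A(1) Cauchy_def)
  next
    case False
    show ?thesis
    proof (rule metric_CauchyI)
      fix e :: real assume "0 < e"
      then have "e / (2 * norm x) > 0"
        using False by simp
      then obtain N where N: "\<forall>m\<ge>N. \<forall>n\<ge>N. norm (poly_op (P m) A x - poly_op (P n) A x) \<le> e / (2 * norm x) * norm x"
        using close[OF P] by blast
      have "e / (2 * norm x) * norm x < e"
        using False \<open>0 < e\<close> by simp
      then show "\<exists>M. \<forall>m\<ge>M. \<forall>n\<ge>M. dist (poly_op (P m) A x) (poly_op (P n) A x) < e"
        using N unfolding dist_norm by (meson order_le_less_trans)
    qed
  qed
  then obtain T where T: "\<And>x. (\<lambda>n. poly_op (P n) A x) \<longlonglongrightarrow> T x"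
    unfolding Cauchy_convergent_iff convergent_def by metis
  have closeT: "\<exists>N. \<forall>m\<ge>N. \<forall>x. norm (poly_op (Q m) A x - T x) \<le> \<epsilon> * norm x"
    if Q: "uniform_limit (real_spectrum A) (\<lambda>n. poly (Q n)) f sequentially" and "\<epsilon> > 0" for Q \<epsilon>
  proof -
    obtain N where N: "\<forall>m\<ge>N. \<forall>n\<ge>N. \<forall>x. norm (poly_op (Q m) A x - poly_op (P n) A x) \<le> \<epsilon> * norm x"
      using close[OF Q \<open>\<epsilon> > 0\<close>] by blast
    have "norm (poly_op (Q m) A x - T x) \<le> \<epsilon> * norm x" if "m \<ge> N" for m x
    proof (rule LIMSEQ_le_const2)
      show "(\<lambda>n. norm (poly_op (Q m) A x - poly_op (P n) A x)) \<longlonglongrightarrow> norm (poly_op (Q m) A x - T x)"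
        by (intro tendsto_intros T)
    qed (use N that in auto)
    then show ?thesis by blast
  qed
  obtain N where N: "\<And>x. norm (poly_op (P N) A x - T x) \<le> 1 * norm x"
    using closeT[OF P, of 1] by auto
  define M where "M = onorm (poly_op (P N) A) + 1"
  have "norm (T x) \<le> M * norm x" for x
  proof -
    have "norm (T x) \<le> norm (poly_op (P N) A x) + norm (poly_op (P N) A x - T x)"
      by (metis norm_minus_commute norm_triangle_sub)
    then show ?thesis
      using N[of x] onorm[OF bounded_op_linear[OF bounded_op_poly_op[OF A(1)]], of "P N" x]
      by (simp add: M_def algebra_simps)
  qed
  then have bT: "bounded_op T"
    by (rule bounded_op_limit[OF bounded_op_poly_op[OF A(1)] T])
  have bl: "bounded_linear (poly_op p A - S)" if "bounded_op S" for p and S :: "'a \<Rightarrow> 'a"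
    using bounded_op_linear[OF bounded_op_diff[OF bounded_op_poly_op[OF A(1)] that]]
    by (simp add: fun_diff_def)
  have "(\<lambda>n. onorm (poly_op (Q n) A - T)) \<longlonglongrightarrow> 0"
    if Q: "uniform_limit (real_spectrum A) (\<lambda>n. poly (Q n)) f sequentially" for Q
  proof (rule metric_LIMSEQ_I)
    fix e :: real assume e: "0 < e"
    obtain N where N: "\<forall>m\<ge>N. \<forall>x. norm (poly_op (Q m) A x - T x) \<le> e/2 * norm x"
      using closeT[OF Q, of "e/2"] e by auto
    have "onorm (poly_op (Q m) A - T) \<le> e/2" if "m \<ge> N" for m
      using N that e by (intro onorm_bound) auto
    then have "dist (onorm (poly_op (Q m) A - T)) 0 < e" if "m \<ge> N" for m
      using onorm_pos_le[OF bl[OF bT], of "Q m"] that e by (fastforce simp: dist_real_def)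
    then show "\<exists>N. \<forall>m\<ge>N. dist (onorm (poly_op (Q m) A - T)) 0 < e"
      by blast
  qed
  moreover have "S = T" if bS: "bounded_op S" and S: "(\<lambda>n. onorm (poly_op (P n) A - S)) \<longlonglongrightarrow> 0" for S
  proof
    fix x :: 'a
    have "(\<lambda>n. onorm (poly_op (P n) A - S) * norm x) \<longlonglongrightarrow> 0 * norm x"
      by (intro tendsto_intros S)
    then have "(\<lambda>n. onorm (poly_op (P n) A - S) * norm x) \<longlonglongrightarrow> 0"
      by simp
    then have "(\<lambda>n. poly_op (P n) A x - S x) \<longlonglongrightarrow> 0"
      by (rule Lim_null_comparison[rotated]) (use onorm[OF bl[OF bS]] in \<open>auto intro!: always_eventually\<close>)
    then have "(\<lambda>n. poly_op (P n) A x) \<longlonglongrightarrow> S x"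
      by (simp add: LIM_zero_iff)
    then show "S x = T x"
      using T LIMSEQ_unique by blast
  qed
  ultimately have "\<exists>!T. bounded_op T \<and>
    (\<forall>P. uniform_limit (real_spectrum A) (\<lambda>n. poly (P n)) f sequentially
      \<longrightarrow> (\<lambda>n. onorm (poly_op (P n) A - T)) \<longlonglongrightarrow> 0)"
    using bT P by blast
  then show ?thesis
    unfolding fun_op_def real_spectrum_def[symmetric] by (rule theI')
qed

section \<open>Functional calculus of a positive operator\<close>

lemma positive_op_bound:
  assumes "positive_op A"
  obtains M where "0 \<le> M" "\<And>x. norm (A x) \<le> M * norm x"
  using bounded_linear.nonneg_bounded[OF bounded_op_linear[OF positive_op_bounded[OF assms]]]
  by (auto simp: mult.commute)

text \<open>From here on functions are continuous on all of \<open>{0..}\<close>, which contains the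
  real spectrum of every positive operator, so conditions on f do not mention A.\<close>

lemma bounded_op_fun_op:
  assumes A: "positive_op A" and f: "continuous_on {0..} f"
  shows "bounded_op (fun_op f A)"
proof -
  obtain M where M: "0 \<le> M" "\<And>x. norm (A x) \<le> M * norm x"
    using positive_op_bound[OF A] by blast
  show ?thesis
    using fun_op_characterization[OF positive_op_bounded[OF A] positive_op_adjoint_pair[OF A]
        real_spectrum_positive[OF A M(2)] continuous_on_subset[OF f]] by auto
qed

lemma fun_op_tendsto_poly:
  assumes A: "positive_op A" and M: "\<And>x. norm (A x) \<le> M * norm x" and f: "continuous_on {0..} f"
    and P: "uniform_limit {0..M} (\<lambda>n. poly (P n)) f sequentially"
  shows "(\<lambda>n. poly_op (P n) A x) \<longlonglongrightarrow> fun_op f A x"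
proof -
  note bA = positive_op_bounded[OF A]
  have "(\<lambda>n. onorm (poly_op (P n) A - fun_op f A)) \<longlonglongrightarrow> 0"
    using fun_op_characterization[OF bA positive_op_adjoint_pair[OF A]
        real_spectrum_positive[OF A M] continuous_on_subset[OF f]]
      uniform_limit_on_subset[OF P real_spectrum_positive[OF A M]] by auto
  then have "(\<lambda>n. onorm (poly_op (P n) A - fun_op f A) * norm x) \<longlonglongrightarrow> 0"
    by (rule tendsto_mult_left_zero)
  moreover have "bounded_linear (poly_op (P n) A - fun_op f A)" for n
    using bounded_op_linear[OF bounded_op_diff[OF bounded_op_poly_op[OF bA] bounded_op_fun_op[OF A f]]]
    by (simp add: fun_diff_def)
  ultimately have "(\<lambda>n. poly_op (P n) A x - fun_op f A x) \<longlonglongrightarrow> 0"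
    by (rule_tac Lim_null_comparison[rotated]) (use onorm in \<open>fastforce intro!: always_eventually\<close>)+
  then show ?thesis
    by (simp add: LIM_zero_iff)
qed

lemma fun_op_approx:
  assumes A: "positive_op A" and M: "\<And>x. norm (A x) \<le> M * norm x" and f: "continuous_on {0..} f"
  obtains P where "uniform_limit {0..M} (\<lambda>n. poly (P n)) f sequentially"
    "\<And>x. (\<lambda>n. poly_op (P n) A x) \<longlonglongrightarrow> fun_op f A x"
proof -
  have "continuous_on {0..M} f"
    using f by (rule continuous_on_subset) auto
  then obtain P where P: "uniform_limit {0..M} (\<lambda>n. poly (P n)) f sequentially"
    by (rule Weierstrass_poly)
  then show thesis
    using that fun_op_tendsto_poly[OF assms P] by blast
qed

lemma adjoint_pair_fun_op:
  assumes A: "positive_op A" and f: "continuous_on {0..} f"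
  shows "adjoint_pair (fun_op f A) (fun_op f A)"
proof -
  obtain M where M: "0 \<le> M" "\<And>x. norm (A x) \<le> M * norm x"
    using positive_op_bound[OF A] by blast
  obtain P where P: "\<And>x. (\<lambda>n. poly_op (P n) A x) \<longlonglongrightarrow> fun_op f A x"
    using fun_op_approx[OF A M(2) f] by blast
  have "cinner (fun_op f A x) y = cinner x (fun_op f A y)" for x y
  proof (rule LIMSEQ_unique)
    show "(\<lambda>n. cinner (poly_op (P n) A x) y) \<longlonglongrightarrow> cinner (fun_op f A x) y"
      by (intro cinner.tendsto tendsto_const P)
    show "(\<lambda>n. cinner (poly_op (P n) A x) y) \<longlonglongrightarrow> cinner x (fun_op f A y)"
      unfolding adjoint_pairD[OF adjoint_pair_poly_op[OF positive_op_bounded[OF A] positive_op_adjoint_pair[OF A]]]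
      by (intro cinner.tendsto tendsto_const P)
  qed
  then show ?thesis
    by (simp add: adjoint_pair_def)
qed

lemma norm_fun_op_le:
  assumes A: "positive_op A" and M: "\<And>x. norm (A x) \<le> M * norm x" and f: "continuous_on {0..} f"
    and c: "\<And>t. 0 \<le> t \<Longrightarrow> t \<le> M \<Longrightarrow> \<bar>f t\<bar> \<le> c"
  shows "norm (fun_op f A x) \<le> c * norm x"
proof -
  obtain P where P: "uniform_limit {0..M} (\<lambda>n. poly (P n)) f sequentially"
    "\<And>x. (\<lambda>n. poly_op (P n) A x) \<longlonglongrightarrow> fun_op f A x"
    using fun_op_approx[OF A M f] by blast
  have "norm (fun_op f A x) \<le> c * norm x + e" if e: "e > 0" for e
  proof (rule LIMSEQ_le_const2)
    show "(\<lambda>n. norm (poly_op (P n) A x)) \<longlonglongrightarrow> norm (fun_op f A x)"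
      by (intro tendsto_norm P)
    define d where "d = e / (norm x + 1)"
    have pos: "0 < norm x + 1"
      using norm_ge_zero[of x] by linarith
    then have d: "d > 0" "d * norm x \<le> e"
      using e by (simp_all add: d_def pos_divide_le_eq mult_left_mono)
    obtain N where N: "\<And>n t. n \<ge> N \<Longrightarrow> t \<in> {0..M} \<Longrightarrow> dist (poly (P n) t) (f t) < d"
      using uniform_limitD[OF P(1) d(1)] unfolding eventually_sequentially by blast
    have "norm (poly_op (P n) A x) \<le> c * norm x + e" if "n \<ge> N" for n
    proof -
      have "norm (poly_op (P n) A x) \<le> (c + d) * norm x"
      proof (rule norm_poly_op_le[OF positive_op_bounded[OF A] positive_op_adjoint_pair[OF A]])
        fix t assume "t \<in> real_spectrum A"
        then have t: "t \<in> {0..M}"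
          using real_spectrum_positive[OF A M] by blast
        show "\<bar>poly (P n) t\<bar> \<le> c + d"
          using N[OF that t] c[of t] t by (simp add: dist_real_def)
      qed
      then show ?thesis
        using d(2) by (simp add: algebra_simps)
    qed
    then show "\<exists>N. \<forall>n\<ge>N. norm (poly_op (P n) A x) \<le> c * norm x + e"
      by blast
  qed
  then show ?thesis
    by (rule field_le_epsilon)
qed

lemma fun_op_diff:
  assumes A: "positive_op A" and f: "continuous_on {0..} f" and g: "continuous_on {0..} g"
  shows "fun_op (\<lambda>t. f t - g t) A x = fun_op f A x - fun_op g A x"
proof -
  obtain M where M: "0 \<le> M" "\<And>x. norm (A x) \<le> M * norm x"
    using positive_op_bound[OF A] by blast
  obtain P where P: "uniform_limit {0..M} (\<lambda>n. poly (P n)) f sequentially"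
    "\<And>x. (\<lambda>n. poly_op (P n) A x) \<longlonglongrightarrow> fun_op f A x"
    using fun_op_approx[OF A M(2) f] by blast
  obtain Q where Q: "uniform_limit {0..M} (\<lambda>n. poly (Q n)) g sequentially"
    "\<And>x. (\<lambda>n. poly_op (Q n) A x) \<longlonglongrightarrow> fun_op g A x"
    using fun_op_approx[OF A M(2) g] by blast
  have "uniform_limit {0..M} (\<lambda>n. poly (P n - Q n)) (\<lambda>t. f t - g t) sequentially"
    unfolding poly_diff by (intro uniform_limit_intros P Q)
  then have "(\<lambda>n. poly_op (P n - Q n) A x) \<longlonglongrightarrow> fun_op (\<lambda>t. f t - g t) A x"
    by (rule fun_op_tendsto_poly[OF A M(2), rotated]) (intro continuous_intros f g)
  moreover have "(\<lambda>n. poly_op (P n - Q n) A x) \<longlonglongrightarrow> fun_op f A x - fun_op g A x"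
    unfolding poly_op_diff[OF positive_op_bounded[OF A]] by (intro tendsto_diff P Q)
  ultimately show ?thesis
    by (rule LIMSEQ_unique)
qed

text \<open>In the weak form <y, P Q x> = <P y, Q x> pointwise convergence of both sequences
  suffices, because the inner product is jointly continuous.\<close>

lemma fun_op_mult:
  assumes A: "positive_op A" and f: "continuous_on {0..} f" and g: "continuous_on {0..} g"
  shows "fun_op (\<lambda>t. f t * g t) A x = fun_op f A (fun_op g A x)"
proof (rule cinner_eqI)
  fix y
  obtain M where M: "0 \<le> M" "\<And>x. norm (A x) \<le> M * norm x"
    using positive_op_bound[OF A] by blast
  obtain P where P: "uniform_limit {0..M} (\<lambda>n. poly (P n)) f sequentially"
    "\<And>x. (\<lambda>n. poly_op (P n) A x) \<longlonglongrightarrow> fun_op f A x"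
    using fun_op_approx[OF A M(2) f] by blast
  obtain Q where Q: "uniform_limit {0..M} (\<lambda>n. poly (Q n)) g sequentially"
    "\<And>x. (\<lambda>n. poly_op (Q n) A x) \<longlonglongrightarrow> fun_op g A x"
    using fun_op_approx[OF A M(2) g] by blast
  have bdd: "bounded (h ` {0..M})" if "continuous_on {0..} h" for h :: "real \<Rightarrow> real"
    by (intro compact_imp_bounded compact_continuous_image continuous_on_subset[OF that]) auto
  have "uniform_limit {0..M} (\<lambda>n. poly (P n * Q n)) (\<lambda>t. f t * g t) sequentially"
    unfolding poly_mult by (intro uniform_lim_mult P Q bdd f g)
  then have "(\<lambda>n. poly_op (P n * Q n) A x) \<longlonglongrightarrow> fun_op (\<lambda>t. f t * g t) A x"
    by (rule fun_op_tendsto_poly[OF A M(2), rotated]) (intro continuous_intros f g)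
  then have "(\<lambda>n. cinner y (poly_op (P n * Q n) A x)) \<longlonglongrightarrow> cinner y (fun_op (\<lambda>t. f t * g t) A x)"
    by (intro cinner.tendsto tendsto_const)
  moreover have "cinner y (poly_op (P n * Q n) A x) = cinner (poly_op (P n) A y) (poly_op (Q n) A x)" for n
    using adjoint_pair_poly_op[OF positive_op_bounded[OF A] positive_op_adjoint_pair[OF A], of "P n"]
    by (simp add: poly_op_mult[OF positive_op_bounded[OF A]] adjoint_pair_def)
  moreover have "(\<lambda>n. cinner (poly_op (P n) A y) (poly_op (Q n) A x)) \<longlonglongrightarrow> cinner (fun_op f A y) (fun_op g A x)"
    by (intro cinner.tendsto P Q)
  ultimately have "cinner y (fun_op (\<lambda>t. f t * g t) A x) = cinner (fun_op f A y) (fun_op g A x)"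
    by (simp add: LIMSEQ_unique)
  then show "cinner y (fun_op (\<lambda>t. f t * g t) A x) = cinner y (fun_op f A (fun_op g A x))"
    by (simp only: adjoint_pairD[OF adjoint_pair_fun_op[OF A f]])
qed

lemma fun_op_cong:
  assumes A: "positive_op A" and f: "continuous_on {0..} f" and eq: "\<And>t. 0 \<le> t \<Longrightarrow> f t = g t"
  shows "fun_op f A = fun_op g A"
proof
  fix x
  have g: "continuous_on {0..} g"
    using f by (rule continuous_on_eq) (simp add: eq)
  obtain M where M: "0 \<le> M" "\<And>x. norm (A x) \<le> M * norm x"
    using positive_op_bound[OF A] by blast
  have "norm (fun_op (\<lambda>t. f t - g t) A x) \<le> 0 * norm x"
    by (rule norm_fun_op_le[OF A M(2)]) (auto intro!: continuous_intros f g simp: eq)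
  then show "fun_op f A x = fun_op g A x"
    by (simp add: fun_op_diff[OF A f g])
qed

lemma fun_op_poly:
  assumes A: "positive_op A"
  shows "fun_op (poly p) A x = poly_op p A x"
proof -
  obtain M where M: "0 \<le> M" "\<And>x. norm (A x) \<le> M * norm x"
    using positive_op_bound[OF A] by blast
  have "(\<lambda>n. poly_op p A x) \<longlonglongrightarrow> fun_op (poly p) A x"
    by (rule fun_op_tendsto_poly[OF A M(2)]) (auto intro!: continuous_intros uniform_limit_const)
  then show ?thesis
    by (simp add: LIMSEQ_const_iff)
qed

lemma fun_op_ident:
  assumes "positive_op A"
  shows "fun_op (\<lambda>t. t) A x = A x"
proof -
  have "(\<lambda>t. t) = poly [:0, 1 :: real:]"
    by (simp add: fun_eq_iff)
  then show ?thesis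
    using fun_op_poly[OF assms, of "[:0, 1:]" x] assms
    by (simp add: poly_op_pCons positive_op_bounded bounded_op_at_0)
qed

lemma fun_op_const:
  assumes "positive_op A"
  shows "fun_op (\<lambda>t. c) A x = c *\<^sub>R x"
proof -
  have "(\<lambda>t. c) = poly [:c:]"
    by (simp add: fun_eq_iff)
  then show ?thesis
    using fun_op_poly[OF assms, of "[:c:]" x] assms
    by (simp add: poly_op_const positive_op_bounded)
qed

lemma fun_op_commute:
  assumes A: "positive_op A" and f: "continuous_on {0..} f"
    and L: "bounded_op L" "\<And>x. L (A x) = A (L x)"
  shows "L (fun_op f A x) = fun_op f A (L x)"
proof -
  interpret L: bounded_linear L
    using L(1) by (rule bounded_op_linear)
  obtain M where M: "0 \<le> M" "\<And>x. norm (A x) \<le> M * norm x"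
    using positive_op_bound[OF A] by blast
  obtain P where P: "\<And>x. (\<lambda>n. poly_op (P n) A x) \<longlonglongrightarrow> fun_op f A x"
    using fun_op_approx[OF A M(2) f] by blast
  have "(\<lambda>n. L (poly_op (P n) A x)) \<longlonglongrightarrow> L (fun_op f A x)"
    by (intro L.tendsto P)
  moreover have "(\<lambda>n. L (poly_op (P n) A x)) \<longlonglongrightarrow> fun_op f A (L x)"
    unfolding poly_op_commute[OF positive_op_bounded[OF A] L.linear_axioms L(2)] by (rule P)
  ultimately show ?thesis
    by (rule LIMSEQ_unique)
qed

lemma norm_fun_op_sq:
  assumes A: "positive_op A" and f: "continuous_on {0..} f"
  shows "(norm (fun_op f A x))\<^sup>2 = Re (cinner x (fun_op (\<lambda>t. f t * f t) A x))"
  using adjoint_pairD[OF adjoint_pair_fun_op[OF A f], of x "fun_op f A x"]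
  by (simp add: fun_op_mult[OF A f f] flip: Re_cinner_self)

text \<open>Turns scalar bounds into operator bounds: f(A) = h(A) g(A) with ||h(A)|| <= c. The
  quotient h is given explicitly because it must stay continuous where g vanishes.\<close>

lemma norm_fun_op_mono:
  assumes A: "positive_op A" and f: "continuous_on {0..} f" and g: "continuous_on {0..} g"
    and h: "continuous_on {0..} h" and fg: "\<And>t. 0 \<le> t \<Longrightarrow> f t = h t * g t"
    and c: "\<And>t. 0 \<le> t \<Longrightarrow> \<bar>h t\<bar> \<le> c"
  shows "norm (fun_op f A x) \<le> c * norm (fun_op g A x)"
proof -
  obtain M where M: "0 \<le> M" "\<And>x. norm (A x) \<le> M * norm x"
    using positive_op_bound[OF A] by blast
  have "fun_op f A x = fun_op h A (fun_op g A x)"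
    using fun_op_cong[OF A f fg] fun_op_mult[OF A h g] by metis
  then show ?thesis
    using norm_fun_op_le[OF A M(2) h c, of "fun_op g A x"] by simp
qed

text \<open>f(A) is the square of the self-adjoint operator obtained from the root of f.\<close>

lemma positive_fun_op:
  assumes A: "positive_op A" and f: "continuous_on {0..} f" and pos: "\<And>t. 0 \<le> t \<Longrightarrow> 0 \<le> f t"
  shows "positive_op (fun_op f A)"
proof (rule positive_opI)
  fix x
  have s: "continuous_on {0..} (\<lambda>t. sqrt (f t))"
    by (intro continuous_intros f)
  have "fun_op f A = fun_op (\<lambda>t. sqrt (f t) * sqrt (f t)) A"
    by (rule fun_op_cong[OF A f]) (simp add: pos)
  then show "0 \<le> Re (cinner x (fun_op f A x))"
    using norm_fun_op_sq[OF A s, of x] by (metis zero_le_power2)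
qed (intro bounded_op_fun_op adjoint_pair_fun_op A f)+

lemma fun_op_tendsto:
  assumes A: "positive_op A" and f: "continuous_on {0..} f" and fs: "\<And>n. continuous_on {0..} (fs n)"
    and lim: "\<And>M. uniform_limit {0..M} fs f sequentially"
  shows "(\<lambda>n. fun_op (fs n) A x) \<longlonglongrightarrow> fun_op f A x"
proof (cases "x = 0")
  case True
  then show ?thesis
    by (simp add: bounded_op_at_0[OF bounded_op_fun_op] A f fs)
next
  case False
  obtain M where M: "0 \<le> M" "\<And>x. norm (A x) \<le> M * norm x"
    using positive_op_bound[OF A] by blast
  show ?thesis
  proof (rule metric_LIMSEQ_I)
    fix e :: real assume e: "0 < e"
    define d where "d = e / (2 * norm x)"
    have d: "0 < d" "d * norm x < e"
      using e False by (simp_all add: d_def)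
    obtain N where N: "\<And>n t. n \<ge> N \<Longrightarrow> t \<in> {0..M} \<Longrightarrow> dist (fs n t) (f t) < d"
      using uniform_limitD[OF lim d(1)] unfolding eventually_sequentially by blast
    have "norm (fun_op (\<lambda>t. fs n t - f t) A x) \<le> d * norm x" if "n \<ge> N" for n
      by (rule norm_fun_op_le[OF A M(2)])
        (use N[OF that] in \<open>auto intro!: continuous_intros fs f less_imp_le simp: dist_real_def\<close>)
    then have "dist (fun_op (fs n) A x) (fun_op f A x) < e" if "n \<ge> N" for n
      unfolding dist_norm fun_op_diff[OF A fs f, symmetric] using d(2) that by (meson order_le_less_trans)
    then show "\<exists>N. \<forall>n\<ge>N. dist (fun_op (fs n) A x) (fun_op f A x) < e"
      by blast
  qed
qed

section \<open>The Loewner--Heinz inequality\<close>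

text \<open>By Cauchy-Schwarz and symmetry the sequence \<open>a n\<close> = ||D^n v|| is
  log-convex, so its ratios never decrease. A first ratio q > 1 would force growth like q^n.\<close>

lemma selfadjoint_power_bounded:
  assumes D: "adjoint_pair D D" and K: "\<And>n. norm ((D ^^ n) v) \<le> K"
  shows "norm (D v) \<le> norm v"
proof (rule ccontr)
  assume gt: "\<not> norm (D v) \<le> norm v"
  \<comment> \<open>If v = 0, symmetry gives <D 0, D 0> = <0, D (D 0)> = 0, against
    \<open>gt\<close>.\<close>
  have v: "norm v > 0"
  proof (rule ccontr)
    assume "\<not> norm v > 0"
    then have "v = 0" by simp
    moreover have "cinner (D 0) (D 0) = 0"
      unfolding adjoint_pairD[OF D] by (simp add: cinner.zero_left)
    ultimately show False
      using gt by (simp add: cinner_self)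
  qed
  define a where "a n = norm ((D ^^ n) v)" for n
  define q where "q = norm (D v) / norm v"
  have q: "q > 1"
    using gt v by (simp add: q_def)
  have log_convex: "(a (Suc n))\<^sup>2 \<le> a n * a (Suc (Suc n))" for n
  proof -
    have "(a (Suc n))\<^sup>2 = Re (cinner ((D ^^ n) v) ((D ^^ Suc (Suc n)) v))"
      using adjoint_pairD[OF D, of "(D ^^ n) v" "D ((D ^^ n) v)"]
      by (simp add: a_def flip: Re_cinner_self)
    also have "\<dots> \<le> a n * a (Suc (Suc n))"
      unfolding a_def using complex_Re_le_cmod Cauchy_Schwarz by (rule order_trans)
    finally show ?thesis .
  qed
  have grow: "a n > 0 \<and> q * a n \<le> a (Suc n)" for n
  proof (induction n)
    case 0
    then show ?case using v by (simp add: a_def q_def)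
  next
    case (Suc n)
    have an: "0 < a n" "q * a n \<le> a (Suc n)"
      using Suc by simp_all
    then have pos: "0 < a (Suc n)"
      using q by (smt (verit) mult_pos_pos)
    have "q * (a (Suc n))\<^sup>2 \<le> q * (a n * a (Suc (Suc n)))"
      using log_convex[of n] q by (intro mult_left_mono) auto
    also have "\<dots> \<le> a (Suc n) * a (Suc (Suc n))"
      using mult_right_mono[OF an(2), of "a (Suc (Suc n))"] by (simp add: a_def mult.assoc)
    finally have "a (Suc n) * (q * a (Suc n)) \<le> a (Suc n) * a (Suc (Suc n))"
      by (simp add: power2_eq_square mult.commute mult.left_commute)
    then show ?case
      using pos by simp
  qed
  have "q ^ n * norm v \<le> a n" for n
  proof (induction n)
    case (Suc n)
    have "q ^ Suc n * norm v \<le> q * a n"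
      using mult_left_mono[OF Suc, of q] q by (simp add: mult.assoc)
    then show ?case
      using grow[of n] by linarith
  qed (simp add: a_def)
  then have "q ^ n \<le> K / norm v" for n
    using K[of n] v by (simp add: a_def pos_le_divide_eq) (meson order_trans)
  moreover obtain n where "K / norm v < q ^ n"
    using real_arch_pow[OF q] by blast
  ultimately show False
    by (meson not_le)
qed

text \<open>
  Pedersen's argument: with \<open>B(s)\<close> a one-parameter group of self-adjoint operators,
  \<open>B(-m) D B(-m)\<close> for \<open>m = (s + t)/2\<close> is similar to the contraction \<open>B(-s) D B(-t)\<close>, so its powers
  are bounded; being self-adjoint, it is a contraction itself.
\<close>

lemma form_bound_midpoint:
  fixes B :: "real \<Rightarrow> 'a::chilbert_space \<Rightarrow> 'a"
  assumes B: "\<And>s. bounded_op (B s)" "\<And>s. adjoint_pair (B s) (B s)"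
      "\<And>s t x. B s (B t x) = B (s + t) x" "\<And>x. B 0 x = x"
    and D: "adjoint_pair D D"
    and le: "\<And>x y. norm (cinner x (D y)) \<le> norm (B s x) * norm (B t y)"
  shows "norm (cinner x (D x)) \<le> (norm (B ((s + t) / 2) x))\<^sup>2"
proof -
  define m where "m = (s + t) / 2"
  define C where "C v = B (- s) (D (B (- t) v))" for v
  define G where "G v = B (- m) (D (B (- m) v))" for v
  \<comment> \<open>Put x = B(-s) C v and y = B(-t) v in \<open>le\<close>: the left side becomes
    ||C v||^2, and on the right the factors B s and B t cancel.\<close>
  have C: "norm (C v) \<le> norm v" for v
  proof -
    have "norm (cinner (C v) (C v)) \<le> norm (C v) * norm v"
      using le[of "B (- s) (C v)" "B (- t) v"] adjoint_pairD[OF B(2), of "- s" "C v" "D (B (- t) v)"]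
      by (simp add: C_def B)
    then show ?thesis
      by (cases "C v = 0") (simp_all add: cinner_self norm_power power2_eq_square norm_mult)
  qed
  have st: "s - m = - (t - m)"
    by (simp add: m_def field_simps)
  have GC: "G v = B (s - m) (C (B (t - m) v))" for v
    by (simp add: G_def C_def B)
  have pow: "(G ^^ n) v = B (s - m) ((C ^^ n) (B (t - m) v))" for n v
  proof (induction n)
    case 0
    then show ?case by (simp add: B st)
  next
    case (Suc n)
    have "(G ^^ Suc n) v = G (B (s - m) ((C ^^ n) (B (t - m) v)))"
      using Suc by simp
    also have "\<dots> = B (s - m) (C ((C ^^ n) (B (t - m) v)))"
      unfolding GC by (simp add: B st)
    finally show ?case by simp
  qed
  have Cn: "norm ((C ^^ n) v) \<le> norm v" for n v
    by (induction n) (use C order_trans in auto)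
  have "norm ((G ^^ n) v) \<le> onorm (B (s - m)) * norm (B (t - m) v)" for n v
    unfolding pow
    using onorm[OF bounded_op_linear[OF B(1)]] mult_left_mono[OF Cn onorm_pos_le[OF bounded_op_linear[OF B(1)]]]
    by (meson order_trans)
  moreover have "adjoint_pair G G"
    using adjoint_pair_comp[OF B(2) adjoint_pair_comp[OF D B(2)]] unfolding G_def[abs_def] .
  ultimately have G: "norm (G v) \<le> norm v" for v
    using selfadjoint_power_bounded by blast
  define v where "v = B m x"
  have x: "x = B (- m) v"
    by (simp add: v_def B)
  have "cinner x (D x) = cinner v (G v)"
    by (simp add: x G_def adjoint_pairD[OF B(2)])
  then have "norm (cinner x (D x)) \<le> norm v * norm v"
    using order_trans[OF Cauchy_Schwarz mult_left_mono[OF G norm_ge_zero]] by simp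
  then show ?thesis
    by (simp add: v_def m_def power2_eq_square)
qed

text \<open>The group is (g(A) + \<epsilon>)^s; \<epsilon> > 0 makes its negative powers bounded.
  With g the identity it serves monotonicity of powers, with g the square root and A = D^2 it serves
  |D|.\<close>

lemma form_bound_midpoint_fun_op:
  assumes A: "positive_op A" and g: "continuous_on {0..} g" "\<And>t. 0 \<le> t \<Longrightarrow> 0 \<le> g t" and \<epsilon>: "0 < \<epsilon>"
    and D: "adjoint_pair D D"
    and le: "\<And>x y. norm (cinner x (D y)) \<le>
      norm (fun_op (\<lambda>\<tau>. (g \<tau> + \<epsilon>) powr s) A x) * norm (fun_op (\<lambda>\<tau>. (g \<tau> + \<epsilon>) powr t) A y)"
  shows "norm (cinner x (D x)) \<le> (norm (fun_op (\<lambda>\<tau>. (g \<tau> + \<epsilon>) powr ((s + t) / 2)) A x))\<^sup>2"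
proof (rule form_bound_midpoint[OF _ _ _ _ D le])
  have pos: "0 < g \<tau> + \<epsilon>" if "0 \<le> \<tau>" for \<tau>
    using g(2)[OF that] \<epsilon> by linarith
  have cont: "continuous_on {0..} (\<lambda>\<tau>. (g \<tau> + \<epsilon>) powr s)" for s
    using pos by (intro continuous_intros g(1)) force
  show "bounded_op (fun_op (\<lambda>\<tau>. (g \<tau> + \<epsilon>) powr s) A)" for s
    by (rule bounded_op_fun_op[OF A cont])
  show "adjoint_pair (fun_op (\<lambda>\<tau>. (g \<tau> + \<epsilon>) powr s) A) (fun_op (\<lambda>\<tau>. (g \<tau> + \<epsilon>) powr s) A)" for s
    by (rule adjoint_pair_fun_op[OF A cont])
  show "fun_op (\<lambda>\<tau>. (g \<tau> + \<epsilon>) powr s) A (fun_op (\<lambda>\<tau>. (g \<tau> + \<epsilon>) powr t) A x) =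
      fun_op (\<lambda>\<tau>. (g \<tau> + \<epsilon>) powr (s + t)) A x" for s t x
    by (simp add: powr_add fun_op_mult[OF A cont cont])
  have "fun_op (\<lambda>\<tau>. (g \<tau> + \<epsilon>) powr 0) A = fun_op (\<lambda>\<tau>. 1) A"
    by (rule fun_op_cong[OF A cont]) (use pos in force)
  then show "fun_op (\<lambda>\<tau>. (g \<tau> + \<epsilon>) powr 0) A x = x" for x
    by (simp add: fun_op_const[OF A])
qed

section \<open>Fractional powers\<close>

lemma continuous_on_pow:
  assumes "0 \<le> (s::real)"
  shows "continuous_on {0..} (\<lambda>t::real. if s = 0 then 1 else t powr s)"
proof (cases "s = 0")
  case False
  then have "0 < s" using assms by simp
  then have "continuous_on {0..} (\<lambda>t::real. t powr s)"
    by (intro continuous_on_powr' continuous_on_id continuous_on_const) auto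
  then show ?thesis
    using False by simp
qed simp

lemma bounded_op_powr_op: "positive_op A \<Longrightarrow> 0 \<le> s \<Longrightarrow> bounded_op (powr_op A s)"
  unfolding powr_op_def by (intro bounded_op_fun_op continuous_on_pow)

lemma adjoint_pair_powr_op: "positive_op A \<Longrightarrow> 0 \<le> s \<Longrightarrow> adjoint_pair (powr_op A s) (powr_op A s)"
  unfolding powr_op_def by (intro adjoint_pair_fun_op continuous_on_pow)

lemma positive_powr_op: "positive_op A \<Longrightarrow> 0 \<le> s \<Longrightarrow> positive_op (powr_op A s)"
  unfolding powr_op_def by (intro positive_fun_op continuous_on_pow) auto

lemma powr_op_zero: "positive_op A \<Longrightarrow> powr_op A 0 x = x"
  by (simp add: powr_op_def fun_op_const)

lemma powr_op_one:
  assumes "positive_op A"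
  shows "powr_op A 1 x = A x"
proof -
  have "powr_op A 1 = fun_op (\<lambda>t. t) A"
    unfolding powr_op_def by (rule fun_op_cong[OF assms continuous_on_pow]) auto
  then show ?thesis
    by (simp add: fun_op_ident assms)
qed

lemma powr_op_add:
  assumes A: "positive_op A" and "0 \<le> s" "0 \<le> r"
  shows "powr_op A (s + r) x = powr_op A s (powr_op A r x)"
proof -
  have "fun_op (\<lambda>t. if s + r = 0 then 1 else t powr (s + r)) A =
      fun_op (\<lambda>t. (if s = 0 then 1 else t powr s) * (if r = 0 then 1 else t powr r)) A"
    by (rule fun_op_cong[OF A continuous_on_pow]) (use assms(2,3) in \<open>auto simp: powr_add\<close>)
  then show ?thesis
    unfolding powr_op_def using fun_op_mult[OF A continuous_on_pow continuous_on_pow] assms(2,3) by simp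
qed

lemma norm_powr_op_sq:
  assumes A: "positive_op A" and "0 \<le> s"
  shows "(norm (powr_op A s x))\<^sup>2 = Re (cinner x (powr_op A (2 * s) x))"
  unfolding mult_2 powr_op_add[OF A assms(2,2)] adjoint_pairD[OF adjoint_pair_powr_op[OF assms], of x "powr_op A s x", symmetric]
    Re_cinner_self ..

lemma norm_powr_op_half_sq: "positive_op A \<Longrightarrow> (norm (powr_op A (1/2) x))\<^sup>2 = Re (cinner x (A x))"
  by (simp add: norm_powr_op_sq powr_op_one)

text \<open>Joint uniform continuity of t^s on a compact rectangle. Its exponents stay above s0/2,
  because continuity fails at t = s = 0.\<close>

lemma uniform_limit_powr_exponent:
  assumes s: "s \<longlonglongrightarrow> s0" "0 < (s0::real)"
  shows "uniform_limit {0..M} (\<lambda>n t. t powr s n) (\<lambda>t. t powr s0) sequentially"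
proof (rule uniform_limitI)
  fix e :: real assume e: "0 < e"
  have "uniformly_continuous_on ({0..M} \<times> {s0/2..s0+1}) (\<lambda>(t, s). t powr s)"
    unfolding case_prod_beta
    by (intro compact_uniformly_continuous compact_Times continuous_on_powr' continuous_intros)
      (use s(2) in auto)
  then obtain d where d: "d > 0" "\<And>t s t' s'. t \<in> {0..M} \<Longrightarrow> s \<in> {s0/2..s0+1} \<Longrightarrow> t' \<in> {0..M} \<Longrightarrow>
      s' \<in> {s0/2..s0+1} \<Longrightarrow> dist (t', s') (t, s) < d \<Longrightarrow> dist (t' powr s') (t powr s) < e"
    using e unfolding uniformly_continuous_on_def by fastforce
  have "\<forall>\<^sub>F n in sequentially. dist (s n) s0 < d"
    using s(1) d(1) by (rule tendstoD)
  moreover have "\<forall>\<^sub>F n in sequentially. s0/2 < s n"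
    by (rule order_tendstoD(1)[OF s(1)]) (use s(2) in simp)
  moreover have "\<forall>\<^sub>F n in sequentially. s n < s0 + 1"
    by (rule order_tendstoD(2)[OF s(1)]) simp
  ultimately show "\<forall>\<^sub>F n in sequentially. \<forall>t\<in>{0..M}. dist (t powr s n) (t powr s0) < e"
  proof eventually_elim
    case (elim n)
    show ?case
    proof
      fix t assume "t \<in> {0..M}"
      then show "dist (t powr s n) (t powr s0) < e"
        using elim s(2) by (intro d(2)) (auto simp: dist_prod_def)
    qed
  qed
qed

lemma dyadic_approx:
  assumes "0 \<le> r" "r \<le> (1::real)"
  obtains k :: "nat \<Rightarrow> nat" where "\<And>n. k n \<le> 2 ^ n" "(\<lambda>n. real (k n) / 2 ^ n) \<longlonglongrightarrow> r"
proof -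
  define k where "k n = nat \<lfloor>r * 2 ^ n\<rfloor>" for n :: nat
  have k: "real (k n) \<le> r * 2 ^ n" "r * 2 ^ n \<le> real (k n) + 1" for n
    using assms(1) unfolding k_def by auto
  have "real (k n) \<le> 2 ^ n" for n
    using order_trans[OF k(1)[of n] mult_right_mono[OF assms(2)]] by simp
  then have "k n \<le> 2 ^ n" for n
    by (metis of_nat_le_iff of_nat_numeral of_nat_power)
  moreover have "(\<lambda>n. real (k n) / 2 ^ n) \<longlonglongrightarrow> r"
  proof (rule real_tendsto_sandwich)
    show "\<forall>\<^sub>F n in sequentially. r - (1/2) ^ n \<le> real (k n) / 2 ^ n"
    proof (intro always_eventually allI)
      fix n
      have "r \<le> (real (k n) + 1) / 2 ^ n"
        using k(2)[of n] by (simp add: pos_le_divide_eq)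
      then show "r - (1/2) ^ n \<le> real (k n) / 2 ^ n"
        by (simp add: add_divide_distrib power_one_over)
    qed
    show "\<forall>\<^sub>F n in sequentially. real (k n) / 2 ^ n \<le> r"
      using k(1) by (intro always_eventually allI) (simp add: field_simps)
    have "(\<lambda>n. r - (1/2) ^ n) \<longlonglongrightarrow> r - 0"
      by (intro tendsto_intros LIMSEQ_power_zero) simp
    then show "(\<lambda>n. r - (1/2) ^ n) \<longlonglongrightarrow> r"
      by simp
  qed simp
  ultimately show thesis by (rule that)
qed

text \<open>The norm form of A^(2s) <= Z^(2s). With Z + \<epsilon> in place of Z, the good exponents
  contain 0 and, by hypothesis, 1/2, and are closed under midpoints by interpolation with D =
  A^(s+t). Continuity in the exponent passes from dyadic multiples to all s, and finally \<epsilon>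
  tends to 0.\<close>

theorem Loewner_Heinz:
  assumes A: "positive_op A" and Z: "positive_op Z"
    and le: "\<And>x. Re (cinner x (A x)) \<le> Re (cinner x (Z x))" and s: "0 \<le> s" "s \<le> 1/2"
  shows "norm (powr_op A s x) \<le> norm (powr_op Z s x)"
proof (cases "s = 0")
  case True
  then show ?thesis
    by (simp add: powr_op_zero A Z)
next
  case False
  with s(1) have s0: "0 < s" by simp
  define B where "B \<epsilon> s = fun_op (\<lambda>\<tau>. (\<tau> + \<epsilon>) powr s) Z" for \<epsilon> s :: real
  have cont: "continuous_on {0..} (\<lambda>\<tau>. (\<tau> + \<epsilon>) powr s)" if "0 < \<epsilon>" for \<epsilon> s :: real
    using that by (intro continuous_intros) force
  have perturbed: "norm (powr_op A s x) \<le> norm (B \<epsilon> s x)" if \<epsilon>: "0 < \<epsilon>" for \<epsilon>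
  proof -
    define S where "S = {s. 0 \<le> s \<and> (\<forall>x. norm (powr_op A s x) \<le> norm (B \<epsilon> s x))}"
    have "fun_op (\<lambda>\<tau>. (\<tau> + \<epsilon>) powr 0) Z = fun_op (\<lambda>\<tau>. 1) Z"
      by (rule fun_op_cong[OF Z cont[OF \<epsilon>]]) (use \<epsilon> in auto)
    then have S0: "0 \<in> S"
      by (simp add: S_def B_def powr_op_zero[OF A] fun_op_const[OF Z])
    have S1: "1/2 \<in> S"
    proof -
      have "(norm (powr_op A (1/2) x))\<^sup>2 \<le> (norm (B \<epsilon> (1/2) x))\<^sup>2" for x
      proof -
        have "fun_op (\<lambda>\<tau>. (\<tau> + \<epsilon>) powr (1/2) * (\<tau> + \<epsilon>) powr (1/2)) Z = fun_op (\<lambda>\<tau>. \<tau> - (- \<epsilon>)) Z"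
          by (rule fun_op_cong[OF Z]) (use \<epsilon> in \<open>auto intro!: continuous_intros simp flip: powr_add\<close>)
        then have "(norm (B \<epsilon> (1/2) x))\<^sup>2 = Re (cinner x (fun_op (\<lambda>\<tau>. \<tau> - (- \<epsilon>)) Z x))"
          using norm_fun_op_sq[OF Z cont[OF \<epsilon>], of "1/2" x] by (simp add: B_def)
        also have "\<dots> = Re (cinner x (Z x)) + \<epsilon> * (norm x)\<^sup>2"
          by (subst fun_op_diff[OF Z]) (auto intro!: continuous_intros
            simp: fun_op_ident[OF Z] fun_op_const[OF Z] cinner_add_right cinner_scaleR_right Re_cinner_self)
        finally show ?thesis
          using le[of x] \<epsilon> by (simp add: norm_powr_op_half_sq[OF A] add_increasing2)
      qed
      then show ?thesis
        unfolding S_def by (auto intro: power2_le_imp_le)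
    qed
    have mid: "(s + t) / 2 \<in> S" if st: "s \<in> S" "t \<in> S" for s t
    proof -
      have nn: "0 \<le> s" "0 \<le> t"
        using st by (auto simp: S_def)
      have "(norm (powr_op A ((s + t) / 2) x))\<^sup>2 \<le> (norm (B \<epsilon> ((s + t) / 2) x))\<^sup>2" for x
      proof -
        \<comment> \<open>Splitting A^(s+t) by Cauchy-Schwarz brings the two known bounds into the
          two-sided form that the midpoint lemma interpolates.\<close>
        have "norm (cinner x (powr_op A (s + t) y)) \<le> norm (B \<epsilon> s x) * norm (B \<epsilon> t y)" for x y
        proof -
          have "cinner x (powr_op A (s + t) y) = cinner (powr_op A s x) (powr_op A t y)"
            using nn by (simp add: powr_op_add[OF A] adjoint_pairD[OF adjoint_pair_powr_op[OF A]])
          also have "norm \<dots> \<le> norm (powr_op A s x) * norm (powr_op A t y)"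
            by (rule Cauchy_Schwarz)
          also have "\<dots> \<le> norm (B \<epsilon> s x) * norm (B \<epsilon> t y)"
            using st by (intro mult_mono) (auto simp: S_def)
          finally show ?thesis .
        qed
        then have "norm (cinner x (powr_op A (s + t) x)) \<le> (norm (B \<epsilon> ((s + t) / 2) x))\<^sup>2"
          unfolding B_def using nn \<epsilon>
          by (intro form_bound_midpoint_fun_op[OF Z] adjoint_pair_powr_op[OF A]) (auto intro!: continuous_intros)
        then show ?thesis
          using norm_powr_op_sq[OF A, of "(s + t) / 2" x] nn
            order_trans[OF complex_Re_le_cmod[of "cinner x (powr_op A (s + t) x)"]]
          by (simp only: nonzero_mult_div_cancel_left times_divide_eq_right add_nonneg_nonneg divide_nonneg_nonneg)
      qed
      then show ?thesis
        unfolding S_def using nn by (auto intro: power2_le_imp_le)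
    qed
    have dyadic: "real k / 2 ^ n / 2 \<in> S" if "k \<le> 2 ^ n" for k n
      using that
    proof (induction n arbitrary: k)
      case 0
      then have "k = 0 \<or> k = 1" by auto
      then show ?case using S0 S1 by auto
    next
      case (Suc n)
      \<comment> \<open>k/2 rounded down and up: both are numerators of the previous level, and
        their sum is k, so the new exponent is a midpoint.\<close>
      define i j where "i = k div 2" and "j = k - i"
      have ij: "k = i + j" "i \<le> 2 ^ n" "j \<le> 2 ^ n"
        using Suc.prems by (auto simp: i_def j_def)
      have "(real i / 2 ^ n / 2 + real j / 2 ^ n / 2) / 2 \<in> S"
        by (intro mid Suc.IH ij)
      then show ?case
        by (simp add: ij(1) field_simps)
    qed
    obtain k where k: "\<And>n. k n \<le> 2 ^ n" "(\<lambda>n. real (k n) / 2 ^ n) \<longlonglongrightarrow> 2 * s"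
      using dyadic_approx[of "2 * s"] s by auto
    define u where "u n = real (k n) / 2 ^ n / 2" for n
    have u: "u \<longlonglongrightarrow> s"
      using tendsto_divide[OF k(2) tendsto_const, of 2] unfolding u_def by simp
    have uS: "u n \<in> S" for n
      using dyadic[OF k(1)] by (simp add: u_def)
    \<comment> \<open>Once the exponents are positive, the exceptional branch of
      \<open>powr_op\<close> at exponent 0 no longer occurs.\<close>
    have evpos: "\<forall>\<^sub>F n in sequentially. 0 < u n"
      by (rule order_tendstoD(1)[OF u s0])
    have "(\<lambda>n. powr_op A (u n) x) \<longlonglongrightarrow> powr_op A s x"
      unfolding powr_op_def
    proof (rule fun_op_tendsto[OF A continuous_on_pow[OF s(1)]])
      show "continuous_on {0..} (\<lambda>t. if u n = 0 then 1 else t powr u n)" for n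
        using uS[of n] by (intro continuous_on_pow) (simp add: S_def)
      show "uniform_limit {0..M} (\<lambda>n t. if u n = 0 then 1 else t powr u n)
          (\<lambda>t. if s = 0 then 1 else t powr s) sequentially" for M
        using uniform_limit_powr_exponent[OF u s0, of M]
        by (rule uniform_limit_cong[THEN iffD1, rotated -1])
          (use s0 eventually_mono[OF evpos] in auto)
    qed
    moreover have "(\<lambda>n. B \<epsilon> (u n) x) \<longlonglongrightarrow> B \<epsilon> s x"
      unfolding B_def
    proof (rule fun_op_tendsto[OF Z cont[OF \<epsilon>] cont[OF \<epsilon>]])
      show "uniform_limit {0..M} (\<lambda>n \<tau>. (\<tau> + \<epsilon>) powr u n) (\<lambda>\<tau>. (\<tau> + \<epsilon>) powr s) sequentially" for M
        using uniform_limit_compose'[OF uniform_limit_powr_exponent[OF u s0, of "M + \<epsilon>"], of "\<lambda>\<tau>. \<tau> + \<epsilon>" "{0..M}"] \<epsilon>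
        by (auto simp: Pi_def)
    qed
    moreover have "norm (powr_op A (u n) x) \<le> norm (B \<epsilon> (u n) x)" for n
      using uS[of n] by (simp add: S_def)
    ultimately show ?thesis
      by (intro LIMSEQ_le[OF tendsto_norm tendsto_norm]) auto
  qed
  have "(\<lambda>n. B (1 / real (Suc n)) s x) \<longlonglongrightarrow> powr_op Z s x"
    unfolding powr_op_def B_def
  proof (rule fun_op_tendsto[OF Z continuous_on_pow[OF s(1)]])
    show "continuous_on {0..} (\<lambda>\<tau>. (\<tau> + 1 / real (Suc n)) powr s)" for n
      by (rule cont) simp
    fix M
    show "uniform_limit {0..M} (\<lambda>n \<tau>. (\<tau> + 1 / real (Suc n)) powr s) (\<lambda>t. if s = 0 then 1 else t powr s) sequentially"
    proof (rule uniform_limitI)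
      fix e :: real assume e: "0 < e"
      have "uniformly_continuous_on {0..M+1} (\<lambda>t. t powr s)"
        by (intro compact_uniformly_continuous continuous_on_powr' continuous_intros) (use s0 in auto)
      then obtain d where d: "d > 0" "\<And>t t'. t \<in> {0..M+1} \<Longrightarrow> t' \<in> {0..M+1} \<Longrightarrow> dist t' t < d \<Longrightarrow>
          dist (t' powr s) (t powr s) < e"
        using e unfolding uniformly_continuous_on_def by meson
      obtain N where N: "1 / real (Suc N) < d"
        using d(1) by (rule nat_approx_posE)
      have "dist ((\<tau> + 1 / real (Suc n)) powr s) (\<tau> powr s) < e" if "n \<ge> N" "\<tau> \<in> {0..M}" for n \<tau>
      proof (rule d(2))
        define \<delta> where "\<delta> = 1 / real (Suc n)"
        have "\<delta> \<le> 1 / real (Suc N)" "\<delta> \<le> 1" "0 < \<delta>"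
          using that unfolding \<delta>_def by (auto simp: field_simps)
        then show "\<tau> \<in> {0..M+1}" "\<tau> + 1 / real (Suc n) \<in> {0..M+1}" "dist (\<tau> + 1 / real (Suc n)) \<tau> < d"
          using that(2) N unfolding \<delta>_def[symmetric] by (auto simp: dist_real_def)
      qed
      then show "\<forall>\<^sub>F n in sequentially. \<forall>\<tau>\<in>{0..M}. dist ((\<tau> + 1 / real (Suc n)) powr s)
          (if s = 0 then 1 else \<tau> powr s) < e"
        unfolding eventually_sequentially using s0 by (intro exI[of _ N]) auto
    qed
  qed
  then have lim: "(\<lambda>n. norm (B (1 / real (Suc n)) s x)) \<longlonglongrightarrow> norm (powr_op Z s x)"
    by (rule tendsto_norm)
  show ?thesis
    by (rule LIMSEQ_le_const[OF lim]) (use perturbed in auto)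
qed

section \<open>Absolute value and traces\<close>

lemma has_trace_unique: "has_trace (A :: 'a::chilbert_space \<Rightarrow> 'a) t \<Longrightarrow> has_trace A u \<Longrightarrow> t = u"
  unfolding has_trace_def using is_onb_ex has_sum_unique by blast

lemma trace_op_eqI: "has_trace A t \<Longrightarrow> trace_op A = t"
  unfolding trace_op_def using has_trace_unique by blast

lemma has_trace_add: "has_trace A t \<Longrightarrow> has_trace B u \<Longrightarrow> has_trace (\<lambda>x. A x + B x) (t + u)"
  by (simp add: has_trace_def cinner_add_right has_sum_add)

lemma has_trace_scaleR: "has_trace A t \<Longrightarrow> has_trace (\<lambda>x. r *\<^sub>R A x) (r *\<^sub>R t)"
  by (auto simp: has_trace_def cinner_scaleR_right scaleR_conv_of_real intro!: has_sum_cmult_right)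

lemma has_trace_diff: "has_trace A t \<Longrightarrow> has_trace B u \<Longrightarrow> has_trace (\<lambda>x. A x - B x) (t - u)"
  using has_trace_add[OF _ has_trace_scaleR, of A t B u "-1"] by simp

lemma cinner_positive_op:
  assumes "positive_op A"
  shows "cinner x (A x) = complex_of_real ((norm (powr_op A (1/2) x))\<^sup>2)"
  using assms norm_powr_op_half_sq[OF assms, of x]
  by (simp add: positive_op_def less_eq_complex_def complex_eq_iff)

lemma has_trace_iff_hs:
  assumes "positive_op A"
  shows "has_trace A (complex_of_real h) \<longleftrightarrow> hs (powr_op A (1/2)) h"
  unfolding has_trace_def hs_def cinner_positive_op[OF assms] has_sum_of_real_iff ..

lemma finite_trace_positive:
  fixes A :: "'a::chilbert_space \<Rightarrow> 'a"
  assumes A: "positive_op A" and "finite_trace A"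
  obtains h where "has_trace A (complex_of_real h)" "hs (powr_op A (1/2)) h"
proof -
  obtain t where t: "has_trace A t"
    using assms(2) by (auto simp: finite_trace_def)
  obtain B :: "'a set" where B: "is_onb B"
    using is_onb_ex by blast
  have "((\<lambda>e. cinner e (A e)) has_sum t) B"
    using t B by (simp add: has_trace_def)
  then have "((\<lambda>e. complex_of_real ((norm (powr_op A (1/2) e))\<^sup>2)) has_sum t) B"
    by (simp only: cinner_positive_op[OF A])
  then have "((\<lambda>e. Im (complex_of_real ((norm (powr_op A (1/2) e))\<^sup>2))) has_sum Im t) B"
    by (rule has_sum_Im)
  then have "((\<lambda>e. 0) has_sum Im t) B"
    by (simp only: Im_complex_of_real)
  then have "Im t = 0"
    by (rule has_sum_unique) simp
  then have "t = complex_of_real (Re t)"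
    by (simp add: complex_eq_iff)
  then show thesis
    using that t has_trace_iff_hs[OF A] by metis
qed

lemma adjoint_op_selfadjoint:
  assumes "adjoint_pair A A"
  shows "adjoint_op A = A"
  unfolding adjoint_op_def
proof (rule the_equality)
  show "\<forall>x y. cinner (A x) y = cinner x (A y)"
    using assms by (simp add: adjoint_pair_def)
  show "B = A" if "\<forall>x y. cinner (A x) y = cinner x (B y)" for B
  proof
    fix y
    show "B y = A y"
      by (rule cinner_eqI) (metis that adjoint_pairD[OF assms])
  qed
qed

context
  fixes D :: "'a::chilbert_space \<Rightarrow> 'a"
  assumes bD: "bounded_op D" and sD: "adjoint_pair D D"
begin

lemma positive_square: "positive_op (\<lambda>x. D (D x))"
proof (rule positive_opI)
  show "0 \<le> Re (cinner x (D (D x)))" for x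
    using Re_cinner_self[of "D x"] by (simp add: adjoint_pairD[OF sD])
qed (rule bounded_op_comp[OF bD bD] adjoint_pair_comp[OF sD sD])+

lemma abs_op_eq: "abs_op D = powr_op (\<lambda>x. D (D x)) (1/2)"
  by (simp add: abs_op_def adjoint_op_selfadjoint[OF sD] comp_def)

lemma positive_abs_op: "positive_op (abs_op D)"
  unfolding abs_op_eq by (intro positive_powr_op positive_square) simp

lemma norm_abs_op: "norm (abs_op D x) = norm (D x)"
proof -
  have "(norm (abs_op D x))\<^sup>2 = (norm (D x))\<^sup>2"
    unfolding abs_op_eq norm_powr_op_half_sq[OF positive_square]
    using Re_cinner_self[of "D x"] by (simp add: adjoint_pairD[OF sD])
  then show ?thesis
    by (simp add: power2_eq_iff_nonneg)
qed

lemma abs_op_fun_op: "abs_op D = fun_op (\<lambda>t. t powr (1/2)) (\<lambda>x. D (D x))"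
  by (simp add: abs_op_eq powr_op_def)

lemma continuous_on_sqrt_powr: "continuous_on {0..} (\<lambda>t::real. t powr (1/2))"
  using continuous_on_pow[of "1/2"] by simp

text \<open>Interpolation between ||x|| and ||(|D| + \<epsilon>) y||: since ||D y|| = || |D| y ||,
  the form <x, D y> is bounded with exponents 0 and 1, hence on the diagonal with exponent 1/2 on
  both sides, by <x, |D| x> + \<epsilon> ||x||^2. The result contains both D <= |D| and -D <= |D|,
  that is, D <= P and P >= 0.\<close>

lemma abs_op_dominates: "norm (cinner x (D x)) \<le> Re (cinner x (abs_op D x))"
proof (rule field_le_epsilon)
  fix e :: real assume e: "0 < e"
  define \<epsilon> where "\<epsilon> = e / ((norm x)\<^sup>2 + 1)"
  have n0: "0 < (norm x)\<^sup>2 + 1"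
    using zero_le_power2[of "norm x"] by linarith
  have \<epsilon>: "0 < \<epsilon>" "\<epsilon> * (norm x)\<^sup>2 \<le> e"
    using e n0 by (simp_all add: \<epsilon>_def pos_divide_le_eq)
  define G where "G = (\<lambda>x. D (D x))"
  have G: "positive_op G"
    unfolding G_def by (rule positive_square)
  \<comment> \<open>Everything is a function of G = D^2, so \<open>t powr (1/2)\<close> stands for
    |D|.\<close>
  define B where "B s = fun_op (\<lambda>t. (t powr (1/2) + \<epsilon>) powr s) G" for s
  have pos: "0 < t powr (1/2) + \<epsilon>" for t
    using \<epsilon>(1) by (simp add: add_nonneg_pos)
  have cont: "continuous_on {0..} (\<lambda>t. (t powr (1/2) + \<epsilon>) powr s)" for s
    by (rule continuous_on_powr[OF continuous_on_add[OF continuous_on_sqrt_powr continuous_on_const] continuous_on_const])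
      (use pos in \<open>simp add: less_imp_neq[THEN not_sym]\<close>)
  have "norm (cinner x (D y)) \<le> norm (B 0 x) * norm (B 1 y)" for x y
  proof -
    have "fun_op (\<lambda>t. (t powr (1/2) + \<epsilon>) powr 0) G = fun_op (\<lambda>t. 1) G"
      by (rule fun_op_cong[OF G cont]) (use pos in \<open>simp add: less_imp_neq[THEN not_sym]\<close>)
    then have "B 0 x = x"
      by (simp add: B_def fun_op_const[OF G])
    moreover have "norm (abs_op D y) \<le> 1 * norm (B 1 y)"
      unfolding abs_op_fun_op B_def G_def[symmetric]
    proof (rule norm_fun_op_mono[OF G continuous_on_sqrt_powr cont])
      show "continuous_on {0..} (\<lambda>t. t powr (1/2) / (t powr (1/2) + \<epsilon>))"
        by (intro continuous_on_divide continuous_on_add continuous_on_sqrt_powr continuous_on_const)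
          (use pos in \<open>simp add: less_imp_neq[THEN not_sym]\<close>)
      show "t powr (1/2) = t powr (1/2) / (t powr (1/2) + \<epsilon>) * (t powr (1/2) + \<epsilon>) powr 1" for t
        using pos[of t] by simp
      show "\<bar>t powr (1/2) / (t powr (1/2) + \<epsilon>)\<bar> \<le> 1" for t
        using pos[of t] \<epsilon>(1) by simp
    qed
    ultimately show ?thesis
      using Cauchy_Schwarz[of x "D y"] mult_left_mono[of "norm (D y)" "norm (B 1 y)" "norm x"] norm_abs_op[of y]
      by simp
  qed
  then have "norm (cinner x (D x)) \<le> (norm (B ((0 + 1) / 2) x))\<^sup>2"
    unfolding B_def by (intro form_bound_midpoint_fun_op[OF G continuous_on_sqrt_powr _ \<epsilon>(1) sD]) auto
  also have "\<dots> = Re (cinner x (fun_op (\<lambda>t. t powr (1/2) - (- \<epsilon>)) G x))"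
  proof -
    have "fun_op (\<lambda>t. (t powr (1/2) + \<epsilon>) powr (1/2) * (t powr (1/2) + \<epsilon>) powr (1/2)) G
        = fun_op (\<lambda>t. t powr (1/2) - (- \<epsilon>)) G"
      by (rule fun_op_cong[OF G continuous_on_mult[OF cont cont]])
        (use pos in \<open>simp flip: powr_add add: less_imp_le\<close>)
    then show ?thesis
      using norm_fun_op_sq[OF G cont, of "1/2" x] by (simp add: B_def)
  qed
  also have "\<dots> = Re (cinner x (abs_op D x)) + \<epsilon> * (norm x)\<^sup>2"
    unfolding fun_op_diff[OF G continuous_on_sqrt_powr continuous_on_const] fun_op_const[OF G]
    by (simp add: abs_op_fun_op G_def cinner_add_right cinner_scaleR_right Re_cinner_self)
  finally show "norm (cinner x (D x)) \<le> Re (cinner x (abs_op D x)) + e"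
    using \<epsilon>(2) by linarith
qed

lemma positive_pos_part_op: "positive_op (pos_part_op D)"
proof (rule positive_opI)
  show "bounded_op (pos_part_op D)"
    unfolding pos_part_op_def
    by (intro bounded_op_scaleR bounded_op_add bD positive_op_bounded positive_abs_op)
  show "adjoint_pair (pos_part_op D) (pos_part_op D)"
    using adjoint_pair_add[OF sD positive_op_adjoint_pair[OF positive_abs_op]]
    by (simp add: adjoint_pair_def pos_part_op_def cinner_scaleR_left cinner_scaleR_right)
  fix x
  show "0 \<le> Re (cinner x (pos_part_op D x))"
    using abs_op_dominates[of x] abs_Re_le_cmod[of "cinner x (D x)"]
    by (simp add: pos_part_op_def cinner_scaleR_right cinner_add_right)
qed

lemma pos_part_op_ge: "Re (cinner x (D x)) \<le> Re (cinner x (pos_part_op D x))"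
  using abs_op_dominates[of x] abs_Re_le_cmod[of "cinner x (D x)"]
  by (simp add: pos_part_op_def cinner_scaleR_right cinner_add_right)

text \<open>
  With \<open>V = D (|D| + \<epsilon>)\<^bsup>-1\<^esup>\<close>, a self-adjoint contraction, \<open>V D\<close> is within \<open>\<epsilon>\<close> of \<open>|D|\<close>,
  so that \<open>V\<close> replaces the partial isometry of the polar decomposition.
\<close>

lemma abs_op_approx:
  assumes \<epsilon>: "0 < \<epsilon>"
  obtains V where "adjoint_pair V V" "\<And>x. norm (V x) \<le> norm x"
    "\<And>x. Re (cinner x (abs_op D x)) \<le> Re (cinner (V x) (D x)) + \<epsilon> * (norm x)\<^sup>2"
proof -
  define G where "G = (\<lambda>x. D (D x))"
  have G: "positive_op G"
    unfolding G_def by (rule positive_square)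
  define r where "r t = 1 / (t powr (1/2) + \<epsilon>)" for t
  have pos: "0 < t powr (1/2) + \<epsilon>" for t
    using \<epsilon> by (simp add: add_nonneg_pos)
  have contr: "continuous_on {0..} r"
    unfolding r_def
    by (intro continuous_on_divide continuous_on_add continuous_on_sqrt_powr continuous_on_const)
      (use pos in \<open>simp add: less_imp_neq[THEN not_sym]\<close>)
  define R where "R = fun_op r G"
  \<comment> \<open>D commutes with functions of D^2; this makes V = D R self-adjoint.\<close>
  have comm: "D (R x) = R (D x)" for x
    unfolding R_def by (rule fun_op_commute[OF G contr bD]) (simp add: G_def)
  have R: "adjoint_pair R R"
    unfolding R_def by (rule adjoint_pair_fun_op[OF G contr])
  define V where "V x = D (R x)" for x
  have V: "adjoint_pair V V"
    using adjoint_pair_comp[OF sD R] by (simp add: V_def[abs_def] comm)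
  have id: "continuous_on {0..} (\<lambda>t::real. t)"
    by (intro continuous_intros)
  note s = continuous_on_sqrt_powr
  have "norm (V x) \<le> norm x" for x
  proof -
    have "norm (V x) = norm (fun_op (\<lambda>t. t powr (1/2) * r t) G x)"
      unfolding V_def norm_abs_op[symmetric] abs_op_fun_op G_def[symmetric] R_def fun_op_mult[OF G s contr] ..
    also have "\<dots> \<le> 1 * norm x"
    proof -
      obtain M where M: "0 \<le> M" "\<And>x. norm (G x) \<le> M * norm x"
        using positive_op_bound[OF G] by blast
      show ?thesis
        by (rule norm_fun_op_le[OF G M(2) continuous_on_mult[OF s contr]]) (use pos \<epsilon> in \<open>simp add: r_def\<close>)
    qed
    finally show ?thesis by simp
  qed
  moreover have "Re (cinner x (abs_op D x)) \<le> Re (cinner (V x) (D x)) + \<epsilon> * (norm x)\<^sup>2" for x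
  proof -
    have "cinner (V x) (D x) = cinner x (fun_op (\<lambda>t. r t * t) G x)"
      unfolding fun_op_mult[OF G contr id] fun_op_ident[OF G] R_def[symmetric]
      by (simp add: G_def V_def adjoint_pairD[OF sD] adjoint_pairD[OF R])
    moreover have "fun_op (\<lambda>t. t powr (1/2) - r t * t) G x = abs_op D x - fun_op (\<lambda>t. r t * t) G x"
      using fun_op_diff[OF G s continuous_on_mult[OF contr id]] by (simp add: abs_op_fun_op G_def)
    moreover have "norm (fun_op (\<lambda>t. t powr (1/2) - r t * t) G x) \<le> \<epsilon> * norm x"
    proof -
      obtain M where M: "0 \<le> M" "\<And>x. norm (G x) \<le> M * norm x"
        using positive_op_bound[OF G] by blast
      show ?thesis
      proof (rule norm_fun_op_le[OF G M(2)])
        show "continuous_on {0..} (\<lambda>t. t powr (1/2) - r t * t)"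
          by (intro continuous_on_diff continuous_on_mult s contr id)
        fix t :: real assume t: "0 \<le> t"
        \<comment> \<open>With w the root of t: w - w^2/(w + \<epsilon>) = \<epsilon> w/(w +
          \<epsilon>), at most \<epsilon>.\<close>
        have "t = t powr (1/2) * t powr (1/2)"
          using t by (simp flip: powr_add)
        then have "r t * t = t powr (1/2) * t powr (1/2) / (t powr (1/2) + \<epsilon>)"
          by (simp add: r_def)
        then have "t powr (1/2) - r t * t = \<epsilon> * (t powr (1/2) / (t powr (1/2) + \<epsilon>))"
          using pos[of t] by (simp add: field_simps)
        moreover define q where "q = t powr (1/2) / (t powr (1/2) + \<epsilon>)"
        moreover have "0 \<le> q" "q \<le> 1"
          unfolding q_def using pos[of t] \<epsilon> by simp_all
        ultimately show "\<bar>t powr (1/2) - r t * t\<bar> \<le> \<epsilon>"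
          using mult_left_mono[of q 1 \<epsilon>] \<epsilon> by (simp add: abs_mult)
      qed
    qed
    then have "Re (cinner x (fun_op (\<lambda>t. t powr (1/2) - r t * t) G x)) \<le> norm x * (\<epsilon> * norm x)"
      using complex_Re_le_cmod Cauchy_Schwarz mult_left_mono[OF _ norm_ge_zero] by (meson order_trans)
    ultimately show ?thesis
      by (simp add: cinner.diff_right power2_eq_square mult.left_commute)
  qed
  ultimately show thesis
    using that V by blast
qed

end

section \<open>Finiteness of the trace of |X - Y|\<close>

text \<open>Finite diagonal sums of |D| are bounded by x + y: up to a small error they are sums of
  Re <V e, X e> - Re <V e, Y e> with V a self-adjoint contraction, and \<open>half\<close> bounds
  each of the two sums by the trace.\<close>

lemma finite_trace_abs_op_diff:
  fixes X Y :: "'a::chilbert_space \<Rightarrow> 'a"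
  assumes X: "positive_op X" "hs (powr_op X (1/2)) x" and Y: "positive_op Y" "hs (powr_op Y (1/2)) y"
  obtains d where "has_trace (abs_op (\<lambda>u. X u - Y u)) (complex_of_real d)"
proof -
  define D where "D u = X u - Y u" for u
  have bD: "bounded_op D"
    unfolding D_def by (intro bounded_op_diff positive_op_bounded X Y)
  have sD: "adjoint_pair D D"
    unfolding D_def by (intro adjoint_pair_diff positive_op_adjoint_pair X Y)
  note pos = positive_abs_op[OF bD sD]
  obtain B :: "'a set" where B: "is_onb B"
    using is_onb_ex by blast
  have half: "\<bar>\<Sum>e\<in>F. Re (cinner (V e) (A e))\<bar> \<le> h"
    if A: "positive_op A" "hs (powr_op A (1/2)) h" and V: "adjoint_pair V V" "\<And>u. norm (V u) \<le> norm u"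
      and F: "finite F" "F \<subseteq> B" for A V h F
  proof -
    define Q where "Q = powr_op A (1/2)"
    have Q: "adjoint_pair Q Q" "hs Q h" "\<And>u. A u = Q (Q u)"
      using adjoint_pair_powr_op[OF A(1)] A(2) powr_op_add[OF A(1), of "1/2" "1/2"] powr_op_one[OF A(1)]
      by (auto simp: Q_def)
    \<comment> \<open>The contraction on the left is harmless; taking adjoints moves it to the
      right, giving the bound for Q V that is used below.\<close>
    obtain h' where h': "hs (\<lambda>u. V (Q u)) h'" "h' \<le> h"
      using hs_mono[OF Q(2) adjoint_pair_comp[OF V(1) Q(1)] V(2)] by blast
    have h'': "hs (\<lambda>u. Q (V u)) h'"
      by (rule hs_adjoint[OF h'(1) adjoint_pair_comp[OF V(1) Q(1)]])
    have "\<bar>\<Sum>e\<in>F. Re (cinner (V e) (A e))\<bar> \<le> (\<Sum>e\<in>F. \<bar>Re (cinner (V e) (A e))\<bar>)"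
      by (rule sum_abs)
    also have "\<dots> \<le> (\<Sum>e\<in>F. 1/2 * (norm (Q (V e)))\<^sup>2 + 1/2 * (norm (Q e))\<^sup>2)"
    proof (rule sum_mono)
      fix e
      have "\<bar>Re (cinner (V e) (A e))\<bar> \<le> norm (Q (V e)) * norm (Q e)"
        using order_trans[OF abs_Re_le_cmod Cauchy_Schwarz, of "Q (V e)" "Q e"]
        by (simp add: Q(3) adjoint_pairD[OF Q(1)])
      also have "\<dots> \<le> 1/2 * (norm (Q (V e)))\<^sup>2 + 1/2 * (norm (Q e))\<^sup>2"
        using sum_squares_bound[of "norm (Q (V e))" "norm (Q e)"] by simp
      finally show "\<bar>Re (cinner (V e) (A e))\<bar> \<le> 1/2 * (norm (Q (V e)))\<^sup>2 + 1/2 * (norm (Q e))\<^sup>2" .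
    qed
    also have "\<dots> = 1/2 * (\<Sum>e\<in>F. (norm (Q (V e)))\<^sup>2) + 1/2 * (\<Sum>e\<in>F. (norm (Q e))\<^sup>2)"
      by (simp add: sum.distrib sum_distrib_left)
    also have "\<dots> \<le> 1/2 * h' + 1/2 * h"
      by (intro add_mono mult_left_mono finite_sum_le_has_sum[OF hsD[OF h'' B]]
          finite_sum_le_has_sum[OF hsD[OF Q(2) B]]) (use F in auto)
    finally show ?thesis
      using h'(2) by simp
  qed
  have bound: "(\<Sum>e\<in>F. Re (cinner e (abs_op D e))) \<le> x + y" if F: "finite F" "F \<subseteq> B" for F
  proof (rule field_le_epsilon)
    fix \<epsilon> :: real assume "0 < \<epsilon>"
    \<comment> \<open>The error is shared among the vectors of F; the summand 1 covers empty
      F.\<close>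
    define \<delta> where "\<delta> = \<epsilon> / (real (card F) + 1)"
    have \<delta>: "0 < \<delta>" "real (card F) * \<delta> \<le> \<epsilon>"
      using \<open>0 < \<epsilon>\<close> by (simp_all add: \<delta>_def pos_divide_le_eq)
    obtain V where V: "adjoint_pair V V" "\<And>u. norm (V u) \<le> norm u"
      "\<And>u. Re (cinner u (abs_op D u)) \<le> Re (cinner (V u) (D u)) + \<delta> * (norm u)\<^sup>2"
      using abs_op_approx[OF bD sD \<delta>(1)] by blast
    have "(\<Sum>e\<in>F. Re (cinner e (abs_op D e))) \<le> (\<Sum>e\<in>F. Re (cinner (V e) (D e)) + \<delta>)"
    proof (rule sum_mono)
      fix e assume "e \<in> F"
      then have "norm e = 1"
        using F B by (auto simp: is_onb_def)
      then show "Re (cinner e (abs_op D e)) \<le> Re (cinner (V e) (D e)) + \<delta>"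
        using V(3)[of e] by simp
    qed
    also have "\<dots> = (\<Sum>e\<in>F. Re (cinner (V e) (X e))) - (\<Sum>e\<in>F. Re (cinner (V e) (Y e))) + real (card F) * \<delta>"
      by (simp add: sum.distrib D_def cinner.diff_right sum_subtractf)
    finally show "(\<Sum>e\<in>F. Re (cinner e (abs_op D e))) \<le> x + y + \<epsilon>"
      using half[OF X V(1,2) F] half[OF Y V(1,2) F] \<delta>(2) by linarith
  qed
  have eq: "Re (cinner e (abs_op D e)) = (norm (powr_op (abs_op D) (1/2) e))\<^sup>2" for e
    by (simp add: norm_powr_op_half_sq[OF pos])
  have "(\<lambda>e. (norm (powr_op (abs_op D) (1/2) e))\<^sup>2) summable_on B"
    by (rule nonneg_bdd_above_summable_on) (use bound in \<open>auto simp: eq intro!: bdd_aboveI2[of _ _ "x + y"]\<close>)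
  then obtain d where "((\<lambda>e. (norm (powr_op (abs_op D) (1/2) e))\<^sup>2) has_sum d) B"
    by (auto simp: summable_on_def)
  then have "hs (powr_op (abs_op D) (1/2)) d"
    by (intro hsI[OF B adjoint_pair_powr_op[OF pos]]) auto
  then show thesis
    using that has_trace_iff_hs[OF pos] by (simp add: D_def[abs_def])
qed

section \<open>The trace inequality\<close>

text \<open>Dominated convergence for unordered sums: the M-test makes the finite partial sums
  converge uniformly in n, so the two limits may be exchanged.\<close>

lemma has_sum_dominated:
  fixes f :: "nat \<Rightarrow> 'i \<Rightarrow> 'b::banach"
  assumes f: "\<And>n. (f n has_sum s n) B" and le: "\<And>n e. e \<in> B \<Longrightarrow> norm (f n e) \<le> g e" and g: "g summable_on B"
    and lim: "\<And>e. e \<in> B \<Longrightarrow> (\<lambda>n. f n e) \<longlonglongrightarrow> F e" and F: "(F has_sum S) B"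
  shows "s \<longlonglongrightarrow> S"
proof (rule swap_uniform_limit'[where F = "finite_subsets_at_top B" and S = UNIV])
  have "uniform_limit UNIV (\<lambda>X n. \<Sum>e\<in>X. f n e) (\<lambda>n. \<Sum>\<^sub>\<infinity>e\<in>B. f n e) (finite_subsets_at_top B)"
    by (rule Weierstrass_m_test_general[OF le g])
  then show "uniform_limit UNIV (\<lambda>X n. \<Sum>e\<in>X. f n e) s (finite_subsets_at_top B)"
    by (simp add: infsumI[OF f])
  show "((\<lambda>X. \<Sum>e\<in>X. F e) \<longlongrightarrow> S) (finite_subsets_at_top B)"
    using F by (simp add: has_sum_def)
  show "\<forall>\<^sub>F X in finite_subsets_at_top B. (\<lambda>n. \<Sum>e\<in>X. f n e) \<longlonglongrightarrow> (\<Sum>e\<in>X. F e)"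
    by (rule eventually_finite_subsets_at_top_weakI) (auto intro!: tendsto_sum lim)
qed auto

text \<open>With N = n + 1, (Nt)^p <= Nt + 1 gives t^p <= N^(-p) (Nt + 1). The last factor cancels
  the denominator in the bound on 1 - c, leaving the error 2 N^(-p) uniformly in t. The constant 2
  also admits the square of a cutoff with error 1/(Nt + 1).\<close>

lemma uniform_limit_powr_cutoff:
  assumes p: "0 < p" "p \<le> 1"
    and c: "\<And>n t. 0 \<le> t \<Longrightarrow> \<bar>1 - c n t\<bar> \<le> 2 / (real (Suc n) * t + 1)"
  shows "uniform_limit {0..M} (\<lambda>n t. t powr p * c n t) (\<lambda>t. t powr p) sequentially"
proof (rule uniform_limitI)
  fix e :: real assume e: "0 < e"
  have bound: "dist (t powr p * c n t) (t powr p) \<le> 2 * real (Suc n) powr (- p)" if t: "0 \<le> t" for n t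
  proof -
    define N where "N = real (Suc n)"
    have N: "0 < N" by (simp add: N_def)
    have pos: "0 < N * t + 1"
      using N t by (simp add: add_nonneg_pos)
    have "(N * t) powr p \<le> N * t + 1"
    proof (cases "N * t \<le> 1")
      case True
      then have "(N * t) powr p \<le> 1"
        using p N t by (intro powr_le1) auto
      then show ?thesis
        using N t by (simp add: add_increasing)
    next
      case False
      then have "(N * t) powr p \<le> (N * t) powr 1"
        using p by (intro powr_mono) auto
      then show ?thesis
        using False by simp
    qed
    then have "N powr (- p) * (N * t) powr p \<le> N powr (- p) * (N * t + 1)"
      by (rule mult_left_mono) simp
    then have le: "t powr p \<le> N powr (- p) * (N * t + 1)"
      using N t by (simp add: powr_mult powr_minus field_simps)
    have "dist (t powr p * c n t) (t powr p) = t powr p * \<bar>1 - c n t\<bar>"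
      using abs_mult[of "t powr p" "1 - c n t"] by (simp add: dist_real_def right_diff_distrib abs_minus_commute)
    also have "\<dots> \<le> (N powr (- p) * (N * t + 1)) * (2 / (N * t + 1))"
      using le c[OF t, of n] order_trans[OF powr_ge_zero le] unfolding N_def by (intro mult_mono) auto
    also have "\<dots> = 2 * N powr (- p)"
      using pos by simp
    finally show ?thesis
      by (simp add: N_def)
  qed
  have lim: "(\<lambda>n. 2 * real (Suc n) powr (- p)) \<longlonglongrightarrow> 2 * 0"
    using p by (intro tendsto_mult tendsto_const tendsto_neg_powr filterlim_compose[OF filterlim_real_sequentially filterlim_Suc]) auto
  have "\<forall>\<^sub>F n in sequentially. 2 * real (Suc n) powr (- p) < e"
    by (rule order_tendstoD(2)[OF lim]) (use e in simp)
  then show "\<forall>\<^sub>F n in sequentially. \<forall>t\<in>{0..M}. dist (t powr p * c n t) (t powr p) < e"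
    by (rule eventually_mono) (use bound in \<open>fastforce intro: order_le_less_trans\<close>)
qed

section \<open>Traces of products of powers\<close>

text \<open>Y^r Z^s is dominated by Z^r Z^s = Z^(1/2), hence is Hilbert-Schmidt. So is its adjoint
  Z^s Y^r, which in turn dominates X^s Y^r.\<close>

lemma hs_powr_product:
  assumes X: "positive_op X" and Y: "positive_op Y" and Z: "positive_op Z" "hs (powr_op Z (1/2)) z"
    and XZ: "\<And>u. Re (cinner u (X u)) \<le> Re (cinner u (Z u))"
    and YZ: "\<And>u. Re (cinner u (Y u)) \<le> Re (cinner u (Z u))"
    and sr: "0 \<le> s" "0 \<le> r" "s + r = 1/2"
  obtains h where "hs (\<lambda>u. powr_op X s (powr_op Y r u)) h"
proof -
  have half: "s \<le> 1/2" "r \<le> 1/2"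
    using sr by auto
  note aX = adjoint_pair_powr_op[OF X sr(1)] and aY = adjoint_pair_powr_op[OF Y sr(2)]
    and aZ = adjoint_pair_powr_op[OF Z(1) sr(1)]
  have "norm (powr_op Y r (powr_op Z s u)) \<le> norm (powr_op Z (1/2) u)" for u
    using Loewner_Heinz[OF Y Z(1) YZ sr(2) half(2)] powr_op_add[OF Z(1) sr(2,1), of u] sr(3)
    by (simp only: add.commute[of r s])
  then obtain h1 where "hs (\<lambda>u. powr_op Y r (powr_op Z s u)) h1"
    using hs_mono[OF Z(2) adjoint_pair_comp[OF aY aZ]] by blast
  then have "hs (\<lambda>u. powr_op Z s (powr_op Y r u)) h1"
    by (rule hs_adjoint[OF _ adjoint_pair_comp[OF aY aZ]])
  then obtain h where "hs (\<lambda>u. powr_op X s (powr_op Y r u)) h"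
    by (rule hs_mono[OF _ adjoint_pair_comp[OF aX aY] Loewner_Heinz[OF X Z(1) XZ sr(1) half(1)]])
  then show thesis by (rule that)
qed

text \<open>
  \<open>X\<^bsup>1-\<nu>\<^esup> Y\<^bsup>\<nu>\<^esup>\<close> has to be rotated into the positive operator \<open>Y\<^bsup>\<nu>/2\<^esup> X\<^bsup>1-\<nu>\<^esup> Y\<^bsup>\<nu>/2\<^esup>\<close>, but the
  two factors \<open>X\<^bsup>(1-\<nu>)/2\<^esup>\<close> and \<open>X\<^bsup>(1-\<nu>)/2\<^esup> Y\<^bsup>\<nu>\<^esup>\<close> need not be Hilbert--Schmidt. They are after
  multiplication by the cutoff \<open>m X (m X + 1)\<^bsup>-1\<^esup>\<close>, which tends to the identity on the range of \<open>X\<close>.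
\<close>

lemma trace_powr_product_le_half:
  fixes X Y Z :: "'a::chilbert_space \<Rightarrow> 'a"
  assumes X: "positive_op X" and Y: "positive_op Y" and Z: "positive_op Z" "hs (powr_op Z (1/2)) z"
    and XZ: "\<And>u. Re (cinner u (X u)) \<le> Re (cinner u (Z u))"
    and YZ: "\<And>u. Re (cinner u (Y u)) \<le> Re (cinner u (Z u))"
    and \<nu>: "0 \<le> \<nu>" "\<nu> \<le> 1/2"
  obtains n where "hs (\<lambda>u. powr_op X ((1 - \<nu>) / 2) (powr_op Y (\<nu> / 2) u)) n"
    "has_trace (\<lambda>u. powr_op X (1 - \<nu>) (powr_op Y \<nu> u)) (complex_of_real n)"
proof -
  define a where "a = (1 - \<nu>) / 2"
  have a: "0 < a" "a \<le> 1/2" "a + \<nu>/2 = 1/2" "a + a = 1 - \<nu>" "0 \<le> 1/2 - \<nu>" "1/2 + (1/2 - \<nu>) = 1 - \<nu>"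
    using \<nu> by (auto simp: a_def field_simps)
  define Yh where "Yh = powr_op Y (\<nu>/2)"
  define Y1 where "Y1 = powr_op Y \<nu>"
  have aYh: "adjoint_pair Yh Yh" and aY1: "adjoint_pair Y1 Y1" and bY1: "bounded_op Y1" and bYh: "bounded_op Yh"
    and YY: "\<And>u. Y1 u = Yh (Yh u)"
    unfolding Yh_def Y1_def
    using adjoint_pair_powr_op[OF Y] bounded_op_powr_op[OF Y] powr_op_add[OF Y, of "\<nu>/2" "\<nu>/2"] \<nu> by auto
  define Q where "Q = powr_op X (1/2)"
  have aQ: "adjoint_pair Q Q"
    unfolding Q_def by (rule adjoint_pair_powr_op[OF X]) simp
  have Q0: "norm (Q u) \<le> norm (powr_op Z (1/2) u)" for u
    unfolding Q_def by (rule Loewner_Heinz[OF X Z(1) XZ]) auto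
  obtain hq where hQ: "hs Q hq"
    using hs_mono[OF Z(2) aQ Q0] by blast
  define Xr where "Xr = powr_op X (1/2 - \<nu>)"
  have aXr: "adjoint_pair Xr Xr"
    unfolding Xr_def by (rule adjoint_pair_powr_op[OF X a(5)])
  \<comment> \<open>X^(1-\<nu>) Y^\<nu> = Q R with both factors Hilbert-Schmidt, so its trace
    exists. The exponent 1/2 - \<nu> in R is where \<nu> <= 1/2 enters.\<close>
  define R where "R u = Xr (Y1 u)" for u
  have aR: "adjoint_pair R (\<lambda>u. Y1 (Xr u))"
    unfolding R_def[abs_def] by (rule adjoint_pair_comp[OF aXr aY1])
  obtain hr where hR: "hs R hr"
    using hs_powr_product[OF X Y Z XZ YZ a(5) \<nu>(1)] unfolding R_def[abs_def] Xr_def Y1_def by auto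
  define Xa where "Xa = powr_op X a"
  have Xa_fun: "Xa = fun_op (\<lambda>t. t powr a) X"
    using a(1) by (simp add: Xa_def powr_op_def)
  define W where "W u = Xa (Yh u)" for u
  obtain n where hW: "hs W n"
    using hs_powr_product[OF X Y Z XZ YZ, of a "\<nu>/2"] a(1,3) \<nu> unfolding W_def[abs_def] Xa_def Yh_def by auto
  define k where "k m t = real (Suc m) * t / (real (Suc m) * t + 1)" for m and t :: real
  have den: "0 < real (Suc m) * t + 1" if "0 \<le> t" for m t
    using that by (intro add_nonneg_pos mult_nonneg_nonneg) auto
  have k01: "0 \<le> k m t" "k m t \<le> 1" if "0 \<le> t" for m t
    using den[OF that, of m] that by (auto simp: k_def pos_divide_le_eq)
  have k1: "1 - k m t = 1 / (real (Suc m) * t + 1)" if "0 \<le> t" for m t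
    using den[OF that, of m] by (simp add: k_def field_simps)
  have kcont: "continuous_on {0..} (k m)" for m
    unfolding k_def using den[of _ m] by (intro continuous_intros) (metis atLeast_iff less_numeral_extra(3))
  have pcont: "continuous_on {0..} (\<lambda>t::real. t powr p)" if "0 < p" for p
    using continuous_on_pow[of p] that by simp
  \<comment> \<open>X^a with one cutoff and, in \<open>E m\<close>, X^(1/2) with two. As 2a = 1 -
    \<nu>, the square of \<open>S m\<close> is \<open>E m\<close> times X^(1/2-\<nu>).\<close>
  define S where "S m = fun_op (\<lambda>t. t powr a * k m t) X" for m
  define E where "E m = fun_op (\<lambda>t. t powr (1/2) * (k m t * k m t)) X" for m
  note Scont = continuous_on_mult[OF pcont[OF a(1)] kcont]
  have Econt: "continuous_on {0..} (\<lambda>t. t powr (1/2) * (k m t * k m t))" for m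
    by (intro continuous_on_mult pcont kcont) simp
  have Qfun: "Q = fun_op (\<lambda>t. t powr (1/2)) X"
    by (simp add: Q_def powr_op_def)
  have aS: "adjoint_pair (S m) (S m)" for m
    unfolding S_def by (rule adjoint_pair_fun_op[OF X Scont])
  have aE: "adjoint_pair (E m) (E m)" for m
    unfolding E_def by (rule adjoint_pair_fun_op[OF X Econt])
  have S_lim: "(\<lambda>m. S m u) \<longlonglongrightarrow> Xa u" for u
    unfolding S_def Xa_fun
  proof (rule fun_op_tendsto[OF X pcont[OF a(1)] Scont])
    show "uniform_limit {0..M} (\<lambda>m t. t powr a * k m t) (\<lambda>t. t powr a) sequentially" for M
    proof (rule uniform_limit_powr_cutoff)
      show "\<bar>1 - k m t\<bar> \<le> 2 / (real (Suc m) * t + 1)" if "0 \<le> t" for m t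
        using den[OF that, of m] unfolding k1[OF that] by (simp add: divide_right_mono)
    qed (use a in auto)
  qed
  have E_lim: "(\<lambda>m. E m u) \<longlonglongrightarrow> Q u" for u
    unfolding E_def Qfun
  proof (rule fun_op_tendsto[OF X pcont Econt])
    show "uniform_limit {0..M} (\<lambda>m t. t powr (1/2) * (k m t * k m t)) (\<lambda>t. t powr (1/2)) sequentially" for M
    proof (rule uniform_limit_powr_cutoff)
      show "\<bar>1 - k m t * k m t\<bar> \<le> 2 / (real (Suc m) * t + 1)" if "0 \<le> t" for m t
      proof -
        have "1 - k m t * k m t = (1 + k m t) * (1 - k m t)"
          by (simp add: algebra_simps)
        then have "\<bar>1 - k m t * k m t\<bar> = (1 + k m t) * (1 - k m t)"
          using k01[OF that, of m] by simp
        also have "\<dots> \<le> 2 * (1 - k m t)"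
          using k01[OF that, of m] by (intro mult_right_mono) auto
        finally show ?thesis
          unfolding k1[OF that] by simp
      qed
    qed auto
  qed simp
  have S_le: "norm (S m u) \<le> norm (Xa u)" for m u
    using norm_fun_op_mono[OF X Scont pcont[OF a(1)] kcont, of m m 1 u] k01
    unfolding S_def Xa_fun by (simp add: mult.commute)
  have E_le: "norm (E m u) \<le> norm (Q u)" for m u
    using norm_fun_op_mono[OF X Econt pcont continuous_on_mult[OF kcont kcont], of "1/2" m m m 1 u] k01
    unfolding E_def Qfun by (simp add: mult.commute mult_le_one)
  \<comment> \<open>The cutoff lends X^a the missing power: t^a k is t^(1/2) times N t^(a+1/2)/(Nt +
    1), where N = m + 1, and this factor is at most N because a + 1/2 <= 1.\<close>
  have S_le_Q: "norm (S m u) \<le> real (Suc m) * norm (Q u)" for m u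
    unfolding S_def Qfun
  proof (rule norm_fun_op_mono[OF X Scont pcont])
    show "continuous_on {0..} (\<lambda>t. t powr (a + 1/2) * (real (Suc m) / (real (Suc m) * t + 1)))"
      using den[of _ m] a(1)
      by (intro continuous_on_mult pcont continuous_on_divide continuous_intros) (auto simp: less_imp_neq[THEN not_sym])
    show "t powr a * k m t = t powr (a + 1/2) * (real (Suc m) / (real (Suc m) * t + 1)) * t powr (1/2)"
      if "0 \<le> t" for t
    proof -
      have "t powr (a + 1/2) * t powr (1/2) = t powr a * t"
        using that by (simp add: powr_add[symmetric] powr_mult_base mult.commute)
      then show ?thesis
        by (simp add: k_def mult.commute mult.left_commute)
    qed
    show "\<bar>t powr (a + 1/2) * (real (Suc m) / (real (Suc m) * t + 1))\<bar> \<le> real (Suc m)" if t: "0 \<le> t" for t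
    proof -
      have "t powr (a + 1/2) \<le> real (Suc m) * t + 1"
      proof (cases "t \<le> 1")
        case True
        then have "t powr (a + 1/2) \<le> 1"
          using t a by (intro powr_le1) auto
        then show ?thesis
          using t by (simp add: add_increasing)
      next
        case False
        then have "t powr (a + 1/2) \<le> t powr 1"
          using a by (intro powr_mono) auto
        then show ?thesis
          using t mult_right_mono[of 1 "real (Suc m)" t] by simp
      qed
      then have "t powr (a + 1/2) / (real (Suc m) * t + 1) \<le> 1"
        using den[OF t, of m] by simp
      then have "real (Suc m) * (t powr (a + 1/2) / (real (Suc m) * t + 1)) \<le> real (Suc m) * 1"
        by (rule mult_left_mono) simp
      then show ?thesis
        using den[OF t, of m] by (simp add: abs_mult mult.commute)
    qed
  qed simp
  have "\<exists>h. hs (S m) h" for m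
    using hs_mono_const[OF hQ aS S_le_Q] by blast
  then obtain hS where hS: "\<And>m. hs (S m) (hS m)"
    by metis
  have aYS: "adjoint_pair (\<lambda>u. Y1 (S m u)) (\<lambda>u. S m (Y1 u))" for m
    by (rule adjoint_pair_comp[OF aY1 aS])
  have ex: "\<exists>h. hs (\<lambda>u. S m (Yh u)) h \<and> has_trace (\<lambda>u. E m (R u)) (complex_of_real h)" for m
  proof -
    obtain h1 where "hs (\<lambda>u. Y1 (S m u)) h1"
      using hs_mono_const[OF hS aYS onorm[OF bounded_op_linear[OF bY1]]] by blast
    then have h1: "hs (\<lambda>u. S m (Y1 u)) h1"
      by (rule hs_adjoint[OF _ aYS])
    obtain h2 where h2: "hs (\<lambda>u. Yh (S m u)) h2"
      using hs_mono_const[OF hS adjoint_pair_comp[OF aYh aS] onorm[OF bounded_op_linear[OF bYh]]] by blast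
    \<comment> \<open>The rotation: with both S and S Y^\<nu> Hilbert-Schmidt, Tr S S Y^\<nu>
      becomes Tr S Y^\<nu> S, a sum of squares ||Y^(\<nu>/2) S e||^2.\<close>
    obtain \<tau> where \<tau>: "\<And>B. is_onb B \<Longrightarrow> ((\<lambda>e. cinner (S m e) (S m (Y1 e))) has_sum \<tau>) B"
      "\<And>B. is_onb B \<Longrightarrow> ((\<lambda>e. cinner (Y1 (S m e)) (S m e)) has_sum \<tau>) B"
      using trace_cyclic[OF hS aS h1 adjoint_pair_sym[OF aYS]] by metis
    obtain B :: "'a set" where B: "is_onb B"
      using is_onb_ex by blast
    have "cinner (Y1 (S m e)) (S m e) = complex_of_real ((norm (Yh (S m e)))\<^sup>2)" for e
      unfolding YY adjoint_pairD[OF aYh] cinner_self ..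
    then have "((\<lambda>e. complex_of_real ((norm (Yh (S m e)))\<^sup>2)) has_sum \<tau>) B"
      using \<tau>(2)[OF B] by simp
    moreover have "((\<lambda>e. complex_of_real ((norm (Yh (S m e)))\<^sup>2)) has_sum complex_of_real h2) B"
      using hsD[OF h2 B] by (simp only: has_sum_of_real_iff)
    ultimately have \<tau>h2: "\<tau> = complex_of_real h2"
      by (rule has_sum_unique)
    have "cinner (S m e) (S m (Y1 e)) = cinner e (E m (R e))" for e
    proof -
      have cr: "continuous_on {0..} (\<lambda>t::real. if 1/2 - \<nu> = 0 then 1 else t powr (1/2 - \<nu>))"
        by (rule continuous_on_pow[OF a(5)])
      have "fun_op (\<lambda>t. t powr a * k m t * (t powr a * k m t)) X =
          fun_op (\<lambda>t. t powr (1/2) * (k m t * k m t) * (if 1/2 - \<nu> = 0 then 1 else t powr (1/2 - \<nu>))) X"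
      proof (rule fun_op_cong[OF X continuous_on_mult[OF Scont Scont]])
        fix t :: real
        have "t powr a * t powr a = t powr (1/2) * (if 1/2 - \<nu> = 0 then 1 else t powr (1/2 - \<nu>))"
        proof (cases "\<nu> = 1/2")
          case True
          show ?thesis
            unfolding powr_add[symmetric] a(4) unfolding True by simp
        next
          case False
          then show ?thesis
            unfolding powr_add[symmetric] a(4) using a(6) by (simp flip: powr_add)
        qed
        then show "t powr a * k m t * (t powr a * k m t) =
            t powr (1/2) * (k m t * k m t) * (if 1/2 - \<nu> = 0 then 1 else t powr (1/2 - \<nu>))"
          by (metis mult.assoc mult.commute)
      qed
      then have "S m (S m v) = E m (Xr v)" for v
        unfolding S_def E_def Xr_def powr_op_def
        by (simp only: fun_op_mult[OF X Scont Scont, symmetric] fun_op_mult[OF X Econt cr, symmetric])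
      then show ?thesis
        by (simp add: adjoint_pairD[OF aS] R_def)
    qed
    then have "has_trace (\<lambda>u. E m (R u)) (complex_of_real h2)"
      using \<tau>(1) \<tau>h2 by (simp add: has_trace_def)
    then show ?thesis
      using hs_adjoint[OF h2 adjoint_pair_comp[OF aYh aS]] by blast
  qed
  then obtain h where h: "\<And>m. hs (\<lambda>u. S m (Yh u)) (h m)"
    "\<And>m. has_trace (\<lambda>u. E m (R u)) (complex_of_real (h m))"
    by metis
  obtain \<tau> where \<tau>: "\<And>B. is_onb B \<Longrightarrow> ((\<lambda>e. cinner (Q e) (R e)) has_sum \<tau>) B"
    using trace_cyclic[OF hQ aQ hR aR] by metis
  obtain B :: "'a set" where B: "is_onb B"
    using is_onb_ex by blast
  \<comment> \<open>The cutoff is removed from both descriptions of \<open>h m\<close>: as squared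
    norms they tend to n, as traces of E R they tend to the trace of Q R.\<close>
  have "h \<longlonglongrightarrow> n"
  proof (rule has_sum_dominated[OF hsD[OF h(1) B]])
    show "(\<lambda>e. (norm (W e))\<^sup>2) summable_on B"
      using hsD[OF hW B] by (auto simp: summable_on_def)
    show "norm ((norm (S m (Yh e)))\<^sup>2) \<le> (norm (W e))\<^sup>2" for m e
      using S_le[of m "Yh e"] by (simp add: W_def power_mono)
    show "(\<lambda>m. (norm (S m (Yh e)))\<^sup>2) \<longlonglongrightarrow> (norm (W e))\<^sup>2" for e
      unfolding W_def by (intro tendsto_power tendsto_norm S_lim)
  qed (rule hsD[OF hW B])
  then have lim1: "(\<lambda>m. complex_of_real (h m)) \<longlonglongrightarrow> complex_of_real n"
    by (rule tendsto_of_real)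
  have lim2: "(\<lambda>m. complex_of_real (h m)) \<longlonglongrightarrow> \<tau>"
  proof (rule has_sum_dominated)
    show "((\<lambda>e. cinner (E m e) (R e)) has_sum complex_of_real (h m)) B" for m
      using h(2)[of m] B by (simp add: has_trace_def adjoint_pairD[OF aE])
    show "(\<lambda>e. (norm (Q e))\<^sup>2 + (norm (R e))\<^sup>2) summable_on B"
      using hsD[OF hQ B] hsD[OF hR B] by (intro summable_on_add) (auto simp: summable_on_def)
    show "norm (cinner (E m e) (R e)) \<le> (norm (Q e))\<^sup>2 + (norm (R e))\<^sup>2" for m e
    proof -
      have "norm (cinner (E m e) (R e)) \<le> norm (Q e) * norm (R e)"
        using order_trans[OF Cauchy_Schwarz mult_right_mono[OF E_le norm_ge_zero]] .
      also have "\<dots> \<le> (norm (Q e))\<^sup>2 + (norm (R e))\<^sup>2"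
        using sum_squares_bound[of "norm (Q e)" "norm (R e)"] mult_nonneg_nonneg[OF norm_ge_zero[of "Q e"] norm_ge_zero[of "R e"]]
        unfolding mult.assoc by linarith
      finally show ?thesis .
    qed
    show "(\<lambda>m. cinner (E m e) (R e)) \<longlonglongrightarrow> cinner (Q e) (R e)" for e
      by (intro cinner.tendsto E_lim tendsto_const)
  qed (rule \<tau>[OF B])
  have "\<tau> = complex_of_real n"
    using LIMSEQ_unique[OF lim2 lim1] .
  moreover have "cinner (Q e) (R e) = cinner e (powr_op X (1 - \<nu>) (Y1 e))" for e
    unfolding R_def adjoint_pairD[OF aQ] using powr_op_add[OF X _ a(5), of "1/2" "Y1 e"] a(6)
    by (simp add: Q_def Xr_def)
  ultimately have "has_trace (\<lambda>u. powr_op X (1 - \<nu>) (Y1 u)) (complex_of_real n)"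
    using \<tau> by (simp add: has_trace_def)
  then show thesis
    using that hW by (simp add: W_def[abs_def] Y1_def Xa_def Yh_def a_def)
qed

text \<open>For \<nu> > 1/2 exchange X with Y and \<nu> with 1 - \<nu>. Taking adjoints restores the
  order and conjugates the trace, which is real.\<close>

lemma trace_powr_product:
  fixes X Y Z :: "'a::chilbert_space \<Rightarrow> 'a"
  assumes X: "positive_op X" and Y: "positive_op Y" and Z: "positive_op Z" "hs (powr_op Z (1/2)) z"
    and XZ: "\<And>u. Re (cinner u (X u)) \<le> Re (cinner u (Z u))"
    and YZ: "\<And>u. Re (cinner u (Y u)) \<le> Re (cinner u (Z u))"
    and \<nu>: "0 \<le> \<nu>" "\<nu> \<le> 1"
  obtains n where "hs (\<lambda>u. powr_op X ((1 - \<nu>) / 2) (powr_op Y (\<nu> / 2) u)) n"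
    "has_trace (\<lambda>u. powr_op X (1 - \<nu>) (powr_op Y \<nu> u)) (complex_of_real n)"
proof (cases "\<nu> \<le> 1/2")
  case True
  then show thesis
    using trace_powr_product_le_half[OF X Y Z XZ YZ \<nu>(1)] that by blast
next
  case False
  then obtain n where n: "hs (\<lambda>u. powr_op Y (\<nu> / 2) (powr_op X ((1 - \<nu>) / 2) u)) n"
    "has_trace (\<lambda>u. powr_op Y \<nu> (powr_op X (1 - \<nu>) u)) (complex_of_real n)"
    using trace_powr_product_le_half[OF Y X Z YZ XZ, of "1 - \<nu>"] \<nu> by auto
  have nn: "0 \<le> \<nu> / 2" "0 \<le> (1 - \<nu>) / 2" "0 \<le> 1 - \<nu>"
    using \<nu> by auto
  have "hs (\<lambda>u. powr_op X ((1 - \<nu>) / 2) (powr_op Y (\<nu> / 2) u)) n"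
    by (rule hs_adjoint[OF n(1) adjoint_pair_comp[OF adjoint_pair_powr_op[OF Y nn(1)] adjoint_pair_powr_op[OF X nn(2)]]])
  moreover have "has_trace (\<lambda>u. powr_op X (1 - \<nu>) (powr_op Y \<nu> u)) (complex_of_real n)"
    unfolding has_trace_def
  proof (intro allI impI)
    fix B :: "'a set" assume B: "is_onb B"
    have "cinner e (powr_op X (1 - \<nu>) (powr_op Y \<nu> e)) = cnj (cinner e (powr_op Y \<nu> (powr_op X (1 - \<nu>) e)))" for e
      using cinner_commute[of "powr_op Y \<nu> (powr_op X (1 - \<nu>) e)" e]
      by (simp add: adjoint_pairD[OF adjoint_pair_powr_op[OF X nn(3)]] adjoint_pairD[OF adjoint_pair_powr_op[OF Y \<nu>(1)]])
    moreover have "((\<lambda>e. cnj (cinner e (powr_op Y \<nu> (powr_op X (1 - \<nu>) e)))) has_sum cnj (complex_of_real n)) B"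
      using n(2) B unfolding has_sum_cnj_iff by (simp add: has_trace_def)
    ultimately show "((\<lambda>e. cinner e (powr_op X (1 - \<nu>) (powr_op Y \<nu> e))) has_sum complex_of_real n) B"
      by simp
  qed
  ultimately show thesis by (rule that)
qed

text \<open>The chain of trace inequalities in squared Hilbert-Schmidt norms, with H the root of
  Z^\<nu> - Y^\<nu>. From ||Z^b u||^2 = ||Y^b u||^2 + ||H u||^2 come x <= ||Z^b X^a||^2 = n + ||H
  X^a||^2 and z = ||Y^b Z^a||^2 + ||H Z^a||^2. Moreover ||H X^a|| <= ||H Z^a|| and y <= ||Y^b
  Z^a||^2, both proved on the adjoints, where the factor to be compared stands on the left.\<close>

lemma trace_powr_product_ge:
  assumes X: "positive_op X" "hs (powr_op X (1/2)) x" and Y: "positive_op Y" "hs (powr_op Y (1/2)) y"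
    and Z: "positive_op Z" "hs (powr_op Z (1/2)) z"
    and XZ: "\<And>u. Re (cinner u (X u)) \<le> Re (cinner u (Z u))"
    and YZ: "\<And>u. Re (cinner u (Y u)) \<le> Re (cinner u (Z u))"
    and \<nu>: "0 \<le> \<nu>" "\<nu> \<le> 1"
    and n: "hs (\<lambda>u. powr_op X ((1 - \<nu>) / 2) (powr_op Y (\<nu> / 2) u)) n"
  shows "x - n \<le> z - y"
proof -
  define a b where "a = (1 - \<nu>) / 2" and "b = \<nu> / 2"
  have ab: "0 \<le> a" "a \<le> 1/2" "0 \<le> b" "b \<le> 1/2" "b + a = 1/2" "a + b = 1/2" "2 * b = \<nu>"
    using \<nu> by (auto simp: a_def b_def field_simps)
  note adj = adjoint_pair_powr_op
  have halves: "powr_op A (1/2) u = powr_op A b (powr_op A a u)" "powr_op A (1/2) u = powr_op A a (powr_op A b u)"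
    if "positive_op A" for A :: "'a \<Rightarrow> 'a" and u
    using powr_op_add[OF that ab(3,1), of u] powr_op_add[OF that ab(1,3), of u] by (simp_all add: ab)
  define K where "K u = powr_op Z \<nu> u - powr_op Y \<nu> u" for u
  have K: "positive_op K"
  proof (rule positive_opI)
    show "bounded_op K" "adjoint_pair K K"
      unfolding K_def[abs_def]
      by (rule bounded_op_diff[OF bounded_op_powr_op[OF Z(1) \<nu>(1)] bounded_op_powr_op[OF Y(1) \<nu>(1)]]
          adjoint_pair_diff[OF adj[OF Z(1) \<nu>(1)] adj[OF Y(1) \<nu>(1)]])+
    show "0 \<le> Re (cinner u (K u))" for u
      using power_mono[OF Loewner_Heinz[OF Y(1) Z(1) YZ ab(3,4), of u] norm_ge_zero, of 2]
      by (simp add: norm_powr_op_sq Y(1) Z(1) ab K_def cinner.diff_right)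
  qed
  define H where "H = powr_op K (1/2)"
  have aH: "adjoint_pair H H"
    unfolding H_def by (rule adj[OF K]) simp
  have split: "(norm (powr_op Z b u))\<^sup>2 = (norm (powr_op Y b u))\<^sup>2 + (norm (H u))\<^sup>2" for u
    unfolding H_def norm_powr_op_half_sq[OF K]
    by (simp add: norm_powr_op_sq Y(1) Z(1) ab K_def cinner.diff_right)
  obtain m where m: "hs (\<lambda>u. powr_op Y b (powr_op Z a u)) m"
    by (rule hs_mono[OF Z(2) adjoint_pair_comp[OF adj[OF Y(1) ab(3)] adj[OF Z(1) ab(1)]]])
      (simp add: halves(1)[OF Z(1)] Loewner_Heinz[OF Y(1) Z(1) YZ ab(3,4)])
  have "hs (\<lambda>u. powr_op Z a (powr_op Y b u)) m"
    by (rule hs_adjoint[OF m adjoint_pair_comp[OF adj[OF Y(1) ab(3)] adj[OF Z(1) ab(1)]]])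
  then have "y \<le> m"
    by (rule hs_le[OF _ Y(2)]) (simp add: halves(2)[OF Y(1)] Loewner_Heinz[OF Y(1) Z(1) YZ ab(1,2)])
  have le_Z: "norm (H u) \<le> norm (powr_op Z b u)" for u
    by (rule power2_le_imp_le) (simp_all add: split)
  obtain k where k: "hs (\<lambda>u. H (powr_op Z a u)) k"
    by (rule hs_mono[OF Z(2) adjoint_pair_comp[OF aH adj[OF Z(1) ab(1)]]])
      (simp add: halves(1)[OF Z(1)] le_Z)
  have "z = m + k"
    by (rule hs_unique[OF Z(2) hs_sum[OF m k]]) (simp add: halves(1)[OF Z(1)] split)
  have "hs (\<lambda>u. powr_op Z a (H u)) k"
    by (rule hs_adjoint[OF k adjoint_pair_comp[OF aH adj[OF Z(1) ab(1)]]])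
  then obtain k' where k': "hs (\<lambda>u. powr_op X a (H u)) k'" "k' \<le> k"
    by (rule hs_mono[OF _ adjoint_pair_comp[OF adj[OF X(1) ab(1)] aH] Loewner_Heinz[OF X(1) Z(1) XZ ab(1,2)]])
  have HX: "hs (\<lambda>u. H (powr_op X a u)) k'"
    by (rule hs_adjoint[OF k'(1) adjoint_pair_comp[OF adj[OF X(1) ab(1)] aH]])
  have YX: "hs (\<lambda>u. powr_op Y b (powr_op X a u)) n"
    by (rule hs_adjoint[OF n[folded a_def b_def] adjoint_pair_comp[OF adj[OF X(1) ab(1)] adj[OF Y(1) ab(3)]]])
  have "hs (\<lambda>u. powr_op Z b (powr_op X a u)) (n + k')"
    by (rule hs_sum[OF YX HX]) (simp add: split)
  then have "x \<le> n + k'"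
    by (rule hs_le[OF _ X(2)]) (simp add: halves(1)[OF X(1)] Loewner_Heinz[OF X(1) Z(1) XZ ab(3,4)])
  then show ?thesis
    using \<open>y \<le> m\<close> \<open>z = m + k\<close> k'(2) by linarith
qed

theorem proposition2p3:
  fixes X Y :: "'a::chilbert_space \<Rightarrow> 'a" and \<nu> :: real
  assumes "positive_op X" and "positive_op Y"
    and "finite_trace X" and "finite_trace Y"
    and "0 < \<nu>" and "\<nu> \<le> 1"
  shows "tsallis_rel_entropy \<nu> X Y \<le> trace_op (pos_part_op (X - Y)) / complex_of_real \<nu>"
proof -
  note X = assms(1) and Y = assms(2)
  obtain x where x: "has_trace X (complex_of_real x)" "hs (powr_op X (1/2)) x"
    using finite_trace_positive[OF X assms(3)] .
  obtain y where y: "has_trace Y (complex_of_real y)" "hs (powr_op Y (1/2)) y"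
    using finite_trace_positive[OF Y assms(4)] .
  define D where "D u = X u - Y u" for u
  have bD: "bounded_op D" and sD: "adjoint_pair D D"
    unfolding D_def[abs_def]
    by (rule bounded_op_diff[OF positive_op_bounded[OF X] positive_op_bounded[OF Y]]
        adjoint_pair_diff[OF positive_op_adjoint_pair[OF X] positive_op_adjoint_pair[OF Y]])+
  obtain d where d: "has_trace (abs_op D) (complex_of_real d)"
    using finite_trace_abs_op_diff[OF X x(2) Y y(2)] unfolding D_def[abs_def] .
  define P where "P = pos_part_op D"
  \<comment> \<open>The trace of P = (D + |D|)/2 by linearity.\<close>
  define \<delta> where "\<delta> = (1/2) * (x - y + d)"
  have P: "positive_op P"
    unfolding P_def by (rule positive_pos_part_op[OF bD sD])
  have "has_trace D (complex_of_real x - complex_of_real y)"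
    unfolding D_def[abs_def] by (rule has_trace_diff[OF x(1) y(1)])
  then have "has_trace P ((1/2) *\<^sub>R (complex_of_real x - complex_of_real y + complex_of_real d))"
    unfolding P_def pos_part_op_def by (intro has_trace_scaleR has_trace_add d)
  then have \<delta>: "has_trace P (complex_of_real \<delta>)"
    by (simp add: \<delta>_def scaleR_conv_of_real)
  define Z where "Z u = Y u + P u" for u
  have Z: "positive_op Z"
  proof (rule positive_opI)
    show "bounded_op Z" "adjoint_pair Z Z"
      unfolding Z_def[abs_def]
      by (rule bounded_op_add[OF positive_op_bounded[OF Y] positive_op_bounded[OF P]]
          adjoint_pair_add[OF positive_op_adjoint_pair[OF Y] positive_op_adjoint_pair[OF P]])+
    show "0 \<le> Re (cinner u (Z u))" for u
      using positive_op_Re_nonneg[OF Y, of u] positive_op_Re_nonneg[OF P, of u]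
      by (simp add: Z_def cinner_add_right)
  qed
  have "has_trace Z (complex_of_real (y + \<delta>))"
    unfolding Z_def[abs_def] of_real_add by (rule has_trace_add[OF y(1) \<delta>])
  then have z: "hs (powr_op Z (1/2)) (y + \<delta>)"
    by (simp only: has_trace_iff_hs[OF Z])
  have YZ: "Re (cinner u (Y u)) \<le> Re (cinner u (Z u))" for u
    using positive_op_Re_nonneg[OF P, of u] by (simp add: Z_def cinner_add_right)
  have XZ: "Re (cinner u (X u)) \<le> Re (cinner u (Z u))" for u
    using pos_part_op_ge[OF bD sD, of u]
    by (simp add: Z_def P_def[symmetric] D_def cinner_add_right cinner.diff_right)
  \<comment> \<open>One number in two roles: the trace occurring in the entropy, and the squared
    norm that the estimate concerns.\<close>
  obtain n where n: "hs (\<lambda>u. powr_op X ((1 - \<nu>) / 2) (powr_op Y (\<nu> / 2) u)) n"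
    "has_trace (\<lambda>u. powr_op X (1 - \<nu>) (powr_op Y \<nu> u)) (complex_of_real n)"
    by (rule trace_powr_product[OF X Y Z z XZ YZ less_imp_le[OF assms(5)] assms(6)])
  have "x - n \<le> \<delta>"
    using trace_powr_product_ge[OF X x(2) Y y(2) Z z XZ YZ _ assms(6) n(1)] assms(5) by simp
  then have "(x - n) / \<nu> \<le> \<delta> / \<nu>"
    using assms(5) by (simp add: divide_right_mono)
  moreover have "trace_op (X - (powr_op X (1 - \<nu>) \<circ> powr_op Y \<nu>)) = complex_of_real (x - n)"
    using trace_op_eqI[OF has_trace_diff[OF x(1) n(2)]] by (simp add: fun_diff_def comp_def)
  moreover have "trace_op (pos_part_op (X - Y)) = complex_of_real \<delta>"
    using trace_op_eqI[OF \<delta>] by (simp add: P_def D_def[abs_def] fun_diff_def)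
  ultimately show ?thesis
    by (simp add: tsallis_rel_entropy_def less_eq_complex_def flip: of_real_divide)
qed

end
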